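(* Let $H$ be an infinite-dimensional real separable Hilbert space and $d\ge1$ an integer. There is $\varepsilon_0>0$ such that the following holds for every $\varepsilon\in(0,\varepsilon_0)$. Let $(P_0,\{B_{j,k}\},\{P_{j,k}\})$ be a coherent collection of balls and planes (CCBP) in $H$ with parameter $\varepsilon$ such that $\varepsilon_k(x_{j,k})<\varepsilon$ for all $k\ge0$ and $j\in J_k$, and let $\sigma_k:H\to H$ and $f=\lim_kf_k:P_0\to H$ be the associated maps. Then $f$ is a bijection onto its image $\Sigma=f(P_0)$ and the following hold (with implied constants independent of $\varepsilon$ and of the CCBP, depending only on $d$; $C$ denotes such a constant). 1. $E_\infty=\bigcap_{K=1}^\infty\overline{\bigcup_{k=K}^\infty\{x_{j,k}\}_{j\in J_k}}\subseteq\Sigma$. 2. $f(x)=x$ for every $x$ in the domain of $f$ with $\operatorname{dist}(x,P_0)>2$. 3. There is $0<\tau<1$ such that if $x,y\in P_0$ and $|x-y|\le1$ then $\frac14|x-y|^{1+\tau}\le|f(x)-f(y)|\le10|x-y|^{1-\tau}$. 4. $|f(x)-x|\lesssim\varepsilon$ for $x\in P_0$. 5. For $x\in P_0$, $f(x)=\lim_{k}\sigma_k\circ\dots\circ\sigma_0(x)$. 6. For $k\ge0$, $\sigma_k(y)=y$ for $y\in H\setminus V_k^{10}$. 7. Let $\Sigma_0=P_0$ and $\Sigma_{k+1}=\sigma_k(\Sigma_k)$. For all $k\ge 0$, $j\in J_k$ there is a Lipschitz function $A_{j,k}:P_{j,k}\cap49B_{j,k}\to P_{j,k}^\perp$ with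 $|A_{j,k}(x_{j,k})|\lesssim\varepsilon r_k$ and $|DA_{j,k}(y)|\lesssim\varepsilon$ for $y\in P_{j,k}\cap49B_{j,k}$, such that if $\Gamma_{j,k}$ is its graph over $P_{j,k}$, then $\Sigma_k\cap D(x_{j,k},P_{j,k},49r_k)=\Gamma_{j,k}\cap D(x_{j,k},P_{j,k},49r_k)$. 8. For $k\ge0$ and $y\in\Sigma_k$ there is an affine $d$-plane $P$ through $y$ and a $C\varepsilon$-Lipschitz $C^2$ function $A:P\to P^\perp$ such that if $\Gamma$ is the graph of $A$ over $P$, then $\Sigma_k\cap B(y,19r_k)=\Gamma\cap B(y,19r_k)$. 9. $\Sigma$ is $C\varepsilon$-Reifenberg flat: for all $z\in\Sigma$ and $t\in(0,1)$ there is a $d$-plane $P=P(z,t)$ with $d_{B(z,t)}(\Sigma,P)\le C\varepsilon$. 10. For all $k\ge 0$ and $y\in\Sigma_k$, $|\sigma_k(y)-y|\lesssim\varepsilon r_k$, and moreover $\operatorname{dist}(y,\Sigma)\lesssim\varepsilon r_k$. 11. For $k\ge0$, $y\in\Sigma_k\cap V_k^8$ and $i\in J_k$ with $y\in10B_{i,k}$, $|\sigma_k(y)-\pi_{i,k}(y)|\lesssim\varepsilon_k(y)r_k$. 12. For $k\ge 0$ and $x,y\in\Sigma_k$, $\angle(T\Sigma_k(x),T\Sigma_k(y))\lesssim\varepsilon\frac{|x-y|}{r_k}$, where $T\Sigma_k(x)$ is the tangent space of $\Sigma_k$ at $x$. 13. For $x\in\Sigma$ and $r>0$, $\mathscr{H}^d_\infty(\Sigma\cap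 B(x,r))\gtrsim r^d$.
   Context: $\mathbb{N}=\{0,1,2,\dots\}$, $r_k=10^{-k}$; a $d$-plane is a $d$-dimensional affine subspace; $P^\perp$ is the linear orthogonal complement of the direction space of $P$; $\lambda B$ is the ball concentric with $B$ and radius multiplied by $\lambda$. For sets $E,F$ and a ball $B$: $d_B(E,F)=\frac{2}{\operatorname{diam}(B)}\max\{\sup_{y\in E\cap B}\operatorname{dist}(y,F),\sup_{y\in F\cap B}\operatorname{dist}(y,E)\}$; $d_{x,r}=d_{B(x,r)}$. For linear $d$-planes $\angle(P,P')=d_{B(0,1)}(P,P')$; for affine ones translate both to the origin. $\mathscr{H}^d_\infty(S)=\inf\{\sum_i\operatorname{diam}(S_i)^d:S\subseteq\bigcup_iS_i\}$. $D(x,P,r)=\{z+w: z\in P\cap B(x,r),\ w\in P^\perp\cap B(0,r)\}$. CCBP with parameter $\varepsilon$: a $d$-plane $P_0$; points $x_{j,k}\in H$ ($k\in\mathbb{N}$, $j\in J_k$) with $|x_{i,k}-x_{j,k}|\ge r_k$ for distinct $i,j\in J_k$; balls $B_{j,k}=B(x_{j,k},r_k)$; $d$-planes $P_{j,k}\ni x_{j,k}$; with $V_k^\lambda=\bigcup_{j\in J_k}\lambda B_{j,k}$, such that (1) $x_{j,k}\in V_{k-1}^2$ for $k\ge1$, $j\in J_k$; (2) $\operatorname{dist}(x_{j,0},P_0)\le\varepsilon$ for $j\in J_0$; (3) $d_{x_{j,k},100r_k}(P_{i,k},P_{j,k})\le\varepsilon$ whenever $i,j\in J_k$, $|x_{i,k}-x_{j,k}|\le100r_k$;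 (4) $d_{x_{j,0},100}(P_{j,0},P_0)\le\varepsilon$ for $j\in J_0$; (5) $d_{x_{i,k},20r_k}(P_{i,k},P_{j,k+1})\le\varepsilon$ whenever $i\in J_k$, $j\in J_{k+1}$, $|x_{i,k}-x_{j,k+1}|\le2r_k$. $\varepsilon_k(x)=\sup\{d_{x_{i,l},10^4r_l}(P_{j,k},P_{i,l}): j\in J_k,\ |l-k|\le2,\ i\in J_l,\ x\in100B_{j,k}\cap100B_{i,l}\}$. $\pi_{j,k}$ is the orthogonal projection onto $P_{j,k}$. For each $k$, $\{\theta_{j,k}\}_{j\in J_k}$ is a fixed family of smooth Lipschitz functions $\theta_{j,k}:H\to[0,1]$ with $\operatorname{supp}\theta_{j,k}\subseteq10B_{j,k}$, $\sum_j\theta_{j,k}\le1$ on $H$, $\sum_j\theta_{j,k}=1$ on $V_k^8$, and $|D^m\theta_{j,k}|\le C(m,d)r_k^{-m}$ for all $m\ge0$ (such families exist for small $\varepsilon$). Define $\sigma_k(y)=y+\sum_{j\in J_k}\theta_{j,k}(y)[\pi_{j,k}(y)-y]$ on $H$, and $f_0(y)=y$, $f_{k+1}=\sigma_k\circ f_k$ on $P_0$; one has $\|f_{k+1}-f_k\|_\infty\le10r_k$, so $f_k$ converges uniformly to a continuous map $f:P_0\to H$. *)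

theory Defs
  imports "HOL-Analysis.Analysis"
begin

text \<open>
  All balls are closed.  The ambient Hilbert space is the whole type \<open>'a\<close>.
\<close>

section \<open>Planes\<close>

text \<open>Direction space of an affine subspace.\<close>

definition directions :: "'a::real_vector set \<Rightarrow> 'a set" where
  "directions P = {u - v | u v. u \<in> P \<and> v \<in> P}"

text \<open>
  A finite basis is required explicitly because \<^const>\<open>dim\<close> is \<open>0\<close> on infinite-dimensional spaces.
\<close>

definition is_plane :: "nat \<Rightarrow> 'a::real_vector set \<Rightarrow> bool" where
  "is_plane d P \<longleftrightarrow> (\<exists>a B. finite B \<and> card B = d \<and> independent B \<and> P = (\<lambda>v. a + v) ` span B)"

abbreviation perp :: "'a::real_inner set \<Rightarrow> 'a set" where
  "perp P \<equiv> orthogonal_comp (directions P)"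

text \<open>
  The library's \<open>closest_point\<close> is restricted to Heine-Borel spaces, hence this definition.
\<close>

definition plane_proj :: "'a::real_inner set \<Rightarrow> 'a \<Rightarrow> 'a" where
  "plane_proj P y = (THE p. p \<in> P \<and> y - p \<in> perp P)"

definition cylinder :: "'a::real_inner \<Rightarrow> 'a set \<Rightarrow> real \<Rightarrow> 'a set" where
  "cylinder x P r = {z + w | z w. z \<in> P \<inter> cball x r \<and> w \<in> perp P \<inter> cball 0 r}"

definition graph_over :: "'a::real_vector set \<Rightarrow> ('a \<Rightarrow> 'a) \<Rightarrow> 'a set" where
  "graph_over S A = {z + A z | z. z \<in> S}"


section \<open>Normalized local Hausdorff distance, angles, Hausdorff content\<close>

text \<open>
  \<open>ball_dist x r E F\<close> is $d_{x,r}(E,F)$.  Inserting \<open>0\<close> makes the supremum over an empty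
  set equal to \<open>0\<close>; it changes nothing otherwise.
\<close>

definition ball_dist :: "'a::real_normed_vector \<Rightarrow> real \<Rightarrow> 'a set \<Rightarrow> 'a set \<Rightarrow> real" where
  "ball_dist x r E F = 2 / diameter (cball x r) *
     max (Sup (insert 0 ((\<lambda>y. infdist y F) ` (E \<inter> cball x r))))
         (Sup (insert 0 ((\<lambda>y. infdist y E) ` (F \<inter> cball x r))))"

definition plane_angle :: "'a::real_normed_vector set \<Rightarrow> 'a set \<Rightarrow> real" where
  "plane_angle P P' = ball_dist 0 1 (directions P) (directions P')"

text \<open>
  Only bounded covering sets are admitted, since \<^const>\<open>diameter\<close> is a real number and carries no
  information for unbounded sets (whose true diameter is infinite).
\<close>

definition hausdorff_content :: "nat \<Rightarrow> 'a::metric_space set \<Rightarrow> ennreal" where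
  "hausdorff_content d S =
     (INF U \<in> {U :: nat \<Rightarrow> 'a set. (\<forall>i. bounded (U i)) \<and> S \<subseteq> (\<Union>i. U i)}.
        \<Sum>i. ennreal (diameter (U i) ^ d))"


section \<open>Higher Frechet derivatives and tangent spaces\<close>

text \<open>\<open>M [v\<^sub>1, \<dots>, v\<^sub>m]\<close> is a bounded \<open>m\<close>-linear map of \<open>v\<^sub>1, \<dots>, v\<^sub>m \<in> V\<close>.\<close>

definition bounded_multilinear_on ::
  "'a::real_normed_vector set \<Rightarrow> nat \<Rightarrow> ('a list \<Rightarrow> 'b::real_normed_vector) \<Rightarrow> bool" where
  "bounded_multilinear_on V m M \<longleftrightarrow>
     (\<forall>us ws. \<forall>v\<in>V. \<forall>w\<in>V. \<forall>c. set us \<subseteq> V \<and> set ws \<subseteq> V \<and> length us + length ws + 1 = m \<longrightarrow>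
        M (us @ (c *\<^sub>R v + w) # ws) = c *\<^sub>R M (us @ v # ws) + M (us @ w # ws)) \<and>
     (\<exists>K. \<forall>vs. length vs = m \<and> set vs \<subseteq> V \<longrightarrow> norm (M vs) \<le> K * prod_list (map norm vs))"

text \<open>
  \<open>f\<close> is of class $C^n$ on the affine subspace \<open>P\<close> and \<open>D y [v\<^sub>1, \<dots>, v\<^sub>m] = D\<^sup>m f(y)(v\<^sub>1, \<dots>, v\<^sub>m)\<close>
  for \<open>m \<le> n\<close> and directions \<open>v\<^sub>i\<close> of \<open>P\<close>.  The third conjunct is Frechet differentiability of
  \<open>D\<^sup>m f\<close> in the operator norm of multilinear maps, the fourth one continuity of \<open>D\<^sup>m f\<close> in
  that norm.
\<close>

definition Cn_with_derivs ::
  "nat \<Rightarrow> 'a::real_normed_vector set \<Rightarrow> ('a \<Rightarrow> 'b::real_normed_vector) \<Rightarrow> ('a \<Rightarrow> 'a list \<Rightarrow> 'b) \<Rightarrow> bool"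
  where
  "Cn_with_derivs n P f D \<longleftrightarrow>
     (\<forall>y\<in>P. D y [] = f y) \<and>
     (\<forall>y\<in>P. \<forall>m\<le>n. bounded_multilinear_on (directions P) m (D y)) \<and>
     (\<forall>y\<in>P. \<forall>m<n. \<forall>e>0. \<forall>\<^sub>F z in at y within P.
        \<forall>vs. length vs = m \<and> set vs \<subseteq> directions P \<longrightarrow>
          norm (D z vs - D y vs - D y ((z - y) # vs)) \<le> e * norm (z - y) * prod_list (map norm vs)) \<and>
     (\<forall>y\<in>P. \<forall>m\<le>n. \<forall>e>0. \<forall>\<^sub>F z in at y within P.
        \<forall>vs. length vs = m \<and> set vs \<subseteq> directions P \<longrightarrow>
          norm (D z vs - D y vs) \<le> e * prod_list (map norm vs))"

definition C2_on_plane ::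
  "'a::real_normed_vector set \<Rightarrow> ('a \<Rightarrow> 'b::real_normed_vector) \<Rightarrow> bool" where
  "C2_on_plane P f \<longleftrightarrow> (\<exists>D. Cn_with_derivs 2 P f D)"

text \<open>Velocities at \<open>x\<close> of curves in \<open>S\<close> through \<open>x\<close>; a linear subspace when \<open>S\<close> is a submanifold.\<close>

definition tangent_space :: "'a::real_normed_vector set \<Rightarrow> 'a \<Rightarrow> 'a set" where
  "tangent_space S x =
     {v. \<exists>\<gamma> :: real \<Rightarrow> 'a. \<gamma> 0 = x \<and> (\<forall>\<^sub>F t in at 0. \<gamma> t \<in> S) \<and> (\<gamma> has_vector_derivative v) (at 0)}"


section \<open>Coherent collections of balls and planes\<close>

definition rad :: "nat \<Rightarrow> real" where
  "rad k = 1 / 10 ^ k"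

text \<open>
  A collection is given by index sets \<open>J k\<close>, centres \<open>x k j\<close> and planes \<open>P k j\<close> (level first);
  the ball $s B_{j,k}$ is \<open>cball (x k j) (s * rad k)\<close>, and \<open>V_set J x k s\<close> is $V_k^s$.
\<close>

definition V_set :: "(nat \<Rightarrow> 'i set) \<Rightarrow> (nat \<Rightarrow> 'i \<Rightarrow> 'a::metric_space) \<Rightarrow> nat \<Rightarrow> real \<Rightarrow> 'a set" where
  "V_set J x k s = (\<Union>j\<in>J k. cball (x k j) (s * rad k))"

definition ccbp ::
  "nat \<Rightarrow> real \<Rightarrow> 'a::real_inner set \<Rightarrow> (nat \<Rightarrow> 'i set) \<Rightarrow> (nat \<Rightarrow> 'i \<Rightarrow> 'a) \<Rightarrow> (nat \<Rightarrow> 'i \<Rightarrow> 'a set) \<Rightarrow> bool"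
  where
  "ccbp d \<epsilon> P0 J x P \<longleftrightarrow>
     is_plane d P0 \<and>
     (\<forall>k. \<forall>j\<in>J k. is_plane d (P k j) \<and> x k j \<in> P k j) \<and>
     (\<forall>k. \<forall>i\<in>J k. \<forall>j\<in>J k. i \<noteq> j \<longrightarrow> dist (x k i) (x k j) \<ge> rad k) \<and>
     (\<forall>k. \<forall>j\<in>J (Suc k). x (Suc k) j \<in> V_set J x k 2) \<and>
     (\<forall>j\<in>J 0. infdist (x 0 j) P0 \<le> \<epsilon>) \<and>
     (\<forall>k. \<forall>i\<in>J k. \<forall>j\<in>J k. dist (x k i) (x k j) \<le> 100 * rad k \<longrightarrow>
        ball_dist (x k j) (100 * rad k) (P k i) (P k j) \<le> \<epsilon>) \<and>
     (\<forall>j\<in>J 0. ball_dist (x 0 j) 100 (P 0 j) P0 \<le> \<epsilon>) \<and>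
     (\<forall>k. \<forall>i\<in>J k. \<forall>j\<in>J (Suc k). dist (x k i) (x (Suc k) j) \<le> 2 * rad k \<longrightarrow>
        ball_dist (x k i) (20 * rad k) (P k i) (P (Suc k) j) \<le> \<epsilon>)"

text \<open>
  $\varepsilon_k(y)$.  The set of values is bounded; \<open>0\<close> is inserted for the case that it is empty.
\<close>

definition eps_at ::
  "(nat \<Rightarrow> 'i set) \<Rightarrow> (nat \<Rightarrow> 'i \<Rightarrow> 'a::real_inner) \<Rightarrow> (nat \<Rightarrow> 'i \<Rightarrow> 'a set) \<Rightarrow> nat \<Rightarrow> 'a \<Rightarrow> real" where
  "eps_at J x P k y = Sup (insert 0
     {ball_dist (x l i) (10 ^ 4 * rad l) (P k j) (P l i) | j l i.
        j \<in> J k \<and> \<bar>int l - int k\<bar> \<le> 2 \<and> i \<in> J l \<and>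
        y \<in> cball (x k j) (100 * rad k) \<inter> cball (x l i) (100 * rad l)})"

text \<open>
  The index sets may be infinite, so sums over \<open>J k\<close> are unordered infinite sums; they have
  only finitely many nonzero terms when \<open>\<epsilon>\<close> is small.  The function \<open>c\<close> stands for the constants
  $C(m,d)$, for the fixed \<open>d\<close>, and bounds the operator norms of the derivatives.
\<close>

definition partition_family ::
  "(nat \<Rightarrow> real) \<Rightarrow> (nat \<Rightarrow> 'i set) \<Rightarrow> (nat \<Rightarrow> 'i \<Rightarrow> 'a::real_inner) \<Rightarrow> (nat \<Rightarrow> 'i \<Rightarrow> 'a \<Rightarrow> real) \<Rightarrow> bool"
  where
  "partition_family c J x \<theta> \<longleftrightarrow>
     (\<forall>k. \<forall>j\<in>J k.
        (\<forall>y. 0 \<le> \<theta> k j y \<and> \<theta> k j y \<le> 1) \<and>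
        (\<exists>L. L-lipschitz_on UNIV (\<theta> k j)) \<and>
        closure {y. \<theta> k j y \<noteq> 0} \<subseteq> cball (x k j) (10 * rad k) \<and>
        (\<exists>D. (\<forall>n. Cn_with_derivs n UNIV (\<theta> k j) D) \<and>
             (\<forall>m y vs. length vs = m \<longrightarrow>
                norm (D y vs) \<le> c m / rad k ^ m * prod_list (map norm vs)))) \<and>
     (\<forall>k y. (\<lambda>j. \<theta> k j y) summable_on J k \<and> (\<Sum>\<^sub>\<infinity>j\<in>J k. \<theta> k j y) \<le> 1) \<and>
     (\<forall>k. \<forall>y\<in>V_set J x k 8. (\<Sum>\<^sub>\<infinity>j\<in>J k. \<theta> k j y) = 1)"

definition sigma_map ::
  "(nat \<Rightarrow> 'i set) \<Rightarrow> (nat \<Rightarrow> 'i \<Rightarrow> 'a::real_inner set) \<Rightarrow> (nat \<Rightarrow> 'i \<Rightarrow> 'a \<Rightarrow> real) \<Rightarrow> nat \<Rightarrow> 'a \<Rightarrow> 'a" where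
  "sigma_map J P \<theta> k y = y + (\<Sum>\<^sub>\<infinity>j\<in>J k. \<theta> k j y *\<^sub>R (plane_proj (P k j) y - y))"

primrec f_seq :: "(nat \<Rightarrow> 'a \<Rightarrow> 'a) \<Rightarrow> nat \<Rightarrow> 'a \<Rightarrow> 'a" where
  "f_seq \<sigma> 0 y = y"
| "f_seq \<sigma> (Suc k) y = \<sigma> k (f_seq \<sigma> k y)"

definition f_lim :: "(nat \<Rightarrow> 'a::t2_space \<Rightarrow> 'a) \<Rightarrow> 'a \<Rightarrow> 'a" where
  "f_lim \<sigma> y = lim (\<lambda>k. f_seq \<sigma> k y)"

primrec surf :: "(nat \<Rightarrow> 'a \<Rightarrow> 'a) \<Rightarrow> 'a set \<Rightarrow> nat \<Rightarrow> 'a set" where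
  "surf \<sigma> P0 0 = P0"
| "surf \<sigma> P0 (Suc k) = \<sigma> k ` surf \<sigma> P0 k"

end

theory Submission
  imports Defs
begin

text \<open>
  On \<open>V\<^sub>k\<^sup>8\<close> the bump functions add up to \<open>1\<close>, so that \<open>\<sigma>\<^sub>k = \<pi>\<^sub>i + \<Sum>\<^sub>l \<theta>\<^sub>l (\<pi>\<^sub>l - \<pi>\<^sub>i)\<close> near the centre \<open>x\<^sub>i\<close>, and
  coherence of the planes makes the sum of order \<open>\<epsilon>\<close> in the scaled \<open>C\<^sup>2\<close> norm.  If \<open>\<Sigma>\<^sub>k\<close> is a flat graph over
  \<open>P\<^sub>i\<close>, then \<open>\<Sigma>\<^sub>k\<^sub>+\<^sub>1\<close> is therefore the image of \<open>P\<^sub>i\<close> under an \<open>\<epsilon>\<close>-perturbation of the identity whose size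
  does not depend on the bounds for \<open>\<Sigma>\<^sub>k\<close>; writing it as a graph over a nearby plane of the next
  generation closes an induction without loss of constants.  Points of \<open>\<Sigma>\<^sub>k\<^sub>+\<^sub>1\<close> away from the new centres
  lose a constant factor at most once, because \<open>\<sigma>\<close> is the identity around them afterwards.

  Hence \<open>\<sigma>\<^sub>k\<close> differs from the identity on \<open>\<Sigma>\<^sub>k\<close> by an \<open>O(\<epsilon>)\<close>-Lipschitz map of size \<open>O(\<epsilon> r\<^sub>k)\<close>, which gives the
  bi-Hoelder bounds, flatness and the estimates for tangent planes.  The content bound follows from
  the Poincare--Miranda theorem: projecting to a plane, the image of a disc under a map close to the
  identity still covers a cube.
\<close>

section \<open>Twice continuously differentiable maps\<close>

text \<open>The constants form a chain \<open>K\<close>, \<open>\<delta> = 400 * K\<close>,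
  \<open>\<gamma> = 26000 * M * \<delta>\<close>, where \<open>M\<close> accounts for the number of
  active bumps and their derivatives. \<open>K\<close> measures how far neighbouring projections
  deviate from each other, \<open>\<delta>\<close> the graphs near the centres,
  \<open>\<gamma>\<close> the graphs near arbitrary points. Only the estimate in terms of
  \<open>K\<close> may be iterated: one that returns a multiple of \<open>\<delta>\<close> would
  grow geometrically with the scale. Every local perturbation is cut off and extended to the whole
  space. A change of the base plane is then an application of Banach's fixed point theorem on a
  complete space, and no domain of an inverse map has to be traced. Balls are not compact here. So
  the active bumps are counted by rounding coordinates in a plane close to the centres, and
  \<open>\<Sigma>\<close> is closed because the lower Hoelder bound turns Cauchy sequences in the
  image into Cauchy sequences in \<open>P0\<close>. One step changes the distance of two nearby
  points by at most one per cent while the radius drops by a factor 10, which leaves ample room for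
  the Hoelder exponent 1/2.\<close>

definition D1 :: "('a::real_normed_vector \<Rightarrow> 'b::real_normed_vector) \<Rightarrow> 'a \<Rightarrow> 'a \<Rightarrow>\<^sub>L 'b" where
  "D1 f x = Blinfun (frechet_derivative f (at x))"

abbreviation D2 :: "('a::real_normed_vector \<Rightarrow> 'b::real_normed_vector) \<Rightarrow> 'a \<Rightarrow> 'a \<Rightarrow>\<^sub>L ('a \<Rightarrow>\<^sub>L 'b)" where
  "D2 f \<equiv> D1 (D1 f)"

definition c1 :: "('a::real_normed_vector \<Rightarrow> 'b::real_normed_vector) \<Rightarrow> bool" where
  "c1 f \<longleftrightarrow> (\<forall>x. f differentiable (at x)) \<and> continuous_on UNIV (D1 f)"

text \<open>Derivatives are operator valued, so the second one is the first derivative of a map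
  between normed spaces and needs no separate calculus. Only maps on the whole space are considered;
  local data are extended by \<open>cutoff_extension\<close>.\<close>

definition c2 :: "('a::real_normed_vector \<Rightarrow> 'b::real_normed_vector) \<Rightarrow> bool" where
  "c2 f \<longleftrightarrow> (\<forall>x. f differentiable (at x)) \<and> c1 (D1 f)"

lemma D1_has_derivative:
  assumes "f differentiable (at x)"
  shows "(f has_derivative blinfun_apply (D1 f x)) (at x)"
proof -
  have "(f has_derivative frechet_derivative f (at x)) (at x)"
    using assms frechet_derivative_works by blast
  then show ?thesis
    unfolding D1_def using bounded_linear_Blinfun_apply has_derivative_bounded_linear by metis
qed

lemma D1_eqI:
  assumes "(f has_derivative blinfun_apply L) (at x)"
  shows "D1 f x = L"
  by (metis D1_def assms blinfun_apply_inverse frechet_derivative_at)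

lemma D1_eqI':
  assumes "(f has_derivative F) (at x)" "\<And>h. blinfun_apply L h = F h"
  shows "D1 f x = L"
proof -
  have "blinfun_apply L = F" using assms(2) by auto
  with assms(1) show ?thesis by (auto intro: D1_eqI)
qed

lemma c1_has_derivative: "c1 f \<Longrightarrow> (f has_derivative blinfun_apply (D1 f x)) (at x)"
  by (simp add: D1_has_derivative c1_def)

lemma c1I:
  assumes "\<And>x. (f has_derivative blinfun_apply (L x)) (at x)" "continuous_on UNIV L"
  shows "c1 f" "D1 f = L"
proof -
  show *: "D1 f = L" using assms(1) D1_eqI by blast
  show "c1 f" unfolding c1_def * using assms by (auto simp: differentiable_def)
qed

lemma c2I:
  assumes "\<And>x. (f has_derivative blinfun_apply (L x)) (at x)" "c1 L"
  shows "c2 f" "D1 f = L"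
proof -
  show *: "D1 f = L" using assms(1) D1_eqI by blast
  show "c2 f" unfolding c2_def * using assms by (auto simp: differentiable_def)
qed

lemma c1_continuous: "c1 f \<Longrightarrow> continuous_on UNIV f"
  by (meson c1_has_derivative has_derivative_at_withinI has_derivative_continuous_on)

lemma c2_c1: "c2 f \<Longrightarrow> c1 f"
  unfolding c2_def by (simp add: c1_continuous c1_def)

lemma c2_D1: "c2 f \<Longrightarrow> c1 (D1 f)"
  by (simp add: c2_def)

lemma c2_continuous: "c2 f \<Longrightarrow> continuous_on UNIV f"
  by (simp add: c1_continuous c2_c1)

lemma D1_cong_open:
  assumes "open U" "x \<in> U" "\<And>y. y \<in> U \<Longrightarrow> f y = g y" "g differentiable (at x)"
  shows "D1 f x = D1 g x"
  using has_derivative_transform_within_open[OF D1_has_derivative[OF assms(4)] assms(1,2)] assms(3)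
  by (intro D1_eqI) auto

lemma D2_cong_open:
  assumes "open U" "x \<in> U" "\<And>y. y \<in> U \<Longrightarrow> f y = g y" "c2 g"
  shows "D2 f x = D2 g x"
proof -
  have "D1 f y = D1 g y" if "y \<in> U" for y
    using D1_cong_open[OF assms(1) that assms(3)] assms(4) by (simp add: c2_def)
  then show ?thesis
    using assms c2_D1[OF assms(4)] by (intro D1_cong_open[OF assms(1,2)]) (auto simp: c1_def)
qed

section \<open>Calculus rules for C^1 and C^2 maps\<close>

lemma c1_linear:
  assumes "bounded_linear F"
  shows "c1 (\<lambda>x. F x + b)" "D1 (\<lambda>x. F x + b) x = Blinfun F"
proof -
  have F: "blinfun_apply (Blinfun F) = F" by (simp add: assms bounded_linear_Blinfun_apply)
  have "((\<lambda>x. F x + b) has_derivative blinfun_apply (Blinfun F)) (at x)" for x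
    unfolding F by (auto intro!: derivative_eq_intros assms[THEN bounded_linear_imp_has_derivative])
  from c1I[OF this] show "c1 (\<lambda>x. F x + b)" "D1 (\<lambda>x. F x + b) x = Blinfun F"
    by (auto intro: continuous_intros)
qed

lemma c1_const: "c1 (\<lambda>x::'a::real_normed_vector. b::'b::real_normed_vector)"
  and D1_const: "D1 (\<lambda>x::'a. b) = (\<lambda>x. 0)"
  using c1I[of "\<lambda>x::'a. b" "\<lambda>x. 0"] by (auto simp: blinfun.zero_left[abs_def] zero_blinfun.rep_eq)

lemma c2_affine:
  assumes "bounded_linear F"
  shows "c2 (\<lambda>x. F x + b)" "D1 (\<lambda>x. F x + b) = (\<lambda>x. Blinfun F)" "D2 (\<lambda>x. F x + b) x = 0"
proof -
  show *: "D1 (\<lambda>x. F x + b) = (\<lambda>x. Blinfun F)" using c1_linear[OF assms] by auto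
  show "c2 (\<lambda>x. F x + b)"
    unfolding c2_def * using c1_linear(1)[OF assms] by (auto simp: c1_const c1_def)
  show "D2 (\<lambda>x. F x + b) x = 0" unfolding * by (simp add: D1_const)
qed

lemma c1_bilinear:
  fixes B :: "'b::real_normed_vector \<Rightarrow> 'c::real_normed_vector \<Rightarrow> 'd::real_normed_vector"
  assumes B: "bounded_bilinear B" and f: "c1 f" and g: "c1 g"
  shows "c1 (\<lambda>x. B (f x) (g x))"
    and "blinfun_apply (D1 (\<lambda>x. B (f x) (g x)) x) h = B (f x) (D1 g x h) + B (D1 f x h) (g x)"
proof -
  interpret bounded_bilinear B by fact
  let ?L = "\<lambda>x. (prod_right (f x) o\<^sub>L D1 g x) + (prod_left (g x) o\<^sub>L D1 f x)"
  have d: "((\<lambda>x. B (f x) (g x)) has_derivative blinfun_apply (?L x)) (at x)" for x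
    using FDERIV[OF c1_has_derivative[OF f] c1_has_derivative[OF g]]
    by (rule has_derivative_eq_rhs) (auto simp: blinfun.add_left prod_left.rep_eq prod_right.rep_eq)
  have "continuous_on UNIV ?L"
    using f g c1_continuous[OF f] c1_continuous[OF g] unfolding c1_def
    by (intro continuous_intros bounded_linear.continuous_on[OF bounded_linear_prod_right]
        bounded_linear.continuous_on[OF bounded_linear_prod_left]) auto
  from c1I[OF d this] show "c1 (\<lambda>x. B (f x) (g x))"
    "blinfun_apply (D1 (\<lambda>x. B (f x) (g x)) x) h = B (f x) (D1 g x h) + B (D1 f x h) (g x)"
    by (auto simp: blinfun.add_left prod_left.rep_eq prod_right.rep_eq)
qed

text \<open>The normalisation of \<open>B\<close> holds for scalar multiplication, composition of
  operators and \<open>tensor_blinfun\<close>, the three products to which this is applied.\<close>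

lemma norm_D1_bilinear:
  assumes B: "bounded_bilinear B" and f: "c1 f" and g: "c1 g"
    and nB: "\<And>a b. norm (B a b) \<le> norm a * norm b"
  shows "norm (D1 (\<lambda>x. B (f x) (g x)) x) \<le> norm (f x) * norm (D1 g x) + norm (D1 f x) * norm (g x)"
proof (rule norm_blinfun_bound)
  fix h
  have "norm (B (f x) (D1 g x h)) \<le> norm (f x) * (norm (D1 g x) * norm h)"
    using nB norm_blinfun[of "D1 g x" h] by (meson mult_left_mono norm_ge_zero order_trans)
  moreover have "norm (B (D1 f x h) (g x)) \<le> (norm (D1 f x) * norm h) * norm (g x)"
    using nB norm_blinfun[of "D1 f x" h] by (meson mult_right_mono norm_ge_zero order_trans)
  ultimately show "norm (blinfun_apply (D1 (\<lambda>x. B (f x) (g x)) x) h) \<le>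
      (norm (f x) * norm (D1 g x) + norm (D1 f x) * norm (g x)) * norm h"
    unfolding c1_bilinear(2)[OF B f g]
    by (intro order_trans[OF norm_triangle_ineq]) (simp add: algebra_simps)
qed simp

lemma c1_add:
  assumes f: "c1 f" and g: "c1 g"
  shows "c1 (\<lambda>x. f x + g x)" "D1 (\<lambda>x. f x + g x) = (\<lambda>x. D1 f x + D1 g x)"
proof -
  have d: "((\<lambda>x. f x + g x) has_derivative blinfun_apply (D1 f x + D1 g x)) (at x)" for x
    using has_derivative_add[OF c1_has_derivative[OF f] c1_has_derivative[OF g]]
    by (rule has_derivative_eq_rhs) (auto simp: blinfun.add_left)
  have "continuous_on UNIV (\<lambda>x. D1 f x + D1 g x)"
    using f g unfolding c1_def by (intro continuous_intros) auto
  from c1I[OF d this] show "c1 (\<lambda>x. f x + g x)" "D1 (\<lambda>x. f x + g x) = (\<lambda>x. D1 f x + D1 g x)"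
    by auto
qed

lemma c2_add:
  assumes f: "c2 f" and g: "c2 g"
  shows "c2 (\<lambda>x. f x + g x)" "D1 (\<lambda>x. f x + g x) = (\<lambda>x. D1 f x + D1 g x)"
    "D2 (\<lambda>x. f x + g x) = (\<lambda>x. D2 f x + D2 g x)"
proof -
  show *: "D1 (\<lambda>x. f x + g x) = (\<lambda>x. D1 f x + D1 g x)"
    using c1_add c2_c1 f g by blast
  show "D2 (\<lambda>x. f x + g x) = (\<lambda>x. D2 f x + D2 g x)"
    unfolding * using c1_add(2)[OF c2_D1[OF f] c2_D1[OF g]] .
  show "c2 (\<lambda>x. f x + g x)"
    unfolding c2_def * using c1_add(1)[OF c2_D1[OF f] c2_D1[OF g]] c1_add(1)[OF f[THEN c2_c1] g[THEN c2_c1]]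
    by (simp add: c1_def)
qed

lemma c2_sum:
  assumes "finite I" "\<And>i. i \<in> I \<Longrightarrow> c2 (f i)"
  shows "c2 (\<lambda>x. \<Sum>i\<in>I. f i x) \<and> D1 (\<lambda>x. \<Sum>i\<in>I. f i x) = (\<lambda>x. \<Sum>i\<in>I. D1 (f i) x) \<and>
    D2 (\<lambda>x. \<Sum>i\<in>I. f i x) = (\<lambda>x. \<Sum>i\<in>I. D2 (f i) x)"
  using assms
proof (induction I rule: finite_induct)
  case empty
  then show ?case using c2_affine[OF bounded_linear_zero, where b=0] by (auto simp: D1_const)
next
  case (insert i I)
  have 1: "c2 (f i)" "c2 (\<lambda>x. \<Sum>i\<in>I. f i x)" using insert by auto
  have "(\<lambda>x. \<Sum>j\<in>insert i I. f j x) = (\<lambda>x. f i x + (\<Sum>j\<in>I. f j x))"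
    using insert(1,2) by simp
  moreover have "D1 (\<lambda>x. \<Sum>j\<in>I. f j x) = (\<lambda>x. \<Sum>j\<in>I. D1 (f j) x)"
    "D2 (\<lambda>x. \<Sum>j\<in>I. f j x) = (\<lambda>x. \<Sum>j\<in>I. D2 (f j) x)" using insert by auto
  ultimately show ?case using c2_add[OF 1] insert(1,2) by simp
qed

lemma norm_D_sum_le:
  fixes f :: "'i \<Rightarrow> 'a::real_normed_vector \<Rightarrow> 'b::real_normed_vector"
  assumes "finite I" "\<And>i. i \<in> I \<Longrightarrow> c2 (f i)"
  shows "(\<And>i. i \<in> I \<Longrightarrow> norm (D1 (f i) x) \<le> a) \<Longrightarrow> norm (D1 (\<lambda>x. \<Sum>i\<in>I. f i x) x) \<le> real (card I) * a"
    and "(\<And>i. i \<in> I \<Longrightarrow> norm (D2 (f i) x) \<le> a) \<Longrightarrow> norm (D2 (\<lambda>x. \<Sum>i\<in>I. f i x) x) \<le> real (card I) * a"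
proof -
  have e: "D1 (\<lambda>x. \<Sum>i\<in>I. f i x) = (\<lambda>x. \<Sum>i\<in>I. D1 (f i) x)"
    "D2 (\<lambda>x. \<Sum>i\<in>I. f i x) = (\<lambda>x. \<Sum>i\<in>I. D2 (f i) x)"
    using c2_sum[of I f, OF assms] by blast+
  show "norm (D1 (\<lambda>x. \<Sum>i\<in>I. f i x) x) \<le> real (card I) * a"
    if "\<And>i. i \<in> I \<Longrightarrow> norm (D1 (f i) x) \<le> a"
    unfolding e(1) using sum_norm_le[of I "\<lambda>i. D1 (f i) x" "\<lambda>_. a"] that by simp
  show "norm (D2 (\<lambda>x. \<Sum>i\<in>I. f i x) x) \<le> real (card I) * a"
    if "\<And>i. i \<in> I \<Longrightarrow> norm (D2 (f i) x) \<le> a"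
    unfolding e(2) using sum_norm_le[of I "\<lambda>i. D2 (f i) x" "\<lambda>_. a"] that by simp
qed

text \<open>The first derivative of a composition is a product of \<open>c1\<close> maps, so the second one follows from
  the product rule for the bilinear composition of operators.\<close>

lemma c1_compose:
  assumes f: "c1 f" and g: "c1 g"
  shows "c1 (\<lambda>x. f (g x))" "D1 (\<lambda>x. f (g x)) = (\<lambda>x. D1 f (g x) o\<^sub>L D1 g x)"
proof -
  have d: "((\<lambda>x. f (g x)) has_derivative blinfun_apply (D1 f (g x) o\<^sub>L D1 g x)) (at x)" for x
    using diff_chain_at[OF c1_has_derivative[OF g] c1_has_derivative[OF f]]
    unfolding o_def by (rule has_derivative_eq_rhs) auto
  have "continuous_on UNIV (\<lambda>x. D1 f (g x) o\<^sub>L D1 g x)"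
    using f g continuous_on_compose2[OF _ c1_continuous[OF g], of UNIV "D1 f"] unfolding c1_def
    by (intro bounded_bilinear.continuous_on[OF bounded_bilinear_blinfun_compose]) simp_all
  from c1I[OF d this] show "c1 (\<lambda>x. f (g x))" "D1 (\<lambda>x. f (g x)) = (\<lambda>x. D1 f (g x) o\<^sub>L D1 g x)"
    by auto
qed

lemma c2_compose:
  assumes f: "c2 f" and g: "c2 g"
  shows "c2 (\<lambda>x. f (g x))"
    and "norm (D1 (\<lambda>x. f (g x)) x) \<le> norm (D1 f (g x)) * norm (D1 g x)"
    and "norm (D2 (\<lambda>x. f (g x)) x) \<le> norm (D1 f (g x)) * norm (D2 g x) + norm (D2 f (g x)) * (norm (D1 g x))\<^sup>2"
proof -
  have D: "D1 (\<lambda>x. f (g x)) = (\<lambda>x. D1 f (g x) o\<^sub>L D1 g x)"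
    by (rule c1_compose(2)[OF c2_c1[OF f] c2_c1[OF g]])
  have c: "c1 (\<lambda>x. D1 f (g x))" "c1 (D1 g)"
    using c1_compose(1)[OF c2_D1[OF f] c2_c1[OF g]] c2_D1[OF g] by auto
  show "c2 (\<lambda>x. f (g x))"
    unfolding c2_def D
    using c1_bilinear(1)[OF bounded_bilinear_blinfun_compose c] c1_compose(1)[OF f[THEN c2_c1] g[THEN c2_c1]]
    by (simp add: c1_def)
  show "norm (D1 (\<lambda>x. f (g x)) x) \<le> norm (D1 f (g x)) * norm (D1 g x)"
    unfolding D by (rule norm_blinfun_compose)
  have "norm (D1 (\<lambda>x. D1 f (g x)) x) \<le> norm (D2 f (g x)) * norm (D1 g x)"
    unfolding c1_compose(2)[OF c2_D1[OF f] c2_c1[OF g]] by (rule norm_blinfun_compose)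
  then have "norm (D1 (\<lambda>x. D1 f (g x)) x) * norm (D1 g x) \<le> norm (D2 f (g x)) * (norm (D1 g x))\<^sup>2"
    by (simp add: mult_right_mono power2_eq_square mult.assoc[symmetric])
  then show "norm (D2 (\<lambda>x. f (g x)) x) \<le> norm (D1 f (g x)) * norm (D2 g x) + norm (D2 f (g x)) * (norm (D1 g x))\<^sup>2"
    using norm_D1_bilinear[OF bounded_bilinear_blinfun_compose c norm_blinfun_compose, of x]
    unfolding D by linarith
qed

text \<open>The rank-one operator is the term of the product rule in which the scalar factor is
  differentiated. As a bounded bilinear operation it can be differentiated once more by
  \<open>c1_bilinear\<close>.\<close>

lift_definition tensor_blinfun :: "('a::real_normed_vector \<Rightarrow>\<^sub>L real) \<Rightarrow> 'b::real_normed_vector \<Rightarrow> 'a \<Rightarrow>\<^sub>L 'b" is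
  "\<lambda>L v h. L h *\<^sub>R v"
  by (rule bounded_linear_scaleR_const)

lemma norm_tensor_blinfun: "norm (tensor_blinfun L v) \<le> norm L * norm v"
  by (rule norm_blinfun_bound)
    (use mult_right_mono[OF norm_blinfun[of L] norm_ge_zero[of v]] in \<open>auto simp: tensor_blinfun.rep_eq mult_ac\<close>)

lemma bounded_bilinear_tensor_blinfun: "bounded_bilinear tensor_blinfun"
proof
  show "\<exists>K. \<forall>a b. norm (tensor_blinfun a b) \<le> norm a * norm b * K"
    using norm_tensor_blinfun by (intro exI[of _ 1]) auto
qed (auto intro!: blinfun_eqI simp: tensor_blinfun.rep_eq blinfun.bilinear_simps algebra_simps)

lemma c2_scaleR:
  fixes s :: "'a::real_normed_vector \<Rightarrow> real" and f :: "'a \<Rightarrow> 'b::real_normed_vector"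
  assumes s: "c2 s" and f: "c2 f"
  shows "c2 (\<lambda>x. s x *\<^sub>R f x)"
    and "norm (D1 (\<lambda>x. s x *\<^sub>R f x) x) \<le> \<bar>s x\<bar> * norm (D1 f x) + norm (D1 s x) * norm (f x)"
    and "norm (D2 (\<lambda>x. s x *\<^sub>R f x) x) \<le>
      \<bar>s x\<bar> * norm (D2 f x) + 2 * norm (D1 s x) * norm (D1 f x) + norm (D2 s x) * norm (f x)"
proof -
  note c = s[THEN c2_c1] f[THEN c2_c1]
  have D: "D1 (\<lambda>x. s x *\<^sub>R f x) = (\<lambda>x. s x *\<^sub>R D1 f x + tensor_blinfun (D1 s x) (f x))"
    by (auto intro!: blinfun_eqI
        simp: c1_bilinear(2)[OF bounded_bilinear_scaleR c] tensor_blinfun.rep_eq blinfun.bilinear_simps)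
  have 1: "c1 (\<lambda>x. s x *\<^sub>R D1 f x)"
    by (rule c1_bilinear(1)[OF bounded_bilinear_scaleR c(1) c2_D1[OF f]])
  have 2: "c1 (\<lambda>x. tensor_blinfun (D1 s x) (f x))"
    by (rule c1_bilinear(1)[OF bounded_bilinear_tensor_blinfun c2_D1[OF s] c(2)])
  show "c2 (\<lambda>x. s x *\<^sub>R f x)"
    unfolding c2_def D using c1_add(1)[OF 1 2] c1_bilinear(1)[OF bounded_bilinear_scaleR c]
    by (simp add: c1_def)
  show "norm (D1 (\<lambda>x. s x *\<^sub>R f x) x) \<le> \<bar>s x\<bar> * norm (D1 f x) + norm (D1 s x) * norm (f x)"
    using norm_D1_bilinear[OF bounded_bilinear_scaleR c] by simp
  have "norm (D1 (\<lambda>x. s x *\<^sub>R D1 f x) x) \<le> \<bar>s x\<bar> * norm (D2 f x) + norm (D1 s x) * norm (D1 f x)"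
    using norm_D1_bilinear[OF bounded_bilinear_scaleR c(1) c2_D1[OF f]] by simp
  moreover have "norm (D1 (\<lambda>x. tensor_blinfun (D1 s x) (f x)) x) \<le>
      norm (D1 s x) * norm (D1 f x) + norm (D2 s x) * norm (f x)"
    using norm_D1_bilinear[OF bounded_bilinear_tensor_blinfun c2_D1[OF s] c(2) norm_tensor_blinfun] .
  moreover have "D2 (\<lambda>x. s x *\<^sub>R f x) x =
      D1 (\<lambda>x. s x *\<^sub>R D1 f x) x + D1 (\<lambda>x. tensor_blinfun (D1 s x) (f x)) x"
    unfolding D using c1_add(2)[OF 1 2] by simp
  ultimately show "norm (D2 (\<lambda>x. s x *\<^sub>R f x) x) \<le>
      \<bar>s x\<bar> * norm (D2 f x) + 2 * norm (D1 s x) * norm (D1 f x) + norm (D2 s x) * norm (f x)"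
    using norm_triangle_ineq[of "D1 (\<lambda>x. s x *\<^sub>R D1 f x) x" "D1 (\<lambda>x. tensor_blinfun (D1 s x) (f x)) x"]
    by simp
qed

lemma c1_lipschitz:
  assumes f: "c1 f" and S: "convex S" and b: "\<And>z. z \<in> S \<Longrightarrow> norm (D1 f z) \<le> K" and "x \<in> S" "y \<in> S"
  shows "norm (f x - f y) \<le> K * norm (x - y)"
proof (rule differentiable_bound[OF S])
  show "(f has_derivative blinfun_apply (D1 f z)) (at z within S)" for z
    using c1_has_derivative[OF f] has_derivative_at_withinI by blast
  show "onorm (blinfun_apply (D1 f z)) \<le> K" if "z \<in> S" for z
    using b[OF that] by (simp add: norm_blinfun.rep_eq)
qed (use assms in auto)

subsection \<open>The inverse of a small perturbation of the identity\<close>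

lemma id_plus_contraction:
  fixes e :: "'a::{real_normed_vector,complete_space} \<Rightarrow> 'a"
  assumes e: "\<And>x y. norm (e x - e y) \<le> 1/2 * norm (x - y)"
  shows "\<exists>!x. x + e x = y"
proof -
  have "\<exists>!x. y - e x = x"
    by (rule banach_fix_type[of "1/2"]) (use e in \<open>auto simp: dist_norm norm_minus_commute\<close>)
  then show ?thesis by (metis add_diff_cancel_right' diff_add_cancel)
qed

lemma id_plus_contraction_dist:
  fixes e :: "'a::real_normed_vector \<Rightarrow> 'a"
  assumes e: "\<And>x y. norm (e x - e y) \<le> 1/2 * norm (x - y)"
  shows "norm (x - y) \<le> 2 * norm (x + e x - (y + e y))"
proof -
  have "norm (x - y) \<le> norm (x + e x - (y + e y)) + norm (e x - e y)"
    using norm_triangle_ineq4[of "x + e x - (y + e y)" "e x - e y"] by (simp add: algebra_simps)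
  then show ?thesis using e[of x y] by linarith
qed

text \<open>The fixed point argument replaces the Neumann series; linearity of the inverse follows
  from uniqueness of the solution.\<close>

lemma id_plus_blinfun_inverse:
  fixes N :: "'a::{real_normed_vector,complete_space} \<Rightarrow>\<^sub>L 'a"
  assumes N: "norm N \<le> 1/2"
  shows "\<exists>M. M o\<^sub>L (id_blinfun + N) = id_blinfun \<and> (id_blinfun + N) o\<^sub>L M = id_blinfun \<and> norm M \<le> 2"
proof -
  have e: "norm (N x - N y) \<le> 1/2 * norm (x - y)" for x y
    using norm_blinfun[of N "x - y"] mult_right_mono[OF N, of "norm (x - y)"]
    by (simp add: blinfun.diff_right)
  define m where "m y = (THE x. x + N x = y)" for y
  have m: "m y + N (m y) = y" for y
    unfolding m_def by (rule theI'[OF id_plus_contraction[of N]]) (use e in auto)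
  have mu: "m y = x" if "x + N x = y" for x y
    using id_plus_contraction[of N y] e m[of y] that by auto
  have nm: "norm (m y) \<le> 2 * norm y" for y
    using id_plus_contraction_dist[of N "m y" 0] e m[of y] by (simp add: blinfun.zero_right)
  have bl: "bounded_linear m"
  proof (rule bounded_linear_intro[where K=2])
    show "m (x + y) = m x + m y" for x y
      by (rule mu) (metis (no_types, lifting) add.assoc add.left_commute blinfun.add_right m)
    show "m (r *\<^sub>R x) = r *\<^sub>R m x" for r x
      by (rule mu) (metis blinfun.scaleR_right m scaleR_add_right)
    show "norm (m x) \<le> norm x * 2" for x using nm[of x] by simp
  qed
  have M: "blinfun_apply (Blinfun m) = m" by (simp add: bl bounded_linear_Blinfun_apply)
  show ?thesis
    by (rule exI[of _ "Blinfun m"])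
      (auto intro!: blinfun_eqI norm_blinfun_bound nm mu simp: M blinfun.add_left m)
qed

text \<open>Near \<open>x\<close> one factor \<open>norm (N y - N x)\<close> is of order
  \<open>norm (y - x)\<close> and the other tends to 0, so \<open>R\<close> is of smaller order than
  \<open>norm (y - x)\<close>. This handles the remainder when operator inverses are differentiated
  in \<open>c2_inverse\<close>.\<close>

lemma has_derivative_zero_quadratic:
  assumes N: "N differentiable (at x)" and R: "\<And>y. norm (R y) \<le> K * (norm (N y - N x))\<^sup>2"
  shows "(R has_derivative (\<lambda>h. 0)) (at x)"
proof -
  obtain N' where N': "(N has_derivative N') (at x)" using N by (auto simp: differentiable_def)
  have q: "((\<lambda>y. norm (N y - N x) / norm (y - x) * norm (N y - N x)) \<longlongrightarrow> 0) (at x)"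
  proof -
    obtain k where k: "\<And>h. norm (N' h) \<le> norm h * k" "k > 0"
      using N' has_derivative_bounded_linear bounded_linear.pos_bounded by metis
    have 0: "((\<lambda>y. norm (N y - N x - N' (y - x)) / norm (y - x)) \<longlongrightarrow> 0) (at x)"
      using N' unfolding has_derivative_iff_norm by auto
    have ev: "\<forall>\<^sub>F y in at x. norm (N y - N x) / norm (y - x) \<le> 1 + k"
      using order_tendstoD(2)[OF 0, of 1, OF zero_less_one] eventually_neq_at_within[of x x UNIV]
    proof eventually_elim
      case (elim y)
      then have p: "norm (y - x) > 0" by auto
      have "norm (N y - N x - N' (y - x)) \<le> norm (y - x)" using elim p by (simp add: divide_simps)
      then have "norm (N y - N x) \<le> norm (y - x) + norm (y - x) * k"
        using norm_triangle_ineq[of "N y - N x - N' (y - x)" "N' (y - x)"] k(1)[of "y - x"] by simp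
      then show ?case using p by (simp add: divide_simps algebra_simps)
    qed
    have "isCont N x" using N differentiable_imp_continuous_within by blast
    then have "((\<lambda>y. (1 + k) * norm (N y - N x)) \<longlongrightarrow> 0) (at x)"
      by (intro tendsto_mult_right_zero tendsto_norm_zero) (auto simp: isCont_def LIM_zero_iff)
    then show ?thesis
    proof (rule Lim_null_comparison[rotated])
      show "\<forall>\<^sub>F y in at x. norm (norm (N y - N x) / norm (y - x) * norm (N y - N x)) \<le> (1 + k) * norm (N y - N x)"
        using ev
      proof eventually_elim
        case (elim y)
        have "norm (norm (N y - N x) / norm (y - x) * norm (N y - N x)) = norm (N y - N x) / norm (y - x) * norm (N y - N x)"
          unfolding real_norm_def by (intro abs_of_nonneg mult_nonneg_nonneg divide_nonneg_nonneg norm_ge_zero)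
        then show ?case using mult_right_mono[OF elim norm_ge_zero] by metis
      qed
    qed
  qed
  have R0: "R x = 0" using R[of x] by simp
  have "((\<lambda>y. norm (R y - R x - 0) / norm (y - x)) \<longlongrightarrow> 0) (at x)"
  proof (rule Lim_null_comparison)
    show "((\<lambda>y. K * (norm (N y - N x) / norm (y - x) * norm (N y - N x))) \<longlongrightarrow> 0) (at x)"
      using q by (rule tendsto_mult_right_zero)
    show "\<forall>\<^sub>F y in at x. norm (norm (R y - R x - 0) / norm (y - x)) \<le>
        K * (norm (N y - N x) / norm (y - x) * norm (N y - N x))"
      using R R0 by (intro always_eventually) (auto simp: power2_eq_square divide_right_mono)
  qed
  then show ?thesis unfolding has_derivative_iff_norm by auto
qed

text \<open>The derivative of the inverse is \<open>M x\<close>, the inverse of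
  \<open>id_blinfun + N x\<close> with \<open>N x = D1 e (\<psi> x)\<close>. Differentiating it once
  more gives minus \<open>M x\<close> composed with \<open>D1 N\<close> and \<open>M x\<close>; as
  \<open>norm (M x) \<le> 2\<close> and \<open>norm (D1 N x)\<close> is at most twice
  \<open>norm (D2 e (\<psi> x))\<close>, this produces the factor 8.\<close>

lemma c2_inverse:
  fixes e :: "'a::{real_normed_vector,complete_space} \<Rightarrow> 'a"
  assumes e: "c2 e" and b: "\<And>x. norm (D1 e x) \<le> 1/2"
  obtains \<psi> where "c2 \<psi>" "\<And>x. \<psi> x + e (\<psi> x) = x" "\<And>x. \<psi> (x + e x) = x"
    "\<And>x. norm (D1 \<psi> x) \<le> 2" "\<And>x. norm (D2 \<psi> x) \<le> 8 * norm (D2 e (\<psi> x))"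
    "\<And>x y. norm (\<psi> x - \<psi> y) \<le> 2 * norm (x - y)"
proof -
  have lip: "norm (e x - e y) \<le> 1/2 * norm (x - y)" for x y
    using c1_lipschitz[OF c2_c1[OF e] convex_UNIV] b by blast
  define \<psi> where "\<psi> y = (THE x. x + e x = y)" for y
  have r: "\<psi> y + e (\<psi> y) = y" for y
    unfolding \<psi>_def by (rule theI'[OF id_plus_contraction[of e]]) (use lip in auto)
  have l: "\<psi> (x + e x) = x" for x
    using id_plus_contraction[of e] lip r by metis
  have lp: "norm (\<psi> x - \<psi> y) \<le> 2 * norm (x - y)" for x y
    using id_plus_contraction_dist[of e "\<psi> x" "\<psi> y"] lip r by simp
  have ct: "continuous_on UNIV \<psi>"
    by (rule lipschitz_on_continuous_on[of 2]) (use lp in \<open>auto simp: lipschitz_on_def dist_norm\<close>)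
  define N where "N x = D1 e (\<psi> x)" for x
  have nN: "norm (N x) \<le> 1/2" for x unfolding N_def by (rule b)
  obtain M where M: "\<And>x. M x o\<^sub>L (id_blinfun + N x) = id_blinfun" "\<And>x. (id_blinfun + N x) o\<^sub>L M x = id_blinfun"
    "\<And>x. norm (M x) \<le> 2"
    using id_plus_blinfun_inverse[OF nN] by metis
  have d\<psi>: "(\<psi> has_derivative blinfun_apply (M y)) (at y)" for y
  proof (rule has_derivative_inverse_basic[where f="\<lambda>x. x + e x" and f'="blinfun_apply (id_blinfun + N y)" and T=UNIV])
    show "((\<lambda>x. x + e x) has_derivative blinfun_apply (id_blinfun + N y)) (at (\<psi> y))"
      using has_derivative_add[OF has_derivative_ident c1_has_derivative[OF c2_c1[OF e], of "\<psi> y"]]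
      by (rule has_derivative_eq_rhs) (auto simp: N_def blinfun.add_left)
    show "blinfun_apply (M y) \<circ> blinfun_apply (id_blinfun + N y) = id"
      using arg_cong[OF M(1)[of y], of blinfun_apply] by (auto simp: fun_eq_iff)
    show "continuous (at y) \<psi>" using ct by (simp add: continuous_on_eq_continuous_at)
  qed (auto simp: r blinfun.bounded_linear_right)
  \<comment> \<open>The resolvent identity, which yields both the continuity and the
    differentiability of \<open>M\<close>.\<close>
  have MM: "M y - M x = - (M x o\<^sub>L (N y - N x) o\<^sub>L M y)" for x y
  proof -
    have "M x o\<^sub>L ((id_blinfun + N y) - (id_blinfun + N x)) o\<^sub>L M y = 
      (M x o\<^sub>L ((id_blinfun + N y) o\<^sub>L M y)) - ((M x o\<^sub>L (id_blinfun + N x)) o\<^sub>L M y)"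
      by (auto intro!: blinfun_eqI simp: blinfun.bilinear_simps)
    also have "\<dots> = M x - M y" unfolding M by (auto intro!: blinfun_eqI simp: blinfun.bilinear_simps)
    finally show ?thesis by simp
  qed
  have nM3: "norm (M x o\<^sub>L X o\<^sub>L M y) \<le> 4 * norm X" for X x y
  proof -
    have "norm (M x o\<^sub>L X o\<^sub>L M y) \<le> norm (M x) * norm X * norm (M y)"
      by (meson mult_right_mono norm_blinfun_compose norm_ge_zero order_trans)
    also have "\<dots> \<le> 2 * norm X * 2" by (intro mult_mono M) auto
    finally show ?thesis by simp
  qed
  have cM: "continuous_on UNIV M"
  proof -
    have "continuous_on UNIV N"
      unfolding N_def[abs_def] by (rule continuous_on_compose2[OF c1_continuous[OF c2_D1[OF e]] ct]) simp
    then have N0: "((\<lambda>y. 4 * norm (N y - N x)) \<longlongrightarrow> 0) (at x)" for x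
      by (intro tendsto_mult_right_zero tendsto_norm_zero LIM_zero)
        (metis continuous_on_def iso_tuple_UNIV_I)
    have b: "norm (M y - M x) \<le> 4 * norm (N y - N x)" for x y
      unfolding MM[of y x] norm_minus_cancel by (rule nM3)
    have "((\<lambda>y. M y - M x) \<longlongrightarrow> 0) (at x)" for x
      by (rule Lim_null_comparison[OF always_eventually N0]) (use b in blast)
    then have "(M \<longlongrightarrow> M x) (at x)" for x by (rule LIM_zero_cancel)
    then show ?thesis unfolding continuous_on_def by blast
  qed
  have D\<psi>: "D1 \<psi> = M" and c\<psi>: "c1 \<psi>" using c1I[OF d\<psi> cM] by auto
  have c1N: "c1 N" and D1N: "D1 N = (\<lambda>x. D2 e (\<psi> x) o\<^sub>L M x)"
    unfolding N_def[abs_def] using c1_compose[OF c2_D1[OF e] c\<psi>] D\<psi> by auto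
  define T where "T x X = - (M x o\<^sub>L X o\<^sub>L M x)" for x X
  have blT: "bounded_linear (T x)" for x
    unfolding T_def
    by (intro bounded_linear_minus bounded_linear_compose[OF bounded_bilinear.bounded_linear_left[OF bounded_bilinear_blinfun_compose]
          bounded_bilinear.bounded_linear_right[OF bounded_bilinear_blinfun_compose]])
  define L where "L x = Blinfun (T x) o\<^sub>L D1 N x" for x
  have bT: "blinfun_apply (Blinfun (T x)) = T x" for x by (simp add: blT bounded_linear_Blinfun_apply)
  have dM: "(M has_derivative blinfun_apply (L x)) (at x)" for x
  proof -
    define R where "R y = M y - M x - T x (N y - N x)" for y
    \<comment> \<open>Applying the resolvent identity a second time, to the factor
      \<open>M y - M x\<close>, shows that the remainder is quadratic in
      \<open>N y - N x\<close>.\<close>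
    have Req: "R y = M x o\<^sub>L (N y - N x) o\<^sub>L (M x o\<^sub>L (N y - N x) o\<^sub>L M y)" for y
    proof -
      have a: "- (A o\<^sub>L X o\<^sub>L B) - (- (A o\<^sub>L X o\<^sub>L A)) = - (A o\<^sub>L X o\<^sub>L (B - A))"
        for A X B :: "'a \<Rightarrow>\<^sub>L 'a"
        by (rule blinfun_eqI) (simp add: blinfun.diff_left blinfun.diff_right blinfun.minus_left)
      have b: "- (A o\<^sub>L X o\<^sub>L (- B)) = A o\<^sub>L X o\<^sub>L B" for A X B :: "'a \<Rightarrow>\<^sub>L 'a"
        by (rule blinfun_eqI) (simp add: blinfun.minus_right blinfun.minus_left)
      have "R y = - (M x o\<^sub>L (N y - N x) o\<^sub>L M y) - (- (M x o\<^sub>L (N y - N x) o\<^sub>L M x))"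
        unfolding R_def T_def by (subst MM[of y x]) (rule refl)
      also have "\<dots> = - (M x o\<^sub>L (N y - N x) o\<^sub>L (M y - M x))" by (rule a)
      also have "\<dots> = M x o\<^sub>L (N y - N x) o\<^sub>L (M x o\<^sub>L (N y - N x) o\<^sub>L M y)"
        by (subst MM[of y x]) (rule b)
      finally show ?thesis .
    qed
    have nR: "norm (R y) \<le> 8 * (norm (N y - N x))\<^sup>2" for y
    proof -
      have "norm (R y) \<le> norm (M x o\<^sub>L (N y - N x)) * norm (M x o\<^sub>L (N y - N x) o\<^sub>L M y)"
        unfolding Req by (rule norm_blinfun_compose)
      also have "\<dots> \<le> (2 * norm (N y - N x)) * (4 * norm (N y - N x))"
        by (intro mult_mono nM3 order_trans[OF norm_blinfun_compose] M) auto
      finally show ?thesis by (simp add: power2_eq_square)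
    qed
    have "(R has_derivative (\<lambda>h. 0)) (at x)"
      by (rule has_derivative_zero_quadratic[where N=N and K=8]) (use c1N nR in \<open>auto simp: c1_def\<close>)
    moreover have "((\<lambda>y. T x (N y - N x)) has_derivative (\<lambda>h. T x (D1 N x h))) (at x)"
      by (rule bounded_linear.has_derivative[OF blT])
        (use has_derivative_diff[OF c1_has_derivative[OF c1N] has_derivative_const] in auto)
    ultimately have "((\<lambda>y. M x + (R y + T x (N y - N x))) has_derivative (\<lambda>h. 0 + (0 + T x (D1 N x h)))) (at x)"
      by (intro has_derivative_add has_derivative_const)
    moreover have "M x + (R y + T x (N y - N x)) = M y" for y by (simp add: R_def)
    moreover have "(\<lambda>h. 0 + (0 + T x (D1 N x h))) = blinfun_apply (L x)"
      by (simp add: L_def fun_eq_iff bT)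
    ultimately show ?thesis by simp
  qed
  have nL: "norm (L x) \<le> 8 * norm (D2 e (\<psi> x))" for x
  proof -
    have "norm (Blinfun (T x)) \<le> 4"
      by (rule norm_blinfun_bound) (auto simp: bT T_def nM3)
    moreover have "norm (D1 N x) \<le> norm (D2 e (\<psi> x)) * 2"
      unfolding D1N by (rule order_trans[OF norm_blinfun_compose]) (simp add: M mult_left_mono)
    ultimately have "norm (L x) \<le> 4 * (norm (D2 e (\<psi> x)) * 2)"
      unfolding L_def by (intro order_trans[OF norm_blinfun_compose] mult_mono) auto
    then show ?thesis by simp
  qed
  have cL: "continuous_on UNIV L"
  proof -
    have "continuous_on UNIV (\<lambda>x. Blinfun (T x))"
    proof -
      interpret bounded_bilinear "blinfun_compose :: ('a \<Rightarrow>\<^sub>L 'a) \<Rightarrow> ('a \<Rightarrow>\<^sub>L 'a) \<Rightarrow> ('a \<Rightarrow>\<^sub>L 'a)"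
        by (rule bounded_bilinear_blinfun_compose)
      \<comment> \<open>Written as a product of a left and a right multiplication, the operator
        visibly depends continuously on \<open>M x\<close> in operator norm.\<close>
      have "Blinfun (T x) = - (prod_left (M x) o\<^sub>L prod_right (M x))" for x
        by (rule blinfun_eqI) (auto simp: bT T_def prod_left.rep_eq prod_right.rep_eq blinfun.bilinear_simps)
      then show ?thesis
        using cM by (auto intro!: continuous_intros bounded_linear.continuous_on[OF bounded_linear_prod_right]
            bounded_linear.continuous_on[OF bounded_linear_prod_left])
    qed
    then show ?thesis
      unfolding L_def using c1N
      by (intro bounded_bilinear.continuous_on[OF bounded_bilinear_blinfun_compose]) (auto simp: c1_def)
  qed
  have "c2 \<psi>" "D2 \<psi> = L" using c1I[OF dM cL] c\<psi> by (auto simp: c2_def c1_def D\<psi>)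
  then show ?thesis
    using that r l lp nL M(3) by (auto simp: D\<psi>)
qed

subsection \<open>Cutoff functions\<close>

lemma has_derivative_max0_power:
  fixes x :: real
  assumes n: "n \<ge> 2"
  shows "((\<lambda>t. max 0 t ^ n) has_real_derivative real n * max 0 x ^ (n - 1)) (at x)"
proof -
  consider "x > 0" | "x < 0" | "x = 0" by linarith
  then show ?thesis
  proof cases
    case 1
    have "((\<lambda>t. t ^ n) has_real_derivative real n * x ^ (n - 1)) (at x)"
      by (auto intro!: derivative_eq_intros)
    then have "((\<lambda>t. max 0 t ^ n) has_real_derivative real n * x ^ (n - 1)) (at x)"
      by (rule has_field_derivative_transform_within[where d=x]) (use 1 in \<open>auto simp: dist_real_def\<close>)
    then show ?thesis using 1 by simp
  next
    case 2
    have "((\<lambda>t. 0) has_real_derivative 0) (at x)" by simp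
    then have "((\<lambda>t. max 0 t ^ n) has_real_derivative 0) (at x)"
      by (rule has_field_derivative_transform_within[where d="-x"]) (use 2 n in \<open>auto simp: dist_real_def\<close>)
    moreover have "n - Suc 0 > 0" using n by simp
    ultimately show ?thesis using 2 by (simp add: zero_power)
  next
    case 3
    obtain m where m: "n = Suc (Suc m)" using n by (metis Suc_le_D numeral_2_eq_2 Suc_le_mono)
    have "((\<lambda>h. max 0 h ^ Suc m) \<longlongrightarrow> max 0 (0::real) ^ Suc m) (at 0)"
      by (intro tendsto_intros)
    then have "((\<lambda>h. max 0 h ^ Suc m) \<longlongrightarrow> (0::real)) (at 0)" by simp
    then have "((\<lambda>h. max 0 (0 + h) ^ n / h - max 0 0 ^ n / h) \<longlongrightarrow> (0::real)) (at 0)"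
      by (rule Lim_null_comparison[rotated])
        (auto intro!: always_eventually simp: m max_def)
    then show ?thesis using 3 n by (simp add: DERIV_def diff_divide_distrib m)
  qed
qed

lemma norm_blinfun_mult_right_real: "norm (blinfun_mult_right (a::real)) \<le> \<bar>a\<bar>"
  by (rule norm_blinfun_bound) (auto simp: blinfun_mult_right.rep_eq abs_mult)

text \<open>The cube is the lowest integer power of the positive part that is twice continuously
  differentiable. The bounds are restricted to \<open>t \<le> 1\<close>, the range in which the
  cutoff is not locally constant.\<close>

lemma c2_max0_cube:
  defines "p \<equiv> (\<lambda>t::real. max 0 t ^ 3)"
  shows "c2 p" "\<And>t. t \<le> 1 \<Longrightarrow> norm (D1 p t) \<le> 3" "\<And>t. t \<le> 1 \<Longrightarrow> norm (D2 p t) \<le> 6"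
proof -
  let ?L = "\<lambda>t. blinfun_mult_right (3 * max 0 t ^ 2 :: real)"
  let ?M = "\<lambda>t. Blinfun (\<lambda>h. blinfun_mult_right (6 * max 0 t * h :: real))"
  have bl: "bounded_linear (\<lambda>h. blinfun_mult_right (6 * max 0 t * h))" for t :: real
    by (intro bounded_linear_compose[OF bounded_linear_blinfun_mult_right] bounded_linear_mult_right)
  have d1: "(p has_derivative blinfun_apply (?L t)) (at t)" for t
    using has_derivative_max0_power[of 3 t]
    by (simp add: has_field_derivative_def p_def blinfun_mult_right.rep_eq)
  have d2: "(?L has_derivative blinfun_apply (?M t)) (at t)" for t
  proof -
    have "((\<lambda>t. 3 * max 0 t ^ 2) has_derivative (\<lambda>h. 6 * max 0 t * h)) (at t)"
      using DERIV_cmult[OF has_derivative_max0_power[of 2 t], of 3] by (simp add: has_field_derivative_def)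
    from bounded_linear.has_derivative[OF bounded_linear_blinfun_mult_right this]
    show ?thesis by (simp add: bounded_linear_Blinfun_apply[OF bl])
  qed
  have M: "?M t = (6 * max 0 t) *\<^sub>R Blinfun blinfun_mult_right" for t
    by (intro blinfun_eqI)
      (simp add: bounded_linear_Blinfun_apply[OF bl] blinfun.scaleR_left
        bounded_linear_Blinfun_apply[OF bounded_linear_blinfun_mult_right] blinfun_mult_right.rep_eq)
  have cM: "continuous_on UNIV ?M" unfolding M by (intro continuous_intros)
  have c: "c1 ?L" "D1 ?L = ?M" using c1I[OF d2 cM] by auto
  show "c2 p" by (rule c2I(1)[OF d1 c(1)])
  have D: "D1 p = ?L" by (rule c2I(2)[OF d1 c(1)])
  show "norm (D1 p t) \<le> 3" if "t \<le> 1" for t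
  proof -
    have "max 0 t ^ 2 \<le> 1" using that by (auto simp: max_def power_le_one)
    then show ?thesis unfolding D using norm_blinfun_mult_right_real[of "3 * max 0 t ^ 2"] by simp
  qed
  show "norm (D2 p t) \<le> 6" if "t \<le> 1" for t
    unfolding D c(2)
  proof (rule norm_blinfun_bound)
    fix h
    have "\<bar>6 * max 0 t * h\<bar> \<le> 6 * norm h" using that by (auto simp: abs_mult max_def intro!: mult_left_le_one_le)
    then show "norm (?M t h) \<le> 6 * norm h"
      unfolding bounded_linear_Blinfun_apply[OF bl] using norm_blinfun_mult_right_real order_trans by blast
  qed simp
qed

lemma cutoff:
  fixes x :: "'a::real_inner"
  assumes r: "\<rho> > 0"
  obtains \<kappa> :: "'a \<Rightarrow> real" where "c2 \<kappa>" "\<And>y. 0 \<le> \<kappa> y \<and> \<kappa> y \<le> 1"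
    "\<And>y. norm (y - x) \<le> \<rho> \<Longrightarrow> \<kappa> y = 1" "\<And>y. norm (y - x) \<ge> 1.05 * \<rho> \<Longrightarrow> \<kappa> y = 0"
    "\<And>y. norm (D1 \<kappa> y) \<le> 200 / \<rho>" "\<And>y. norm (D2 \<kappa> y) \<le> 32000 / \<rho>\<^sup>2"
proof -
  define p where "p t = max 0 t ^ 3" for t :: real
  note p = c2_max0_cube[folded p_def[abs_def]]
  define g where "g t = - p t + 1" for t
  \<comment> \<open>The profile falls from 1 at \<open>t = 0\<close> to 0 at \<open>t = 1\<close>,
    and is C^2 at both ends because it is a composition of C^2 functions.\<close>
  define b where "b t = p (g t)" for t
  have um: "bounded_linear (\<lambda>t::real. - t)" by (intro bounded_linear_minus bounded_linear_ident)
  have nu: "norm (Blinfun (\<lambda>t::real. - t)) \<le> 1"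
    by (rule norm_blinfun_bound) (auto simp: bounded_linear_Blinfun_apply[OF um])
  have g: "c2 g" "norm (D1 g t) \<le> 3" "norm (D2 g t) \<le> 6" if "t \<le> 1" for t
  proof -
    note a = c2_affine[OF um, of 1]
    show "c2 g" unfolding g_def[abs_def] using c2_compose(1)[OF a(1) p(1)] .
    have "norm (D1 g t) \<le> norm (Blinfun (\<lambda>t::real. - t)) * norm (D1 p t)"
      unfolding g_def[abs_def] using c2_compose(2)[OF a(1) p(1), of t] a(2) by simp
    also have "\<dots> \<le> 1 * 3" by (intro mult_mono nu p that) auto
    finally show "norm (D1 g t) \<le> 3" by simp
    have "norm (D2 g t) \<le> norm (Blinfun (\<lambda>t::real. - t)) * norm (D2 p t) + 0"
      unfolding g_def[abs_def] using c2_compose(3)[OF a(1) p(1), of t] by (simp only: a(2) D1_const) simp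
    also have "\<dots> \<le> 1 * 6 + 0" by (intro add_mono mult_mono nu p that) auto
    finally show "norm (D2 g t) \<le> 6" by simp
  qed
  have g1: "g t \<le> 1" for t by (simp add: g_def p_def)
  have b: "c2 b" unfolding b_def[abs_def] using c2_compose(1)[OF p(1) g(1)[of 0]] by simp
  have b1: "norm (D1 b t) \<le> 9" if "t \<le> 1" for t
  proof -
    have "norm (D1 b t) \<le> norm (D1 p (g t)) * norm (D1 g t)"
      unfolding b_def[abs_def] by (rule c2_compose(2)[OF p(1) g(1)[of 0]]) simp
    also have "\<dots> \<le> 3 * 3" by (intro mult_mono p g g1 that) auto
    finally show ?thesis by simp
  qed
  have b2: "norm (D2 b t) \<le> 72" if "t \<le> 1" for t
  proof -
    have "norm (D2 b t) \<le> norm (D1 p (g t)) * norm (D2 g t) + norm (D2 p (g t)) * (norm (D1 g t))\<^sup>2"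
      unfolding b_def[abs_def] by (rule c2_compose(3)[OF p(1) g(1)[of 0]]) simp
    also have "\<dots> \<le> 3 * 6 + 6 * 3\<^sup>2" by (intro add_mono mult_mono power_mono p g g1 that) auto
    finally show ?thesis by simp
  qed
  have bv: "0 \<le> b t" "b t \<le> 1" "t \<le> 0 \<Longrightarrow> b t = 1" "t \<ge> 1 \<Longrightarrow> b t = 0" for t
  proof -
    have pn: "p t \<ge> 0" by (simp add: p_def)
    show "0 \<le> b t" by (simp add: b_def p_def)
    show "b t \<le> 1" using g1[of t] by (auto simp: b_def p_def max_def power_le_one)
    show "t \<le> 0 \<Longrightarrow> b t = 1" by (simp add: b_def p_def g_def)
    show "t \<ge> 1 \<Longrightarrow> b t = 0"
      by (simp add: b_def p_def g_def max_def) (metis le_add_same_cancel1 one_le_power diff_ge_0_iff_ge add_uminus_conv_diff le_minus_iff neg_le_0_iff_le diff_add_eq_diff_diff_swap uminus_add_conv_diff antisym diff_self)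
  qed
  \<comment> \<open>The squared norm is smooth also at \<open>x\<close>. The factor 10 maps the
    radius \<rho> to 0 and the radius \<open>sqrt 1.1 * \<rho>\<close> to 1, and
    \<open>1.1 \<le> 1.05\<^sup>2\<close>.\<close>
  define u where "u y = 10 * ((y - x) \<bullet> (y - x) / \<rho>\<^sup>2 - 1)" for y
  let ?F = "\<lambda>y. (20 / \<rho>\<^sup>2) *\<^sub>R blinfun_inner_right y"
  let ?L = "\<lambda>y. ?F y + ?F (- x)"
  have F: "bounded_linear ?F"
    by (intro bounded_linear_scaleR_right[THEN bounded_linear_compose] bounded_linear_blinfun_inner_right)
  have Lh: "?L y h = 20 / \<rho>\<^sup>2 * ((y - x) \<bullet> h)" for y h
    by (simp add: blinfun.bilinear_simps blinfun_inner_right.rep_eq algebra_simps inner_diff_left diff_divide_distrib)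
  have du: "(u has_derivative blinfun_apply (?L y)) (at y)" for y
    unfolding u_def Lh[abs_def]
    using r by (auto intro!: derivative_eq_intros simp: field_simps inner_commute power4_eq_xxxx power2_eq_square)
  note a = c2_affine[OF F, of "?F (- x)"]
  have u: "c2 u" by (rule c2I(1)[OF du c2_c1[OF a(1)]])
  have Du: "D1 u = ?L" by (rule c2I(2)[OF du c2_c1[OF a(1)]])
  have u1: "norm (D1 u y) \<le> 20 / \<rho>\<^sup>2 * norm (y - x)" for y
    unfolding Du by (rule norm_blinfun_bound)
      (use r in \<open>auto simp: Lh abs_mult mult.assoc Cauchy_Schwarz_ineq2 intro!: mult_left_mono divide_right_mono\<close>)
  have u2: "norm (D2 u y) \<le> 20 / \<rho>\<^sup>2" for y
    unfolding Du a(2)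
  proof (rule norm_blinfun_bound)
    fix h :: 'a
    have "norm (blinfun_inner_right h) \<le> norm h"
      by (rule norm_blinfun_bound) (auto simp: blinfun_inner_right.rep_eq Cauchy_Schwarz_ineq2)
    then show "norm (blinfun_apply (Blinfun ?F) h) \<le> 20 / \<rho>\<^sup>2 * norm h"
      unfolding bounded_linear_Blinfun_apply[OF F] using r by (auto intro!: mult_left_mono divide_right_mono)
  qed simp
  define \<kappa> where "\<kappa> y = b (u y)" for y
  have cu: "isCont u y" for y using c2_continuous[OF u] continuous_on_eq_continuous_at by blast
  have \<kappa>: "c2 \<kappa>" unfolding \<kappa>_def[abs_def] by (rule c2_compose(1)[OF b u])
  \<comment> \<open>Off the transition layer the cutoff is locally constant. This case is separated
    because the bound for \<open>D1 u\<close> grows with the distance from \<open>x\<close>.\<close>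
  have out: "D1 \<kappa> y = 0 \<and> D2 \<kappa> y = 0" if "u y < 0 \<or> u y > 1" for y
  proof -
    obtain U c where U: "open U" "y \<in> U" "\<And>z. z \<in> U \<Longrightarrow> \<kappa> z = c"
    proof (cases "u y < 0")
      case True
      have "open {z. u z < 0}" using c2_continuous[OF u] by (intro open_Collect_less) auto
      then show ?thesis using that[of "{z. u z < 0}" 1] True bv(3) by (auto simp: \<kappa>_def)
    next
      case False
      have "open {z. u z > 1}" using c2_continuous[OF u] by (intro open_Collect_less) auto
      then show ?thesis using that[of "{z. u z > 1}" 0] False \<open>u y < 0 \<or> u y > 1\<close> bv(4) by (auto simp: \<kappa>_def)
    qed
    have c: "c2 (\<lambda>z::'a. c)" using c2_affine(1)[OF bounded_linear_zero, of c] by simp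
    have "D1 \<kappa> y = D1 (\<lambda>z::'a. c) y" by (rule D1_cong_open[OF U]) simp_all
    moreover have "D2 \<kappa> y = D2 (\<lambda>z::'a. c) y" by (rule D2_cong_open[OF U c])
    ultimately show ?thesis by (simp add: D1_const)
  qed
  have bds: "norm (D1 \<kappa> y) \<le> 200 / \<rho> \<and> norm (D2 \<kappa> y) \<le> 32000 / \<rho>\<^sup>2" for y
  proof (cases "u y < 0 \<or> u y > 1")
    case True then show ?thesis using out[OF True] r by simp
  next
    case False
    then have t: "u y \<le> 1" by simp
    have "(norm (y - x))\<^sup>2 \<le> 1.1 * \<rho>\<^sup>2"
      using t r by (simp add: u_def power2_norm_eq_inner field_simps)
    also have "\<dots> \<le> (1.05 * \<rho>)\<^sup>2" by (simp add: power2_eq_square)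
    finally have n: "norm (y - x) \<le> 1.05 * \<rho>"
      by (rule power2_le_imp_le) (use r in simp)
    have "norm (D1 u y) \<le> 20 / \<rho>\<^sup>2 * (1.05 * \<rho>)"
      using u1[of y] mult_left_mono[OF n, of "20 / \<rho>\<^sup>2"] by simp
    also have "\<dots> = 21 / \<rho>" using r by (simp add: power2_eq_square)
    finally have n1: "norm (D1 u y) \<le> 21 / \<rho>" .
    have "norm (D1 \<kappa> y) \<le> norm (D1 b (u y)) * norm (D1 u y)"
      unfolding \<kappa>_def[abs_def] by (rule c2_compose(2)[OF b u])
    also have "\<dots> \<le> 9 * (21 / \<rho>)" by (intro mult_mono b1 t n1) auto
    also have "\<dots> \<le> 200 / \<rho>" using r by (simp add: field_simps)
    finally have 1: "norm (D1 \<kappa> y) \<le> 200 / \<rho>" .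
    have "norm (D2 \<kappa> y) \<le> norm (D1 b (u y)) * norm (D2 u y) + norm (D2 b (u y)) * (norm (D1 u y))\<^sup>2"
      unfolding \<kappa>_def[abs_def] by (rule c2_compose(3)[OF b u])
    also have "\<dots> \<le> 9 * (20 / \<rho>\<^sup>2) + 72 * (21 / \<rho>)\<^sup>2"
      by (intro add_mono mult_mono power_mono b1 b2 t n1 u2) auto
    also have "\<dots> \<le> 32000 / \<rho>\<^sup>2" using r by (simp add: field_simps power2_eq_square)
    finally show ?thesis using 1 by simp
  qed
  have in1: "\<kappa> y = 1" if "norm (y - x) \<le> \<rho>" for y
  proof -
    have "(norm (y - x))\<^sup>2 \<le> \<rho>\<^sup>2" using that by (intro power_mono) auto
    then have "u y \<le> 0" using r by (simp add: u_def power2_norm_eq_inner field_simps)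
    then show ?thesis by (simp add: \<kappa>_def bv)
  qed
  have out0: "\<kappa> y = 0" if "norm (y - x) \<ge> 1.05 * \<rho>" for y
  proof -
    have "1.1 * \<rho>\<^sup>2 \<le> (1.05 * \<rho>)\<^sup>2" by (simp add: power2_eq_square)
    also have "\<dots> \<le> (norm (y - x))\<^sup>2" using that r by (intro power_mono) auto
    finally have "u y \<ge> 1" using r by (simp add: u_def power2_norm_eq_inner field_simps)
    then show ?thesis by (simp add: \<kappa>_def bv)
  qed
  show ?thesis using that[of \<kappa>] \<kappa> bds in1 out0 bv by (auto simp: \<kappa>_def)
qed

text \<open>The product rule costs factors \<open>1 / \<rho>\<close> and
  \<open>1 / \<rho>\<^sup>2\<close>, the same powers of the radius by which the derivatives of
  \<open>f\<close> scale, so the extension keeps bounds of the same kind. The layer is thin so that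
  \<open>f\<close> has to be controlled only slightly beyond the radius \<rho>.\<close>

lemma cutoff_extension:
  fixes f :: "'a::real_inner \<Rightarrow> 'b::real_normed_vector"
  assumes f: "c2 f" and r: "\<rho> > 0"
    and a: "\<And>y. norm (y - x) \<le> 1.05 * \<rho> \<Longrightarrow> norm (f y) \<le> a"
    and b: "\<And>y. norm (y - x) \<le> 1.05 * \<rho> \<Longrightarrow> norm (D1 f y) \<le> b"
    and c: "\<And>y. norm (y - x) \<le> 1.05 * \<rho> \<Longrightarrow> norm (D2 f y) \<le> c"
  obtains g where "c2 g" "\<And>y. norm (y - x) \<le> \<rho> \<Longrightarrow> g y = f y" "\<And>y. norm (g y) \<le> a"
    "\<And>y. norm (D1 g y) \<le> b + 200 * a / \<rho>"
    "\<And>y. norm (D2 g y) \<le> c + 400 * b / \<rho> + 32000 * a / \<rho>\<^sup>2"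
proof -
  obtain \<kappa> :: "'a \<Rightarrow> real" where \<kappa>: "c2 \<kappa>" "\<And>y. 0 \<le> \<kappa> y \<and> \<kappa> y \<le> 1"
    "\<And>y. norm (y - x) \<le> \<rho> \<Longrightarrow> \<kappa> y = 1" "\<And>y. norm (y - x) \<ge> 1.05 * \<rho> \<Longrightarrow> \<kappa> y = 0"
    "\<And>y. norm (D1 \<kappa> y) \<le> 200 / \<rho>" "\<And>y. norm (D2 \<kappa> y) \<le> 32000 / \<rho>\<^sup>2"
    using cutoff[OF r] by metis
  define g where "g y = \<kappa> y *\<^sub>R f y" for y
  have g: "c2 g" unfolding g_def[abs_def] by (rule c2_scaleR(1)[OF \<kappa>(1) f])
  have abc: "0 \<le> a" "0 \<le> b" "0 \<le> c"
    using order_trans[OF norm_ge_zero a[of x]] order_trans[OF norm_ge_zero b[of x]]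
      order_trans[OF norm_ge_zero c[of x]] r by auto
  have out: "g y = 0 \<and> D1 g y = 0 \<and> D2 g y = 0" if "norm (y - x) > 1.05 * \<rho>" for y
  proof -
    let ?U = "{z. norm (z - x) > 1.05 * \<rho>}"
    have U: "open ?U" "y \<in> ?U" "\<And>z. z \<in> ?U \<Longrightarrow> g z = 0"
      using that \<kappa>(4) by (auto simp: g_def intro!: open_Collect_less continuous_intros)
    have c: "c2 (\<lambda>z::'a. 0::'b)" using c2_affine(1)[OF bounded_linear_zero, of 0] by simp
    have "D1 g y = D1 (\<lambda>z::'a. 0::'b) y" by (rule D1_cong_open[OF U]) simp_all
    moreover have "D2 g y = D2 (\<lambda>z::'a. 0::'b) y" by (rule D2_cong_open[OF U c])
    ultimately show ?thesis using U(2,3) by (simp add: D1_const)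
  qed
  have bds: "norm (g y) \<le> a \<and> norm (D1 g y) \<le> b + 200 * a / \<rho> \<and>
    norm (D2 g y) \<le> c + 400 * b / \<rho> + 32000 * a / \<rho>\<^sup>2" for y
  proof (cases "norm (y - x) > 1.05 * \<rho>")
    case True
    then show ?thesis using out[OF True] abc r by simp
  next
    case False
    then have n: "norm (y - x) \<le> 1.05 * \<rho>" by simp
    have x1: "\<bar>\<kappa> y\<bar> \<le> 1" using \<kappa>(2)[of y] by simp
    have "norm (g y) \<le> 1 * a" unfolding g_def norm_scaleR using x1 a[OF n] by (intro mult_mono) auto
    moreover have "norm (D1 g y) \<le> 1 * b + 200 / \<rho> * a"
      unfolding g_def[abs_def]
      by (rule order_trans[OF c2_scaleR(2)[OF \<kappa>(1) f]], intro add_mono mult_mono x1 a b n \<kappa>)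
        (use r in auto)
    moreover have "norm (D2 g y) \<le> 1 * c + 2 * (200 / \<rho>) * b + 32000 / \<rho>\<^sup>2 * a"
      unfolding g_def[abs_def]
      by (rule order_trans[OF c2_scaleR(3)[OF \<kappa>(1) f]], intro add_mono mult_mono x1 a b c n \<kappa> order_refl)
        (use r in auto)
    ultimately show ?thesis by simp
  qed
  show ?thesis using that[of g] g bds \<kappa>(3) by (auto simp: g_def)
qed

subsection \<open>The list-based notion of derivatives\<close>

text \<open>The passage from multilinear maps of lists to nested operators, through which the
  derivative bounds of the bump functions enter.\<close>

lemma Cn_with_derivs_UNIV_c2:
  fixes f :: "'a::real_normed_vector \<Rightarrow> 'b::real_normed_vector"
  assumes C: "Cn_with_derivs 2 UNIV f D"
  shows "c2 f" "\<And>y v. D1 f y v = D y [v]" "\<And>y v w. D2 f y v w = D y [v, w]"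
proof -
  have dir: "directions (UNIV::'a set) = UNIV"
    unfolding directions_def by (auto, metis diff_zero)
  have ml: "bounded_multilinear_on UNIV m (D y)" if "m \<le> 2" for m y
    using C that unfolding Cn_with_derivs_def dir by auto
  have lin: "D y (us @ (c *\<^sub>R v + w) # ws) = c *\<^sub>R D y (us @ v # ws) + D y (us @ w # ws)"
    if "length us + length ws + 1 = m" "m \<le> 2" for y us ws c v w m
    using ml[OF that(2), of y] that(1) unfolding bounded_multilinear_on_def by blast
  have bd: "\<exists>K. \<forall>vs. length vs = m \<longrightarrow> norm (D y vs) \<le> K * prod_list (map norm vs)" if "m \<le> 2" for m y
    using ml[OF that, of y] unfolding bounded_multilinear_on_def by auto
  have bl1: "bounded_linear (\<lambda>v. D y [v])" for y
  proof -
    obtain K where K: "\<And>vs. length vs = 1 \<Longrightarrow> norm (D y vs) \<le> K * prod_list (map norm vs)"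
      using bd[of 1 y] by auto
    have add: "D y [v + w] = D y [v] + D y [w]" for v w
      using lin[of "[]" "[]" 1 y 1 v w] by simp
    have z: "D y [0] = 0" using add[of 0 0] by simp
    show ?thesis
      by (rule bounded_linear_intro[where K=K])
        (use add lin[of "[]" "[]" 1 y _ _ 0] z K[of "[_]"] in \<open>auto simp: mult.commute\<close>)
  qed
  define L where "L y = Blinfun (\<lambda>v. D y [v])" for y
  have L: "L y v = D y [v]" for y v by (simp add: L_def bounded_linear_Blinfun_apply[OF bl1])
  have bl2: "bounded_linear (\<lambda>w. D y [v, w])" for y v
  proof -
    obtain K where K: "\<And>vs. length vs = 2 \<Longrightarrow> norm (D y vs) \<le> K * prod_list (map norm vs)"
      using bd[of 2 y] by auto
    have add: "D y [v, w + w'] = D y [v, w] + D y [v, w']" for w w'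
      using lin[of "[v]" "[]" 2 y 1 w w'] by simp
    have z: "D y [v, 0] = 0" using add[of 0 0] by simp
    show ?thesis
      by (rule bounded_linear_intro[where K="K * norm v"])
        (use add lin[of "[v]" "[]" 2 y _ _ 0] z K[of "[v, _]"] in \<open>auto simp: mult_ac\<close>)
  qed
  define M1 where "M1 y v = Blinfun (\<lambda>w. D y [v, w])" for y v
  have M1: "M1 y v w = D y [v, w]" for y v w by (simp add: M1_def bounded_linear_Blinfun_apply[OF bl2])
  have bl3: "bounded_linear (M1 y)" for y
  proof -
    obtain K0 where K0: "\<And>vs. length vs = 2 \<Longrightarrow> norm (D y vs) \<le> K0 * prod_list (map norm vs)"
      using bd[of 2 y] by auto
    define K where "K = max K0 0"
    have K: "norm (D y [v, w]) \<le> K * norm v * norm w" for v w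
      using K0[of "[v, w]"] mult_right_mono[of K0 K "norm v * norm w"] by (simp add: K_def mult.assoc)
    have add: "D y [v + v', w] = D y [v, w] + D y [v', w]" for v v' w
      using lin[of "[]" "[w]" 2 y 1 v v'] by simp
    have z: "D y [0, w] = 0" for w using add[of 0 0] by simp
    show ?thesis
    proof (rule bounded_linear_intro[where K="K"])
      show "norm (M1 y v) \<le> norm v * K" for v
        by (rule norm_blinfun_bound) (use K[of v] in \<open>auto simp: M1 K_def mult_ac\<close>)
      show "M1 y (v + v') = M1 y v + M1 y v'" for v v'
        by (rule blinfun_eqI) (simp add: M1 blinfun.add_left add)
      show "M1 y (c *\<^sub>R v) = c *\<^sub>R M1 y v" for c v
        by (rule blinfun_eqI)
          (use lin[of "[]" "[_]" 2 y c v 0] z in \<open>simp add: M1 blinfun.scaleR_left\<close>)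
    qed
  qed
  define M where "M y = Blinfun (M1 y)" for y
  have M: "M y v w = D y [v, w]" for y v w
    by (simp add: M_def bounded_linear_Blinfun_apply[OF bl3] M1)
  have D0: "D y [] = f y" for y using C unfolding Cn_with_derivs_def by auto
  have ev: "\<forall>\<^sub>F z in at y. \<forall>vs. length vs = m \<longrightarrow>
          norm (D z vs - D y vs - D y ((z - y) # vs)) \<le> e * norm (z - y) * prod_list (map norm vs)"
    if "m < 2" "e > 0" for y m e
    using C that unfolding Cn_with_derivs_def dir by auto
  have d1: "(f has_derivative blinfun_apply (L y)) (at y)" for y
    unfolding has_derivative_within_alt2
  proof (intro conjI allI impI)
    fix e :: real assume "e > 0"
    from ev[OF _ this, of 0 y]
    show "\<forall>\<^sub>F z in at y. norm (f z - f y - (L y) (z - y)) \<le> e * norm (z - y)"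
      by simp (elim eventually_mono, simp add: D0 L)
  qed (rule blinfun.bounded_linear_right)
  have d2: "(L has_derivative blinfun_apply (M y)) (at y)" for y
    unfolding has_derivative_within_alt2
  proof (intro conjI allI impI)
    fix e :: real assume e: "e > 0"
    have "\<forall>\<^sub>F z in at y. \<forall>vs. length vs = 1 \<longrightarrow>
          norm (D z vs - D y vs - D y ((z - y) # vs)) \<le> e * norm (z - y) * prod_list (map norm vs)"
      by (rule ev) (use e in auto)
    then show "\<forall>\<^sub>F z in at y. norm (L z - L y - (M y) (z - y)) \<le> e * norm (z - y)"
    proof eventually_elim
      case (elim z)
      show ?case
      proof (rule norm_blinfun_bound)
        show "norm ((L z - L y - M y (z - y)) v) \<le> e * norm (z - y) * norm v" for v
          using elim[rule_format, of "[v]"] by (simp add: blinfun.diff_left L M)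
      qed (use e in simp)
    qed
  qed (rule blinfun.bounded_linear_right)
  have cM: "continuous_on UNIV M"
    unfolding continuous_on_def
  proof (intro ballI tendstoI)
    fix y and e :: real assume e: "e > 0"
    have "\<forall>\<^sub>F z in at y. \<forall>vs. length vs = 2 \<longrightarrow> norm (D z vs - D y vs) \<le> (e/2) * prod_list (map norm vs)"
    proof -
      have "\<forall>y\<in>UNIV. \<forall>m\<le>2. \<forall>e>0. \<forall>\<^sub>F z in at y. \<forall>vs. length vs = m \<and> set vs \<subseteq> UNIV \<longrightarrow>
          norm (D z vs - D y vs) \<le> e * prod_list (map norm vs)"
        using C unfolding Cn_with_derivs_def dir by blast
      from this[rule_format, of y 2 "e/2"] e show ?thesis by simp
    qed
    then show "\<forall>\<^sub>F z in at y. dist (M z) (M y) < e"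
    proof eventually_elim
      case (elim z)
      have "norm (M z - M y) \<le> e / 2"
      proof (rule norm_blinfun_bound)
        show "norm ((M z - M y) v) \<le> e / 2 * norm v" for v
        proof (rule norm_blinfun_bound)
          show "norm (((M z - M y) v) w) \<le> e / 2 * norm v * norm w" for w
            using elim[rule_format, of "[v, w]"] by (simp add: blinfun.diff_left M)
        qed (use e in simp)
      qed (use e in simp)
      then show ?case using e by (simp add: dist_norm)
    qed
  qed
  have c: "c1 L" "D1 L = M" using c1I[OF d2 cM] by auto
  show "c2 f" by (rule c2I(1)[OF d1 c(1)])
  have D: "D1 f = L" by (rule c2I(2)[OF d1 c(1)])
  show "D1 f y v = D y [v]" for y v by (simp add: D L)
  show "D2 f y v w = D y [v, w]" for y v w by (simp add: D c M)
qed

text \<open>The converse passage, for the regularity claim in conclusion 8: a C^2 map of the whole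
  space satisfies the definition along each plane.\<close>

lemma C2_on_plane_c2:
  fixes f :: "'a::real_normed_vector \<Rightarrow> 'b::real_normed_vector"
  assumes f: "c2 f"
  shows "C2_on_plane P f"
proof -
  define D where "D y vs = (case vs of [] \<Rightarrow> f y | [v] \<Rightarrow> D1 f y v | [v, w] \<Rightarrow> D2 f y v w | _ \<Rightarrow> 0)" for y vs
  have D: "D y [] = f y" "D y [v] = D1 f y v" "D y [v, w] = D2 f y v w" for y v w by (auto simp: D_def)
  have l2: "length vs = 2 \<longleftrightarrow> (\<exists>v w. vs = [v, w])" and l1: "length vs = Suc 0 \<longleftrightarrow> (\<exists>v. vs = [v])" for vs :: "'a list"
    by (auto simp: length_Suc_conv numeral_2_eq_2)
  have m2: "m \<le> 2 \<longleftrightarrow> m = 0 \<or> m = 1 \<or> m = 2" "m < 2 \<longleftrightarrow> m = 0 \<or> m = 1" for m :: nat by auto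
  have "\<forall>\<^sub>F z in at y within P. \<forall>vs. length vs = m \<and> set vs \<subseteq> directions P \<longrightarrow>
      norm (D z vs - D y vs - D y ((z - y) # vs)) \<le> e * norm (z - y) * prod_list (map norm vs)"
    if "m < 2" "e > 0" for y m and e :: real
  proof -
    from that consider "m = 0" | "m = 1" by linarith
    then show ?thesis
    proof cases
      case 1
      have "(f has_derivative D1 f y) (at y within P)"
        using c1_has_derivative[OF c2_c1[OF f]] has_derivative_at_withinI by blast
      then have "\<forall>\<^sub>F z in at y within P. norm (f z - f y - D1 f y (z - y)) \<le> e * norm (z - y)"
        using \<open>e > 0\<close> unfolding has_derivative_within_alt2 by blast
      then show ?thesis by eventually_elim (simp add: 1 D)
    next
      case 2
      have "(D1 f has_derivative D2 f y) (at y within P)"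
        using c1_has_derivative[OF c2_D1[OF f]] has_derivative_at_withinI by blast
      then have "\<forall>\<^sub>F z in at y within P. norm (D1 f z - D1 f y - D2 f y (z - y)) \<le> e * norm (z - y)"
        using \<open>e > 0\<close> unfolding has_derivative_within_alt2 by blast
      then show ?thesis
      proof eventually_elim
        case (elim z)
        have "norm (D1 f z v - D1 f y v - D2 f y (z - y) v) \<le> e * norm (z - y) * norm v" for v
          using norm_blinfun[of "D1 f z - D1 f y - D2 f y (z - y)" v]
            mult_right_mono[OF elim, of "norm v"] by (simp add: blinfun.diff_left)
        then show ?case by (auto simp: 2 l1 D)
      qed
    qed
  qed
  moreover have "\<forall>\<^sub>F z in at y within P. \<forall>vs. length vs = m \<and> set vs \<subseteq> directions P \<longrightarrow>
      norm (D z vs - D y vs) \<le> e * prod_list (map norm vs)" if "m \<le> 2" "e > 0" for y m and e :: real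
  proof -
    have ev: "\<forall>\<^sub>F z in at y within P. norm (h z - h y) \<le> e" if "continuous_on UNIV h"
      for h :: "'a \<Rightarrow> 'c::real_normed_vector"
    proof -
      have "(h \<longlongrightarrow> h y) (at y within P)" using that
        by (metis UNIV_I continuous_on_def subset_UNIV tendsto_within_subset)
      from tendstoD[OF this \<open>e > 0\<close>] show ?thesis by (rule eventually_mono) (simp add: dist_norm)
    qed
    from \<open>m \<le> 2\<close> consider "m = 0" | "m = 1" | "m = 2" by linarith
    then show ?thesis
    proof cases
      case 1
      then show ?thesis using ev[OF c2_continuous[OF f]] by (simp add: D)
    next
      case 2
      from ev[OF c1_continuous[OF c2_D1[OF f]]] show ?thesis
      proof eventually_elim
        case (elim z)
        have "norm (D1 f z v - D1 f y v) \<le> e * norm v" for v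
          using norm_blinfun[of "D1 f z - D1 f y" v] mult_right_mono[OF elim, of "norm v"]
          by (simp add: blinfun.diff_left)
        then show ?case by (auto simp: 2 l1 D)
      qed
    next
      case 3
      have "continuous_on UNIV (D2 f)" using c2_D1[OF f] by (simp add: c1_def)
      from ev[OF this] show ?thesis
      proof eventually_elim
        case (elim z)
        have "norm (D2 f z v w - D2 f y v w) \<le> e * (norm v * norm w)" for v w
        proof -
          have "norm ((D2 f z - D2 f y) v) \<le> e * norm v"
            using norm_blinfun[of "D2 f z - D2 f y" v] mult_right_mono[OF elim, of "norm v"] by simp
          from mult_right_mono[OF this, of "norm w"] norm_blinfun[of "(D2 f z - D2 f y) v" w]
          show ?thesis by (simp add: blinfun.diff_left mult.assoc)
        qed
        then show ?case by (auto simp: 3 l2 D)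
      qed
    qed
  qed
  moreover have "bounded_multilinear_on (directions P) m (D y)" if "m \<le> 2" for m y
  proof -
    from that consider "m = 0" | "m = 1" | "m = 2" by linarith
    then show ?thesis
    proof cases
      case 1
      then show ?thesis unfolding bounded_multilinear_on_def by (auto simp: D intro: exI[of _ "norm (f y)"])
    next
      case 2
      then show ?thesis unfolding bounded_multilinear_on_def
        by (auto simp: l1 D blinfun.bilinear_simps norm_blinfun intro!: exI[of _ "norm (D1 f y)"])
    next
      case 3
      have "norm (D2 f y v w) \<le> norm (D2 f y) * (norm v * norm w)" for v w
        using norm_blinfun[of "D2 f y v" w] mult_right_mono[OF norm_blinfun[of "D2 f y" v], of "norm w"]
        by (simp add: mult.assoc)
      moreover have "length us + length ws = 1 \<longleftrightarrow>
          (us = [] \<and> (\<exists>w. ws = [w])) \<or> (ws = [] \<and> (\<exists>w. us = [w]))" for us ws :: "'a list"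
        by (cases us; cases ws) (auto simp: l1)
      ultimately show ?thesis using 3 unfolding bounded_multilinear_on_def
        by (auto simp: l2 D blinfun.bilinear_simps intro!: exI[of _ "norm (D2 f y)"])
    qed
  qed
  ultimately have "Cn_with_derivs 2 P f D"
    unfolding Cn_with_derivs_def by (auto simp: D)
  then show ?thesis unfolding C2_on_plane_def by blast
qed

section \<open>Finite-dimensional planes\<close>

definition onb :: "nat \<Rightarrow> (nat \<Rightarrow> 'a::real_inner) \<Rightarrow> bool" where
  "onb d b \<longleftrightarrow> (\<forall>i<d. \<forall>j<d. b i \<bullet> b j = (if i = j then 1 else 0))"

definition oproj :: "nat \<Rightarrow> (nat \<Rightarrow> 'a::real_inner) \<Rightarrow> 'a \<Rightarrow> 'a" where
  "oproj d b v = (\<Sum>i<d. (v \<bullet> b i) *\<^sub>R b i)"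

text \<open>For a plane this is the orthogonal projection onto the direction space: the linear part
  of the affine map \<open>plane_proj P\<close>. As an operator it allows the angle of two planes to
  be measured by \<open>norm (Dp E - Dp F)\<close>, which satisfies the triangle inequality.\<close>

definition Dp :: "'a::real_inner set \<Rightarrow> 'a \<Rightarrow>\<^sub>L 'a" where
  "Dp P = Blinfun (\<lambda>v. plane_proj P v - plane_proj P 0)"

lemma linear_oproj: "linear (oproj d b)"
  unfolding oproj_def
  by (rule linearI) (auto simp: inner_add_left scaleR_add_left sum.distrib scaleR_sum_right)

lemma oproj_span: "oproj d b v \<in> span (b ` {..<d})"
  unfolding oproj_def by (intro span_sum span_scale span_base) auto

lemma oproj_inner:
  assumes "onb d b" "j < d"
  shows "oproj d b v \<bullet> b j = v \<bullet> b j"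
proof -
  have "oproj d b v \<bullet> b j = (\<Sum>i<d. (v \<bullet> b i) * (b i \<bullet> b j))"
    by (simp add: oproj_def inner_sum_left)
  also have "\<dots> = (\<Sum>i<d. if i = j then v \<bullet> b j else 0)"
    using assms by (intro sum.cong) (auto simp: onb_def)
  finally show ?thesis using assms by simp
qed

lemma oproj_id:
  assumes "onb d b" "v \<in> span (b ` {..<d})"
  shows "oproj d b v = v"
proof -
  have "oproj d b (b j) = b j" if "j < d" for j
  proof -
    have "oproj d b (b j) = (\<Sum>i<d. if i = j then b j else 0)"
      unfolding oproj_def using assms(1) that by (intro sum.cong) (auto simp: onb_def)
    then show ?thesis using that by simp
  qed
  then show ?thesis
    using linear_eq_on_span[OF linear_oproj linear_id, of "b ` {..<d}" d b] assms(2) by auto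
qed

lemma oproj_orthogonal:
  assumes "onb d b" "w \<in> span (b ` {..<d})"
  shows "(v - oproj d b v) \<bullet> w = 0"
proof -
  have "w = (\<Sum>i<d. (w \<bullet> b i) *\<^sub>R b i)"
    using oproj_id[OF assms] by (simp add: oproj_def)
  then have "(v - oproj d b v) \<bullet> w = (\<Sum>i<d. (w \<bullet> b i) * ((v - oproj d b v) \<bullet> b i))"
    by (metis (no_types, lifting) inner_scaleR_right inner_sum_right sum.cong)
  also have "\<dots> = 0" using oproj_inner[OF assms(1)] by (simp add: inner_diff_left)
  finally show ?thesis .
qed

lemma gram_schmidt:
  fixes B :: "'a::real_inner set"
  assumes "finite B" "independent B"
  shows "\<exists>b. onb (card B) b \<and> span (b ` {..<card B}) = span B"
  using assms
proof (induction B rule: finite_induct)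
  case empty
  show ?case by (auto simp: onb_def)
next
  case (insert v B)
  then obtain b where b: "onb (card B) b" "span (b ` {..<card B}) = span B"
    by (auto simp: independent_insert)
  let ?n = "card B"
  define w where "w = v - oproj ?n b v"
  have vB: "v \<notin> span B" using insert by (auto simp: independent_insert)
  have w: "w \<noteq> 0" using vB oproj_span[of ?n b v] b(2) by (auto simp: w_def)
  define b' where "b' = b(?n := w /\<^sub>R norm w)"
  have nw: "(w /\<^sub>R norm w) \<bullet> (w /\<^sub>R norm w) = 1" using w by (simp add: dot_square_norm power2_eq_square)
  have wb: "w \<bullet> b i = 0" if "i < ?n" for i
    using oproj_orthogonal[OF b(1), of "b i" v] that by (auto simp: w_def intro: span_base)
  have "onb (Suc ?n) b'"
    unfolding onb_def
  proof (intro allI impI)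
    fix i j assume "i < Suc ?n" "j < Suc ?n"
    then show "b' i \<bullet> b' j = (if i = j then 1 else 0)"
      using wb nw b(1) by (auto simp: b'_def less_Suc_eq onb_def inner_commute)
  qed
  moreover have "span (b' ` {..<Suc ?n}) = span (insert v B)"
  proof -
    have "b' ` {..<Suc ?n} = insert (w /\<^sub>R norm w) (b ` {..<?n})"
      by (auto simp: b'_def lessThan_Suc)
    also have "span \<dots> = span (insert v (b ` {..<?n}))"
    proof
      have ws: "w \<in> span (insert v (b ` {..<?n}))"
        unfolding w_def using oproj_span[of ?n b v] span_mono[of "b ` {..<?n}" "insert v (b ` {..<?n})"]
        by (intro span_diff span_base[of v]) auto
      show "span (insert (w /\<^sub>R norm w) (b ` {..<?n})) \<subseteq> span (insert v (b ` {..<?n}))"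
        by (intro span_minimal) (auto intro: span_base span_scale ws)
      let ?T = "insert (w /\<^sub>R norm w) (b ` {..<?n})"
      have "norm w *\<^sub>R (w /\<^sub>R norm w) + oproj ?n b v \<in> span ?T"
        using oproj_span[of ?n b v] span_mono[of "b ` {..<?n}" ?T]
        by (intro span_add span_scale span_base[of "w /\<^sub>R norm w"]) auto
      then have "v \<in> span ?T" using w by (simp add: w_def)
      then show "span (insert v (b ` {..<?n})) \<subseteq> span ?T"
        by (intro span_minimal) (auto intro: span_base)
    qed
    also have "\<dots> = span (insert v B)"
      using b(2) by (simp add: span_insert)
    finally show ?thesis .
  qed
  ultimately show ?case using insert(1,2) by auto
qed

lemma onb_independent:
  assumes "onb d b"
  shows "inj_on b {..<d}" "independent (b ` {..<d})"
proof -
  show i: "inj_on b {..<d}"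
  proof (rule inj_onI)
    fix i j assume ij: "i \<in> {..<d}" "j \<in> {..<d}" "b i = b j"
    then have "b i \<bullet> b j = 1" using assms by (auto simp: onb_def)
    moreover have "b i \<bullet> b j = (if i = j then 1 else 0)" using assms ij unfolding onb_def by blast
    ultimately show "i = j" by (simp split: if_splits)
  qed
  show "independent (b ` {..<d})"
    unfolding independent_explicit_finite_subsets
  proof (intro allI impI ballI)
    fix S u v assume S: "S \<subseteq> b ` {..<d}" "finite S" "(\<Sum>v\<in>S. u v *\<^sub>R v) = 0" "v \<in> S"
    have "0 = (\<Sum>w\<in>S. u w *\<^sub>R w) \<bullet> v" using S by simp
    also have "\<dots> = (\<Sum>w\<in>S. u w * (w \<bullet> v))" by (simp add: inner_sum_left)
    also have "\<dots> = (\<Sum>w\<in>S. if w = v then u v else 0)"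
    proof (rule sum.cong)
      fix w assume "w \<in> S"
      then obtain i j where "w = b i" "v = b j" "i < d" "j < d" using S by blast
      then show "u w * (w \<bullet> v) = (if w = v then u v else 0)"
        using assms i by (auto simp: onb_def inj_on_def)
    qed simp
    also have "\<dots> = u v" using S by simp
    finally show "u v = 0" by simp
  qed
qed

lemma directions_translate_span: "directions ((\<lambda>v. a + v) ` span B) = span B"
proof -
  have "u - v \<in> span B" if "u \<in> span B" "v \<in> span B" for u v using that by (rule span_diff)
  moreover have "\<exists>u v. w = u - v \<and> u \<in> (\<lambda>v. a + v) ` span B \<and> v \<in> (\<lambda>v. a + v) ` span B" if "w \<in> span B" for w
    using that span_zero[of B] by (intro exI[of _ "a + w"] exI[of _ "a + 0"]) auto
  ultimately show ?thesis unfolding directions_def by auto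
qed

lemma is_plane_onb:
  assumes "onb d b"
  shows "is_plane d ((\<lambda>v. a + v) ` span (b ` {..<d}))"
  unfolding is_plane_def using onb_independent[OF assms]
  by (intro exI[of _ a] exI[of _ "b ` {..<d}"]) (auto simp: card_image)

lemma plane_onb:
  assumes P: "is_plane d P"
  obtains a b where "onb d b" "P = (\<lambda>v. a + v) ` span (b ` {..<d})" "directions P = span (b ` {..<d})"
    "\<And>y. plane_proj P y = a + oproj d b (y - a)" "\<And>v. Dp P v = oproj d b v"
proof -
  obtain a B where B: "finite B" "card B = d" "independent B" "P = (\<lambda>v. a + v) ` span B"
    using P unfolding is_plane_def by blast
  obtain b where b: "onb d b" "span (b ` {..<d}) = span B" using gram_schmidt[OF B(1,3)] B(2) by auto
  have dir: "directions P = span (b ` {..<d})" unfolding B(4) b(2) by (rule directions_translate_span)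
  have pp: "plane_proj P y = a + oproj d b (y - a)" for y
    unfolding plane_proj_def
  proof (rule the_equality)
    show "a + oproj d b (y - a) \<in> P \<and> y - (a + oproj d b (y - a)) \<in> perp P"
      using oproj_span[of d b "y - a"] b(2) B(4) oproj_orthogonal[OF b(1), of _ "y - a"]
      unfolding dir by (auto simp: orthogonal_comp_def orthogonal_def algebra_simps inner_commute)
    fix p assume p: "p \<in> P \<and> y - p \<in> perp P"
    then obtain v where v: "v \<in> span (b ` {..<d})" "p = a + v" using B(4) b(2) by auto
    let ?w = "oproj d b (y - a) - v"
    have ws: "?w \<in> span (b ` {..<d})" using oproj_span v(1) span_diff by blast
    have "?w \<bullet> (y - a - v) = 0"
      using p ws unfolding dir by (auto simp: orthogonal_comp_def orthogonal_def v(2) algebra_simps)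
    moreover have "?w \<bullet> (y - a - oproj d b (y - a)) = 0"
      using oproj_orthogonal[OF b(1) ws, of "y - a"] by (simp add: inner_commute)
    ultimately have "?w \<bullet> ?w = 0" by (simp add: inner_diff_right)
    then show "p = a + oproj d b (y - a)" using v(2) by simp
  qed
  have bl: "bounded_linear (oproj d b)"
    unfolding oproj_def[abs_def]
    by (intro bounded_linear_sum bounded_linear_scaleR_const bounded_linear_inner_left)
  have "(\<lambda>v. plane_proj P v - plane_proj P 0) = oproj d b"
    by (auto simp: pp linear_diff[OF linear_oproj] fun_eq_iff linear_neg[OF linear_oproj])
  then have "Dp P v = oproj d b v" for v unfolding Dp_def using bl by (simp add: bounded_linear_Blinfun_apply)
  then show ?thesis using that b dir pp B(4) by metis
qed

section \<open>The projection onto a single plane\<close>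

context
  fixes d :: nat and P :: "'a::real_inner set"
  assumes P: "is_plane d P"
begin

lemma subspace_directions: "subspace (directions P)"
  using plane_onb[OF P] subspace_span by metis

lemma Dp_in_directions: "Dp P v \<in> directions P"
  using plane_onb[OF P] oproj_span by metis

lemma Dp_id: "v \<in> directions P \<Longrightarrow> Dp P v = v"
  using plane_onb[OF P] oproj_id by metis

lemma Dp_idem [simp]: "Dp P (Dp P v) = Dp P v"
  by (simp add: Dp_id Dp_in_directions)

lemma Dp_orthogonal: "w \<in> directions P \<Longrightarrow> (v - Dp P v) \<bullet> w = 0"
  using plane_onb[OF P] oproj_orthogonal by metis

lemma Dp_symmetric: "Dp P v \<bullet> w = v \<bullet> Dp P w"
  using Dp_orthogonal[of "Dp P w" v] Dp_orthogonal[of "Dp P v" w] Dp_in_directions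
  by (simp add: inner_diff_left inner_commute[of "Dp P v" w] inner_commute[of "Dp P w" v])
    (simp add: inner_commute)

lemma perp_iff: "w \<in> perp P \<longleftrightarrow> Dp P w = 0"
proof
  assume "w \<in> perp P"
  then have "Dp P w \<bullet> w = 0"
    using Dp_in_directions[of w] by (auto simp: orthogonal_comp_def orthogonal_def)
  then have "Dp P w \<bullet> Dp P w = 0" using Dp_symmetric[of w "Dp P w"] by (simp add: inner_commute)
  then show "Dp P w = 0" by simp
next
  assume "Dp P w = 0"
  then show "w \<in> perp P"
    using Dp_orthogonal[of _ w] by (auto simp: orthogonal_comp_def orthogonal_def inner_commute)
qed

lemma Dp_complement_perp: "v - Dp P v \<in> perp P"
  by (simp add: perp_iff blinfun.diff_right)

lemma Dp_pythagoras: "(norm v)\<^sup>2 = (norm (Dp P v))\<^sup>2 + (norm (v - Dp P v))\<^sup>2"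
proof -
  have "(v - Dp P v) \<bullet> Dp P v = 0" by (rule Dp_orthogonal[OF Dp_in_directions])
  then show ?thesis
    unfolding power2_norm_eq_inner by (simp add: inner_diff_left inner_diff_right inner_commute)
qed

lemma norm_Dp_le: "norm (Dp P v) \<le> norm v"
  by (rule power2_le_imp_le) (use Dp_pythagoras[of v] in auto)

lemma norm_Dp_complement_le: "norm (v - Dp P v) \<le> norm v"
  by (rule power2_le_imp_le) (use Dp_pythagoras[of v] in auto)

lemma norm_Dp: "norm (Dp P) \<le> 1"
  by (rule norm_blinfun_bound) (auto simp: norm_Dp_le)

lemma plane_proj_in: "plane_proj P y \<in> P"
  using plane_onb[OF P] oproj_span by (metis imageI)

lemma plane_proj_diff: "plane_proj P y = plane_proj P z + Dp P (y - z)"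
proof -
  obtain a b where "\<And>y. plane_proj P y = a + oproj d b (y - a)" "\<And>v. Dp P v = oproj d b v"
    using plane_onb[OF P] by metis
  then show ?thesis by (simp add: linear_diff[OF linear_oproj, symmetric] linear_add[OF linear_oproj, symmetric])
qed

lemma plane_proj_id: "p \<in> P \<Longrightarrow> plane_proj P p = p"
proof -
  assume p: "p \<in> P"
  obtain a b where "onb d b" "P = (\<lambda>v. a + v) ` span (b ` {..<d})" "\<And>y. plane_proj P y = a + oproj d b (y - a)"
    using plane_onb[OF P] by metis
  then show "plane_proj P p = p" using p oproj_id by fastforce
qed

lemma plane_proj_add: "p \<in> P \<Longrightarrow> plane_proj P y = p + Dp P (y - p)"
  using plane_proj_diff[of y p] plane_proj_id by simp

lemma plane_translate_iff: "p \<in> P \<Longrightarrow> p + v \<in> P \<longleftrightarrow> v \<in> directions P"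
proof -
  assume p: "p \<in> P"
  obtain a b where "P = (\<lambda>v. a + v) ` span (b ` {..<d})" "directions P = span (b ` {..<d})"
    using plane_onb[OF P] by metis
  then show "p + v \<in> P \<longleftrightarrow> v \<in> directions P"
  proof -
    obtain s where s: "p = a + s" "s \<in> span (b ` {..<d})" using p \<open>P = _\<close> by auto
    have "p + v \<in> P \<longleftrightarrow> s + v \<in> span (b ` {..<d})"
      unfolding \<open>P = _\<close> s(1) by (auto simp: image_iff add.assoc)
    then show ?thesis using span_add_eq[OF s(2)] \<open>directions P = span _\<close> by simp
  qed
qed

lemma plane_diff: "p \<in> P \<Longrightarrow> q \<in> P \<Longrightarrow> p - q \<in> directions P"
  using plane_translate_iff[of q "p - q"] by simp

lemma plane_proj_eq: "p \<in> P \<Longrightarrow> w \<in> perp P \<Longrightarrow> plane_proj P (p + w) = p"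
  using plane_proj_add[of p "p + w"] perp_iff by simp

lemma dist_plane_proj_le: "norm (plane_proj P y - plane_proj P z) \<le> norm (y - z)"
  using plane_proj_diff[of y z] norm_Dp_le[of "y - z"] by simp

lemma plane_proj_closest: "q \<in> P \<Longrightarrow> norm (y - plane_proj P y) \<le> norm (y - q)"
  using plane_proj_add[of q y] norm_Dp_complement_le[of "y - q"] by (simp add: algebra_simps)

lemma infdist_plane: "infdist y P = norm (y - plane_proj P y)"
proof (rule antisym)
  show "infdist y P \<le> norm (y - plane_proj P y)"
    using infdist_le[OF plane_proj_in[of y], of y] by (simp add: dist_norm)
  have "P \<noteq> {}" using plane_proj_in by auto
  then show "norm (y - plane_proj P y) \<le> infdist y P"
    unfolding infdist_def using plane_proj_closest by (auto intro!: cINF_greatest simp: dist_norm)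
qed

lemma closed_plane: "closed P"
proof -
  have "P = {y. norm (y - plane_proj P y) = 0}"
  proof (intro set_eqI iffI)
    fix y assume "y \<in> {y. norm (y - plane_proj P y) = 0}"
    then show "y \<in> P" using plane_proj_in[of y] by simp
  qed (simp add: plane_proj_id)
  moreover have "continuous_on UNIV (plane_proj P)"
    by (rule lipschitz_on_continuous_on[of 1]) (auto simp: lipschitz_on_def dist_norm dist_plane_proj_le)
  then have "closed {y. norm (y - plane_proj P y) = 0}"
    by (intro closed_Collect_eq continuous_on_norm continuous_on_diff continuous_on_id continuous_on_const)
  ultimately show ?thesis by simp
qed

lemma plane_translate:
  shows "is_plane d ((\<lambda>p. p + w) ` P)" "directions ((\<lambda>p. p + w) ` P) = directions P"
proof -
  obtain a b where b: "onb d b" "P = (\<lambda>v. a + v) ` span (b ` {..<d})" "directions P = span (b ` {..<d})"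
    using plane_onb[OF P] by metis
  have e: "(\<lambda>p. p + w) ` P = (\<lambda>v. (a + w) + v) ` span (b ` {..<d})"
    unfolding b(2) image_image by (intro image_cong) (auto simp: algebra_simps)
  show "is_plane d ((\<lambda>p. p + w) ` P)" unfolding e by (rule is_plane_onb[OF b(1)])
  show "directions ((\<lambda>p. p + w) ` P) = directions P" unfolding e b(3) by (rule directions_translate_span)
qed

end

text \<open>A small gap makes the projection of \<open>E\<close> to \<open>F\<close> injective and hence, by equality of the dimensions,
  surjective.\<close>

lemma gap_symmetric:
  fixes E F :: "'a::real_inner set"
  assumes E: "is_plane d E" and F: "is_plane d F" and \<eta>: "\<eta> \<le> 1/2"
    and gap: "\<And>v. v \<in> directions E \<Longrightarrow> norm (v - Dp F v) \<le> \<eta> * norm v"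
    and w: "w \<in> directions F"
  shows "norm (w - Dp E w) \<le> 2 * \<eta> * norm w"
proof -
  obtain a b where b: "onb d b" "directions E = span (b ` {..<d})" using plane_onb[OF E] by metis
  obtain a' b' where b': "onb d b'" "directions F = span (b' ` {..<d})" using plane_onb[OF F] by metis
  have lin: "linear (blinfun_apply (Dp F))" by (simp add: blinfun.bounded_linear_right bounded_linear.linear)
  have low: "norm v \<le> 2 * norm (Dp F v)" if "v \<in> directions E" for v
  proof -
    have "norm v \<le> norm (v - Dp F v) + norm (Dp F v)" using norm_triangle_ineq[of "v - Dp F v" "Dp F v"] by simp
    moreover have "\<eta> * norm v \<le> 1/2 * norm v" using \<eta> by (intro mult_right_mono) auto
    ultimately show ?thesis using gap[OF that] by linarith
  qed
  have inj: "inj_on (blinfun_apply (Dp F)) (span (b ` {..<d}))"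
  proof (rule inj_onI)
    fix u v assume uv: "u \<in> span (b ` {..<d})" "v \<in> span (b ` {..<d})" "Dp F u = Dp F v"
    then have "u - v \<in> directions E" using b(2) span_diff by metis
    from low[OF this] uv(3) show "u = v" by (simp add: blinfun.diff_right)
  qed
  let ?I = "blinfun_apply (Dp F) ` (b ` {..<d})"
  have ind: "independent ?I"
    using linear_independent_injective_image[OF lin onb_independent(2)[OF b(1)] inj] .
  have card: "card ?I = d"
    using card_image[OF inj_on_subset[OF inj span_superset]] onb_independent(1)[OF b(1)] by (simp add: card_image)
  have sub: "?I \<subseteq> span (b' ` {..<d})" using Dp_in_directions[OF F] b'(2) by auto
  have "w \<in> span ?I"
  proof (rule ccontr)
    assume nw: "w \<notin> span ?I"
    then have "independent (insert w ?I)" using ind by (simp add: independent_insert)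
    moreover have "insert w ?I \<subseteq> span (b' ` {..<d})" using sub w b'(2) by auto
    ultimately have "card (insert w ?I) \<le> card (b' ` {..<d})"
      using independent_span_bound[of "b' ` {..<d}" "insert w ?I"] by auto
    moreover have "card (insert w ?I) = Suc d"
    proof (subst card_insert_disjoint)
      show "w \<notin> ?I" using nw span_base[of w ?I] by blast
    qed (simp_all add: card del: image_image)
    moreover have "card (b' ` {..<d}) \<le> d" using card_image_le[of "{..<d}" b'] by simp
    ultimately show False by simp
  qed
  then obtain v where v: "v \<in> directions E" "w = Dp F v"
    unfolding linear_span_image[OF lin] b(2) by auto
  have \<eta>0: "0 \<le> \<eta> \<or> v = 0" using order_trans[OF norm_ge_zero gap[OF v(1)]] by (auto simp: zero_le_mult_iff)
  \<comment> \<open>The complementary projection of \<open>E\<close> annihilates \<open>v\<close>,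
    so the gap at \<open>w\<close> is at most the distance from \<open>w\<close> to
    \<open>v\<close>, which the hypothesis controls.\<close>
  have "w - Dp E w = (w - v) - Dp E (w - v)" using Dp_id[OF E v(1)] by (simp add: blinfun.diff_right)
  then have "norm (w - Dp E w) \<le> norm (w - v)" using norm_Dp_complement_le[OF E] by metis
  also have "\<dots> \<le> \<eta> * norm v" using gap[OF v(1)] v(2) by (simp add: norm_minus_commute)
  also have "\<dots> \<le> \<eta> * (2 * norm w)"
  proof (cases "v = 0")
    case False
    then have "0 \<le> \<eta>" using \<eta>0 by simp
    then show ?thesis using low[OF v(1)] v(2) by (intro mult_left_mono) auto
  qed (simp add: v blinfun.zero_right)
  finally show ?thesis by simp
qed

text \<open>Split the difference at \<open>v\<close> into the part of \<open>Dp E v\<close>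
  orthogonal to \<open>F\<close> and the projection \<open>z\<close> to \<open>F\<close> of
  \<open>w = v - Dp E v\<close>. The first is a gap. For the second,
  \<open>z \<bullet> z = z \<bullet> w\<close>, and since \<open>w\<close> is orthogonal to
  \<open>E\<close> only \<open>z - Dp E z\<close> contributes: the opposite gap.\<close>

lemma norm_Dp_diff_le:
  fixes E F :: "'a::real_inner set"
  assumes E: "is_plane d E" and F: "is_plane d' F" and \<eta>: "0 \<le> \<eta>"
    and EF: "\<And>v. v \<in> directions E \<Longrightarrow> norm (v - Dp F v) \<le> \<eta> * norm v"
    and FE: "\<And>v. v \<in> directions F \<Longrightarrow> norm (v - Dp E v) \<le> \<eta> * norm v"
  shows "norm (Dp E - Dp F) \<le> 2 * \<eta>"
proof (rule norm_blinfun_bound)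
  fix v
  let ?w = "v - Dp E v"
  let ?z = "Dp F ?w"
  have "norm ?z * norm ?z = ?z \<bullet> ?w"
    using Dp_symmetric[OF F, of ?w ?z] Dp_idem[OF F] by (simp add: inner_commute dot_square_norm power2_eq_square)
  also have "\<dots> = (?z - Dp E ?z) \<bullet> ?w"
    using Dp_orthogonal[OF E Dp_in_directions[OF E, of ?z], of v] by (simp add: inner_diff_left inner_diff_right inner_commute)
  also have "\<dots> \<le> norm (?z - Dp E ?z) * norm ?w" by (rule norm_cauchy_schwarz)
  also have "\<dots> \<le> (\<eta> * norm ?z) * norm ?w"
    by (intro mult_right_mono FE Dp_in_directions[OF F]) auto
  finally have "norm ?z \<le> \<eta> * norm ?w" using \<eta> by (cases "norm ?z = 0") (auto simp: mult_ac)
  also have "\<dots> \<le> \<eta> * norm v" using norm_Dp_complement_le[OF E] \<eta> by (intro mult_left_mono) auto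
  finally have 1: "norm ?z \<le> \<eta> * norm v" .
  have "norm (Dp E v - Dp F (Dp E v)) \<le> \<eta> * norm (Dp E v)" by (intro EF Dp_in_directions[OF E])
  also have "\<dots> \<le> \<eta> * norm v" using norm_Dp_le[OF E] \<eta> by (intro mult_left_mono) auto
  finally have 2: "norm (Dp E v - Dp F (Dp E v)) \<le> \<eta> * norm v" .
  have "(Dp E - Dp F) v = (Dp E v - Dp F (Dp E v)) - ?z" by (simp add: blinfun.diff_left blinfun.diff_right)
  then show "norm ((Dp E - Dp F) v) \<le> 2 * \<eta> * norm v"
    using norm_triangle_ineq4[of "Dp E v - Dp F (Dp E v)" ?z] 1 2 by simp
qed (use \<eta> in simp)

subsection \<open>Normalized local Hausdorff distance\<close>

lemma diameter_cball_nontrivial: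
  fixes x :: "'a::real_normed_vector"
  assumes nt: "\<exists>v::'a. v \<noteq> 0" and r: "r \<ge> 0"
  shows "diameter (cball x r) = 2 * r"
proof (rule antisym)
  show "diameter (cball x r) \<le> 2 * r"
    using r dist_triangle3[of _ _ x]
    by (intro diameter_le) (auto simp: dist_norm[symmetric], smt (verit) dist_triangle3)
  obtain v :: 'a where v: "v \<noteq> 0" using nt by blast
  let ?u = "(r / norm v) *\<^sub>R v"
  have u: "norm ?u = r" using v r by simp
  have "(x + ?u) - (x - ?u) = 2 *\<^sub>R ?u" unfolding scaleR_2 by simp
  then have "dist (x + ?u) (x - ?u) = norm (2 *\<^sub>R ?u)" by (simp only: dist_norm)
  also have "\<dots> = 2 * r" using u by (simp only: norm_scaleR)
  finally show "2 * r \<le> diameter (cball x r)"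
    using diameter_bounded_bound[of "cball x r" "x + ?u" "x - ?u"] u by (auto simp: dist_norm)
qed

lemma bdd_above_infdist_cball:
  assumes "F \<noteq> {}"
  shows "bdd_above (insert 0 ((\<lambda>y. infdist y F) ` (E \<inter> cball x r)))"
proof -
  obtain f where f: "f \<in> F" using assms by blast
  have "infdist y F \<le> dist x f + r" if "y \<in> cball x r" for y
    using infdist_le[OF f, of y] dist_triangle[of y f x] that by (simp add: dist_commute)
  then show ?thesis by (auto intro!: bdd_aboveI2)
qed

lemma infdist_le_ball_dist:
  fixes x :: "'a::real_normed_vector"
  assumes nt: "\<exists>v::'a. v \<noteq> 0" and r: "r > 0" and "E \<noteq> {}" "F \<noteq> {}"
  shows "y \<in> E \<Longrightarrow> norm (y - x) \<le> r \<Longrightarrow> infdist y F \<le> r * ball_dist x r E F"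
    and "y \<in> F \<Longrightarrow> norm (y - x) \<le> r \<Longrightarrow> infdist y E \<le> r * ball_dist x r E F"
    and "0 \<le> ball_dist x r E F"
proof -
  let ?a = "Sup (insert 0 ((\<lambda>y. infdist y F) ` (E \<inter> cball x r)))"
  let ?b = "Sup (insert 0 ((\<lambda>y. infdist y E) ` (F \<inter> cball x r)))"
  have e: "r * ball_dist x r E F = max ?a ?b"
    using r by (simp add: ball_dist_def diameter_cball_nontrivial[OF nt])
  show 1: "infdist y F \<le> r * ball_dist x r E F" if "y \<in> E" "norm (y - x) \<le> r"
    unfolding e using that
    by (intro order_trans[OF cSup_upper[OF _ bdd_above_infdist_cball] max.cobounded1] assms)
      (auto simp: dist_norm norm_minus_commute)
  show "infdist y E \<le> r * ball_dist x r E F" if "y \<in> F" "norm (y - x) \<le> r"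
    unfolding e using that
    by (intro order_trans[OF cSup_upper[OF _ bdd_above_infdist_cball] max.cobounded2] assms)
      (auto simp: dist_norm norm_minus_commute)
  have "0 \<le> ?a" by (intro cSup_upper bdd_above_infdist_cball assms) auto
  then have "0 \<le> r * ball_dist x r E F" unfolding e by simp
  then show "0 \<le> ball_dist x r E F" using r by (simp add: zero_le_mult_iff)
qed

lemma ball_dist_le:
  fixes x :: "'a::real_normed_vector"
  assumes nt: "\<exists>v::'a. v \<noteq> 0" and r: "r > 0" and \<eta>: "0 \<le> \<eta>"
    and EF: "\<And>y. y \<in> E \<Longrightarrow> norm (y - x) \<le> r \<Longrightarrow> infdist y F \<le> r * \<eta>"
    and FE: "\<And>y. y \<in> F \<Longrightarrow> norm (y - x) \<le> r \<Longrightarrow> infdist y E \<le> r * \<eta>"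
  shows "ball_dist x r E F \<le> \<eta>"
proof -
  have "Sup (insert 0 ((\<lambda>y. infdist y F) ` (E \<inter> cball x r))) \<le> r * \<eta>"
    using EF r \<eta> by (intro cSup_least) (auto simp: dist_norm norm_minus_commute)
  moreover have "Sup (insert 0 ((\<lambda>y. infdist y E) ` (F \<inter> cball x r))) \<le> r * \<eta>"
    using FE r \<eta> by (intro cSup_least) (auto simp: dist_norm norm_minus_commute)
  ultimately show ?thesis
    using r by (simp add: ball_dist_def diameter_cball_nontrivial[OF nt] divide_simps mult.commute)
qed

text \<open>Applying the distance bound at \<open>p\<close> and at \<open>p + u\<close> with
  \<open>norm u = r / 2\<close> shows that a direction of length \<open>r / 2\<close> is off by at
  most \<open>2 * r * \<beta>\<close>: a relative gap \<open>4 * \<beta>\<close>, hence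
  \<open>8 * \<beta>\<close> for the projections. That \<open>p\<close> lies in the half ball keeps
  \<open>p + u\<close> in the ball. The 5 is 1 for the offset at \<open>p\<close> plus 8/2 for the
  distance from \<open>p\<close> to \<open>x\<close>.\<close>

lemma plane_near:
  fixes E F :: "'a::real_inner set"
  assumes nt: "\<exists>v::'a. v \<noteq> 0" and E: "is_plane d E" and F: "is_plane d' F" and r: "r > 0"
    and \<beta>: "ball_dist x r E F \<le> \<beta>"
    and p: "p \<in> E" "norm (p - x) \<le> r / 2" and q: "q \<in> F" "norm (q - x) \<le> r / 2"
  shows "norm (Dp E - Dp F) \<le> 8 * \<beta>"
    and "norm (plane_proj E y - plane_proj F y) \<le> \<beta> * (5 * r + 8 * norm (y - x))"
    and "0 \<le> \<beta>"
    and "z \<in> E \<Longrightarrow> norm (z - x) \<le> r \<Longrightarrow> norm (z - plane_proj F z) \<le> r * \<beta>"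
    and "z \<in> F \<Longrightarrow> norm (z - x) \<le> r \<Longrightarrow> norm (z - plane_proj E z) \<le> r * \<beta>"
proof -
  have ne: "E \<noteq> {}" "F \<noteq> {}" using p q by auto
  note b = infdist_le_ball_dist[OF nt r ne]
  show \<beta>0: "0 \<le> \<beta>" using b(3) \<beta> by (rule order_trans)
  have rb: "r * ball_dist x r E F \<le> r * \<beta>" using \<beta> r by simp
  show EF: "norm (z - plane_proj F z) \<le> r * \<beta>" if "z \<in> E" "norm (z - x) \<le> r" for z
    using b(1)[OF that] rb infdist_plane[OF F] by simp
  show FE: "norm (z - plane_proj E z) \<le> r * \<beta>" if "z \<in> F" "norm (z - x) \<le> r" for z
    using b(2)[OF that] rb infdist_plane[OF E] by simp
  have gen: "norm (v - Dp F v) \<le> (4 * \<beta>) * norm v"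
    if E: "is_plane d E" and F: "is_plane d' F" and p: "p \<in> E" "norm (p - x) \<le> r / 2"
      and EF: "\<And>z. z \<in> E \<Longrightarrow> norm (z - x) \<le> r \<Longrightarrow> norm (z - plane_proj F z) \<le> r * \<beta>"
      and v: "v \<in> directions E" for E F :: "'a set" and d d' p v
  proof (cases "v = 0")
    case False
    define u where "u = (r / (2 * norm v)) *\<^sub>R v"
    have nu: "norm u = r / 2" using False r by (simp add: u_def)
    have "u \<in> directions E" unfolding u_def using subspace_directions[OF E] v by (rule subspace_scale)
    then have pu: "p + u \<in> E" using plane_translate_iff[OF E p(1)] by simp
    have "norm (p + u - x) \<le> r"
      using norm_triangle_ineq[of "p - x" u] p(2) nu by (simp add: algebra_simps)
    from EF[OF pu this] have 1: "norm (p + u - plane_proj F (p + u)) \<le> r * \<beta>" .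
    have 2: "norm (p - plane_proj F p) \<le> r * \<beta>" using EF[OF p(1)] p(2) r by simp
    have "u - Dp F u = (p + u - plane_proj F (p + u)) - (p - plane_proj F p)"
      using plane_proj_diff[OF F, of "p + u" p] by simp
    then have "norm (u - Dp F u) \<le> norm (p + u - plane_proj F (p + u)) + norm (p - plane_proj F p)"
      by (simp only: norm_triangle_ineq4)
    then have 3: "norm (u - Dp F u) \<le> 2 * (r * \<beta>)" using 1 2 by linarith
    have "v = (2 * norm v / r) *\<^sub>R u" using False r by (simp add: u_def)
    then have "v - Dp F v = (2 * norm v / r) *\<^sub>R (u - Dp F u)"
      by (metis blinfun.scaleR_right scaleR_right_diff_distrib)
    then have "norm (v - Dp F v) = 2 * norm v / r * norm (u - Dp F u)" using r by simp
    also have "\<dots> \<le> 2 * norm v / r * (2 * (r * \<beta>))" using 3 r by (intro mult_left_mono) auto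
    finally show ?thesis using r by (simp add: mult_ac)
  qed (simp add: blinfun.zero_right)
  have "norm (Dp E - Dp F) \<le> 2 * (4 * \<beta>)"
    using gen[OF E F p EF] gen[OF F E q FE] \<beta>0 by (intro norm_Dp_diff_le[OF E F]) auto
  then show D: "norm (Dp E - Dp F) \<le> 8 * \<beta>" by simp
  have "plane_proj E y - plane_proj F y = (p - plane_proj F p) + (Dp E - Dp F) (y - p)"
    using plane_proj_add[OF E p(1), of y] plane_proj_diff[OF F, of y p] by (simp add: blinfun.diff_left)
  also have "norm \<dots> \<le> r * \<beta> + 8 * \<beta> * norm (y - p)"
  proof (rule order_trans[OF norm_triangle_ineq], rule add_mono)
    show "norm (p - plane_proj F p) \<le> r * \<beta>" using EF[OF p(1)] p(2) r by simp
    show "norm ((Dp E - Dp F) (y - p)) \<le> 8 * \<beta> * norm (y - p)"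
      using norm_blinfun[of "Dp E - Dp F" "y - p"] mult_right_mono[OF D, of "norm (y - p)"] by simp
  qed
  also have "\<dots> \<le> r * \<beta> + 8 * \<beta> * (norm (y - x) + r / 2)"
    using norm_triangle_ineq4[of "y - x" "p - x"] p(2) \<beta>0 by (intro add_left_mono mult_left_mono) auto
  finally show "norm (plane_proj E y - plane_proj F y) \<le> \<beta> * (5 * r + 8 * norm (y - x))"
    by (simp add: algebra_simps)
qed

text \<open>Coordinates in the plane are rounded with mesh \<open>r / (2 * d)\<close>. Two points in
  one cell would differ by at most \<open>r / 2\<close> along the plane and by \<open>r / 10\<close>
  each across it, less than \<open>r\<close> in total, so rounding is injective. There are
  \<open>160 * d + 1\<close> values per coordinate.\<close>

lemma plane_packing:
  fixes P :: "'a::real_inner set" and c :: "'i \<Rightarrow> 'a"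
  assumes P: "is_plane d P" and d: "d \<ge> 1" and r: "r > 0"
    and near: "\<And>l. l \<in> I \<Longrightarrow> norm (c l - x) \<le> 40 * r"
    and plane: "\<And>l. l \<in> I \<Longrightarrow> norm (c l - plane_proj P (c l)) \<le> r / 10"
    and sep: "\<And>l m. l \<in> I \<Longrightarrow> m \<in> I \<Longrightarrow> l \<noteq> m \<Longrightarrow> norm (c l - c m) \<ge> r"
  shows "finite I" "card I \<le> (200 * d) ^ d"
proof -
  obtain a b where b: "onb d b" "\<And>v. Dp P v = oproj d b v" using plane_onb[OF P] by metis
  have nb: "norm (b i) = 1" if "i < d" for i
    using b(1) that unfolding onb_def by (simp add: norm_eq_sqrt_inner)
  define h where "h l = restrict (\<lambda>i. \<lfloor>2 * d / r * ((c l - x) \<bullet> b i)\<rfloor>) {..<d}" for l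
  let ?A = "{- (80 * int d)..80 * int d}"
  have img: "h ` I \<subseteq> PiE {..<d} (\<lambda>_. ?A)"
    unfolding h_def
  proof (intro image_subsetI restrict_PiE_iff[THEN iffD2] ballI)
    fix l i assume l: "l \<in> I" and "i \<in> {..<d}"
    then have i: "i < d" by simp
    have "\<bar>(c l - x) \<bullet> b i\<bar> \<le> 40 * r"
      using Cauchy_Schwarz_ineq2[of "c l - x" "b i"] nb[OF i] near[OF l] by simp
    then have "\<bar>2 * d / r * ((c l - x) \<bullet> b i)\<bar> \<le> 2 * d / r * (40 * r)"
      unfolding abs_mult using r by (intro mult_mono) auto
    then have "\<bar>2 * d / r * ((c l - x) \<bullet> b i)\<bar> \<le> 80 * real d" using r by simp
    then show "\<lfloor>2 * d / r * ((c l - x) \<bullet> b i)\<rfloor> \<in> ?A"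
      by (simp only: atLeastAtMost_iff abs_le_iff le_floor_iff floor_le_iff) auto
  qed
  have inj: "inj_on h I"
  proof (rule inj_onI, rule ccontr)
    fix l m assume lm: "l \<in> I" "m \<in> I" "h l = h m" "l \<noteq> m"
    let ?v = "c l - c m"
    have co: "\<bar>?v \<bullet> b i\<bar> \<le> r / (2 * d)" if "i < d" for i
    proof -
      have "\<lfloor>2 * d / r * ((c l - x) \<bullet> b i)\<rfloor> = \<lfloor>2 * d / r * ((c m - x) \<bullet> b i)\<rfloor>"
        using fun_cong[OF lm(3), of i] that by (simp add: h_def)
      then have "\<bar>2 * d / r * ((c l - x) \<bullet> b i) - 2 * d / r * ((c m - x) \<bullet> b i)\<bar> \<le> 1" by linarith
      moreover have "2 * d / r * ((c l - x) \<bullet> b i) - 2 * d / r * ((c m - x) \<bullet> b i) = 2 * d / r * (?v \<bullet> b i)"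
        unfolding right_diff_distrib[symmetric] inner_diff_left[symmetric] by simp
      ultimately have "2 * d / r * \<bar>?v \<bullet> b i\<bar> \<le> 1" using r by (simp add: abs_mult)
      then show ?thesis using r d by (simp add: field_simps)
    qed
    have "norm (Dp P ?v) \<le> (\<Sum>i<d. norm ((?v \<bullet> b i) *\<^sub>R b i))" unfolding b(2) oproj_def by (rule norm_sum)
    also have "\<dots> \<le> (\<Sum>i<d. r / (2 * d))" using co nb by (intro sum_mono) auto
    also have "\<dots> = r / 2" using d by simp
    finally have 1: "norm (Dp P ?v) \<le> r / 2" .
    have "?v = Dp P ?v + ((c l - plane_proj P (c l)) - (c m - plane_proj P (c m)))"
      using plane_proj_diff[OF P, of "c l" "c m"] by simp
    then have "norm ?v \<le> norm (Dp P ?v) + (norm (c l - plane_proj P (c l)) + norm (c m - plane_proj P (c m)))"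
      by (metis (no_types, lifting) add_left_mono norm_triangle_ineq norm_triangle_ineq4 order_trans)
    then show False using 1 plane[OF lm(1)] plane[OF lm(2)] sep[OF lm(1,2,4)] r by linarith
  qed
  have fin: "finite (PiE {..<d} (\<lambda>_. ?A))" by (intro finite_PiE) auto
  show "finite I" using inj_on_finite[OF inj img fin] .
  have "card I \<le> card (PiE {..<d} (\<lambda>_. ?A))" by (rule card_inj_on_le[OF inj img fin])
  also have "\<dots> = (card ?A) ^ d" by (simp add: card_PiE)
  also have "card ?A = 160 * d + 1" by simp
  also have "(160 * d + 1) ^ d \<le> (200 * d) ^ d" using d by (intro power_mono) auto
  finally show "card I \<le> (200 * d) ^ d" .
qed

section \<open>Surfaces given by small perturbations of planes\<close>

lemma c2_lin:
  fixes T :: "'a::real_normed_vector \<Rightarrow>\<^sub>L 'b::real_normed_vector"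
  shows "c2 (\<lambda>x. T x + b)" "D1 (\<lambda>x. T x + b) = (\<lambda>x. T)" "D2 (\<lambda>x. T x + b) = (\<lambda>x. 0)"
proof -
  show *: "D1 (\<lambda>x. T x + b) = (\<lambda>x. T)"
    using c2_affine(2)[OF blinfun.bounded_linear_right] by (simp add: blinfun_apply_inverse)
  show "c2 (\<lambda>x. T x + b)" by (rule c2_affine(1)[OF blinfun.bounded_linear_right])
  show "D2 (\<lambda>x. T x + b) = (\<lambda>x. 0)" unfolding * by (rule D1_const)
qed

lemma c2_lin_compose:
  fixes T :: "'b::real_normed_vector \<Rightarrow>\<^sub>L 'c::real_normed_vector"
  assumes f: "c2 f"
  shows "c2 (\<lambda>x. T (f x))" "norm (D1 (\<lambda>x. T (f x)) x) \<le> norm T * norm (D1 f x)"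
    "norm (D2 (\<lambda>x. T (f x)) x) \<le> norm T * norm (D2 f x)"
  using c2_compose[OF c2_lin(1)[of T 0] f] by (simp_all add: c2_lin(2,3)[of T 0, simplified] D1_const)

lemma c2_compose_lin:
  fixes T :: "'a::real_normed_vector \<Rightarrow>\<^sub>L 'b::real_normed_vector"
  assumes f: "c2 f"
  shows "c2 (\<lambda>x. f (T x + b))" "norm (D1 (\<lambda>x. f (T x + b)) x) \<le> norm (D1 f (T x + b)) * norm T"
    "norm (D2 (\<lambda>x. f (T x + b)) x) \<le> norm (D2 f (T x + b)) * (norm T)\<^sup>2"
  using c2_compose[OF f c2_lin(1)[of T b]] by (simp_all add: c2_lin(2,3)[of T b] D1_const)

lemma plane_proj_affine:
  assumes "is_plane d P"
  shows "plane_proj P = (\<lambda>y. Dp P y + plane_proj P 0)"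
proof
  show "plane_proj P y = Dp P y + plane_proj P 0" for y
    using plane_proj_diff[OF assms, of y 0] by (simp only: diff_zero add.commute)
qed

lemma norm_id_minus_Dp:
  assumes "is_plane d P"
  shows "norm (id_blinfun - Dp P) \<le> 1"
  by (rule norm_blinfun_bound) (simp_all add: blinfun.diff_left norm_Dp_complement_le[OF assms])

text \<open>Move along \<open>Q'\<close> instead of \<open>Q\<close>: on \<open>Q'\<close> the map
  \<open>p + F p\<close> equals the perturbed projection to \<open>Q\<close>. Its component along
  \<open>Q'\<close> is a small perturbation of the identity with inverse \<psi>, and the normal
  component of \<open>F\<close> after \<psi> is the new graph function. The constants are
  \<open>2 * \<eta> * 2\<close> and \<open>2 * \<eta> * 8 * \<kappa> + 4 * \<kappa>\<close>.\<close>

lemma reparam_graph: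
  fixes Q Q' :: "'a::{real_inner,complete_space} set" and E :: "'a \<Rightarrow> 'a"
  assumes Q: "is_plane d Q" and Q': "is_plane d' Q'" and E: "c2 E"
    and ang: "norm (Dp Q - Dp Q') \<le> \<eta>" and E1: "\<And>y. norm (D1 E y) \<le> \<eta>"
    and E2: "\<And>y. norm (D2 E y) \<le> \<kappa>" and \<eta>: "\<eta> \<le> 1/20"
    and x0: "x0 \<in> Q'" "norm (plane_proj Q x0 - x0) \<le> a" "norm (E (plane_proj Q x0)) \<le> a"
  obtains A where "c2 A" "\<And>q. A q \<in> perp Q'" "\<And>q. norm (D1 A q) \<le> 4 * \<eta>" "\<And>q. norm (D2 A q) \<le> 5 * \<kappa>"
    "norm (A x0) \<le> 4 * a" "graph_over Q' A = (\<lambda>q. q + E q) ` Q"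
proof -
  have \<eta>0: "0 \<le> \<eta>" using ang norm_ge_zero order_trans by blast
  have \<kappa>0: "0 \<le> \<kappa>" using E2 norm_ge_zero order_trans by blast
  let ?\<pi> = "plane_proj Q" and ?\<pi>' = "plane_proj Q'"
  define T where "T = Dp Q o\<^sub>L Dp Q'"
  define t where "t = ?\<pi> (?\<pi>' 0)"
  have g: "?\<pi> (?\<pi>' p) = T p + t" for p
    using plane_proj_diff[OF Q, of "?\<pi>' p" "?\<pi>' 0"] plane_proj_diff[OF Q', of p 0] by (simp add: T_def t_def)
  have nT: "norm T \<le> 1"
    unfolding T_def using order_trans[OF norm_blinfun_compose mult_mono[OF norm_Dp[OF Q] norm_Dp[OF Q']]] by simp
  define L where "L = T - Dp Q'"
  have nL: "norm L \<le> \<eta>"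
  proof (rule norm_blinfun_bound[OF \<eta>0])
    fix v
    have "L v = (Dp Q - Dp Q') (Dp Q' v)"
      using Dp_idem[OF Q'] by (simp add: L_def T_def blinfun.diff_left)
    also have "norm \<dots> \<le> \<eta> * norm (Dp Q' v)"
      using norm_blinfun[of "Dp Q - Dp Q'"] mult_right_mono[OF ang] order_trans norm_ge_zero by blast
    also have "\<dots> \<le> \<eta> * norm v" using norm_Dp_le[OF Q'] \<eta>0 by (intro mult_left_mono) auto
    finally show "norm (L v) \<le> \<eta> * norm v" .
  qed
  have Lp: "?\<pi> (?\<pi>' p) - ?\<pi>' p = L p + (t - ?\<pi>' 0)" for p
  proof -
    have "?\<pi>' p = Dp Q' p + ?\<pi>' 0" using plane_proj_diff[OF Q', of p 0] by simp
    then show ?thesis unfolding g by (simp add: L_def blinfun.diff_left algebra_simps)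
  qed
  \<comment> \<open>Projecting to \<open>Q'\<close> first extends the formula from \<open>Q'\<close>
    to the whole space, as required by \<open>c2_inverse\<close>.\<close>
  define F where "F p = (L p + (t - ?\<pi>' 0)) + E (T p + t)" for p
  have F: "F p = ?\<pi> (?\<pi>' p) - ?\<pi>' p + E (?\<pi> (?\<pi>' p))" for p unfolding F_def Lp[symmetric] g[symmetric] by (rule refl)
  note la = c2_lin[of L "t - ?\<pi>' 0"] and lb = c2_compose_lin[OF E, of T t]
  have cF: "c2 F" unfolding F_def[abs_def] by (rule c2_add(1)[OF la(1) lb(1)])
  have F1: "norm (D1 F p) \<le> 2 * \<eta>" for p
  proof -
    have "norm (D1 (\<lambda>p. E (T p + t)) p) \<le> \<eta> * 1"
      by (rule order_trans[OF lb(2)], intro mult_mono E1 nT) (use \<eta>0 in auto)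
    then show ?thesis
      unfolding F_def[abs_def] c2_add(2)[OF la(1) lb(1)] la(2)
      using norm_triangle_ineq[of L "D1 (\<lambda>p. E (T p + t)) p"] nL by simp
  qed
  have F2: "norm (D2 F p) \<le> \<kappa>" for p
  proof -
    have "norm (D2 (\<lambda>p. E (T p + t)) p) \<le> \<kappa> * 1\<^sup>2"
      by (rule order_trans[OF lb(3)], intro mult_mono power_mono E2 nT) (use \<kappa>0 in auto)
    then show ?thesis
      unfolding F_def[abs_def] c2_add(3)[OF la(1) lb(1)] la(3) by simp
  qed
  define e where "e p = Dp Q' (F p)" for p
  note le = c2_lin_compose[OF cF, of "Dp Q'", folded e_def[abs_def]]
  have ce: "c2 e" by (fact le(1))
  have e1: "norm (D1 e p) \<le> 2 * \<eta>" for p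
    using order_trans[OF le(2) mult_mono[OF norm_Dp[OF Q'] F1]] by simp
  have e2: "norm (D2 e p) \<le> \<kappa>" for p
    using order_trans[OF le(3) mult_mono[OF norm_Dp[OF Q'] F2]] by simp
  have e1': "norm (D1 e p) \<le> 1/2" for p using e1[of p] \<eta> by simp
  obtain \<psi> where \<psi>: "c2 \<psi>" "\<And>x. \<psi> x + e (\<psi> x) = x" "\<And>x. \<psi> (x + e x) = x"
    "\<And>x. norm (D1 \<psi> x) \<le> 2" "\<And>x. norm (D2 \<psi> x) \<le> 8 * norm (D2 e (\<psi> x))"
    "\<And>x y. norm (\<psi> x - \<psi> y) \<le> 2 * norm (x - y)"
    using c2_inverse[OF ce e1'] by metis
  note lF = c2_compose[OF cF \<psi>(1)]
  have F\<psi>1: "norm (D1 (\<lambda>q. F (\<psi> q)) q) \<le> 4 * \<eta>" for q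
    using order_trans[OF lF(2) mult_mono[OF F1 \<psi>(4)]] \<eta>0 by simp
  have F\<psi>2: "norm (D2 (\<lambda>q. F (\<psi> q)) q) \<le> 5 * \<kappa>" for q
  proof -
    have "norm (D2 \<psi> q) \<le> 8 * \<kappa>" using \<psi>(5)[of q] e2[of "\<psi> q"] by linarith
    then have "norm (D2 (\<lambda>q. F (\<psi> q)) q) \<le> (2 * \<eta>) * (8 * \<kappa>) + \<kappa> * 2\<^sup>2"
      by (intro order_trans[OF lF(3)] add_mono mult_mono power_mono F1 F2 \<psi>(4)) (use \<eta>0 \<kappa>0 in auto)
    also have "(2 * \<eta>) * (8 * \<kappa>) \<le> (2 * (1/20)) * (8 * \<kappa>)" using \<eta> \<kappa>0 by (intro mult_right_mono) auto
    finally show ?thesis using \<kappa>0 by simp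
  qed
  define N where "N = id_blinfun - Dp Q'"
  have nN: "norm N \<le> 1" unfolding N_def by (rule norm_id_minus_Dp[OF Q'])
  define A where "A q = N (F (\<psi> q))" for q
  note lA = c2_lin_compose[OF lF(1), of N, folded A_def[abs_def]]
  have A: "A q = F (\<psi> q) - Dp Q' (F (\<psi> q))" for q by (simp add: A_def N_def blinfun.diff_left)
  have A1: "norm (D1 A q) \<le> 4 * \<eta>" for q using order_trans[OF lA(2) mult_mono[OF nN F\<psi>1]] by simp
  have A2: "norm (D2 A q) \<le> 5 * \<kappa>" for q using order_trans[OF lA(3) mult_mono[OF nN F\<psi>2]] by simp
  have Ap: "A q \<in> perp Q'" for q unfolding A by (rule Dp_complement_perp[OF Q'])
  have Ax0: "norm (A x0) \<le> 4 * a"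
  proof -
    have x': "?\<pi>' x0 = x0" by (rule plane_proj_id[OF Q' x0(1)])
    have Fx: "norm (F x0) \<le> 2 * a"
      unfolding F x' using norm_triangle_ineq[of "?\<pi> x0 - x0" "E (?\<pi> x0)"] x0(2,3) by simp
    have "norm (\<psi> x0 - x0) \<le> 2 * norm (F x0)"
      using \<psi>(6)[of x0 "x0 + e x0"] \<psi>(3)[of x0] norm_Dp_le[OF Q', of "F x0"] by (simp add: e_def)
    moreover have "norm (F (\<psi> x0) - F x0) \<le> 2 * \<eta> * norm (\<psi> x0 - x0)"
      by (rule c1_lipschitz[OF c2_c1[OF cF] convex_UNIV F1]) auto
    moreover have "2 * \<eta> * norm (\<psi> x0 - x0) \<le> 1/2 * norm (\<psi> x0 - x0)"
      using \<eta> by (intro mult_right_mono) auto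
    ultimately have "norm (F (\<psi> x0)) \<le> 2 * norm (F x0)"
      using norm_triangle_ineq[of "F (\<psi> x0) - F x0" "F x0"] by simp
    moreover have "norm (A x0) \<le> norm (F (\<psi> x0))" unfolding A by (rule norm_Dp_complement_le[OF Q'])
    ultimately show ?thesis using Fx by linarith
  qed
  have pF: "p + F p = ?\<pi> p + E (?\<pi> p)" if "p \<in> Q'" for p
    using plane_proj_id[OF Q' that] by (simp add: F)
  \<comment> \<open>The equation is solved in the whole space. The solution lies in
    \<open>Q'\<close> because \<open>w\<close>, its offset from \<open>Q'\<close>, is a direction of
    \<open>Q\<close> and orthogonal to \<open>Q'\<close>, so that
    \<open>norm w \<le> \<eta> * norm w\<close>.\<close>
  have surj: "\<exists>p\<in>Q'. ?\<pi> p = q" if "q \<in> Q" for q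
  proof -
    let ?e = "\<lambda>p. L p + (t - ?\<pi>' 0)"
    have "norm (?e x - ?e y) \<le> 1/2 * norm (x - y)" for x y
    proof -
      have "norm (?e x - ?e y) = norm (L (x - y))" by (simp add: blinfun.diff_right)
      then show ?thesis
        using norm_blinfun[of L "x - y"] mult_right_mono[OF order_trans[OF nL \<eta>] norm_ge_zero[of "x - y"]]
          norm_ge_zero[of "x - y"] by linarith
    qed
    then obtain p where p: "p + ?e p = q" using id_plus_contraction[of ?e q] by blast
    define w where "w = p - ?\<pi>' p"
    have wq: "w = q - ?\<pi> (?\<pi>' p)" using p unfolding w_def Lp[of p, symmetric] by (simp add: algebra_simps)
    have "w \<in> directions Q" unfolding wq by (rule plane_diff[OF Q that plane_proj_in[OF Q]])
    then have 1: "Dp Q w = w" by (rule Dp_id[OF Q])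
    have "w = (p - ?\<pi>' 0) - Dp Q' (p - ?\<pi>' 0)"
      unfolding w_def plane_proj_add[OF Q' plane_proj_in[OF Q'], of p 0] by simp
    then have 2: "Dp Q' w = 0" using Dp_complement_perp[OF Q'] perp_iff[OF Q'] by metis
    have "norm w = norm ((Dp Q - Dp Q') w)" using 1 2 by (simp add: blinfun.diff_left)
    also have "\<dots> \<le> \<eta> * norm w"
      using norm_blinfun[of "Dp Q - Dp Q'" w] mult_right_mono[OF ang, of "norm w"] by simp
    also have "\<dots> \<le> 1/2 * norm w" using \<eta> by (intro mult_right_mono) auto
    finally have "w = 0" by simp
    then have "p = ?\<pi>' p" "q = ?\<pi> (?\<pi>' p)" using wq by (auto simp: w_def)
    then show ?thesis using plane_proj_in[OF Q', of p] by metis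
  qed
  have gr: "graph_over Q' A = (\<lambda>q. q + E q) ` Q"
  proof (intro equalityI subsetI)
    fix z assume "z \<in> graph_over Q' A"
    then obtain q where q: "q \<in> Q'" "z = q + A q" by (auto simp: graph_over_def)
    let ?p = "\<psi> q"
    \<comment> \<open>The inverse preserves \<open>Q'\<close>, since \<open>e\<close> takes its
      values in the directions of \<open>Q'\<close>.\<close>
    have "q + - e ?p \<in> Q'"
      using plane_translate_iff[OF Q' q(1), of "- e ?p"] Dp_in_directions[OF Q', of "F ?p"]
        subspace_neg[OF subspace_directions[OF Q']] by (simp add: e_def)
    then have pQ: "?p \<in> Q'" using \<psi>(2)[of q] by (metis add_diff_cancel_right' diff_conv_add_uminus)
    have "z = ?p + F ?p" using \<psi>(2)[of q] unfolding q(2) A e_def by (simp add: algebra_simps)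
    then show "z \<in> (\<lambda>q. q + E q) ` Q" using pF[OF pQ] plane_proj_in[OF Q] by auto
  next
    fix z assume "z \<in> (\<lambda>q. q + E q) ` Q"
    then obtain q0 where q0: "q0 \<in> Q" "z = q0 + E q0" by auto
    obtain p where p: "p \<in> Q'" "?\<pi> p = q0" using surj[OF q0(1)] by auto
    let ?q = "p + e p"
    have "?q \<in> Q'" using plane_translate_iff[OF Q' p(1)] Dp_in_directions[OF Q'] by (simp add: e_def)
    moreover have "z = ?q + A ?q"
      unfolding A \<psi>(3) using pF[OF p(1)] p(2) q0(2) by (simp add: e_def)
    ultimately show "z \<in> graph_over Q' A" by (auto simp: graph_over_def)
  qed
  show ?thesis using that[OF lA(1) Ap A1 A2 Ax0 gr] .
qed

text \<open>Conclusion 8 asks for a plane through the given point. A parallel shift by the value of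
  \<open>A\<close> at its foot achieves this and changes no derivative.\<close>

lemma graph_translate:
  fixes Q :: "'a::real_inner set"
  assumes Q: "is_plane d Q" and A: "c2 A" and Ap: "\<And>q. A q \<in> perp Q" and y: "y \<in> graph_over Q A"
    and A1: "\<And>q. norm (D1 A q) \<le> \<eta>" and A2: "\<And>q. norm (D2 A q) \<le> \<kappa>"
  obtains Q' A' where "is_plane d Q'" "y \<in> Q'" "c2 A'" "\<And>q. A' q \<in> perp Q'"
    "\<And>q. norm (D1 A' q) \<le> \<eta>" "\<And>q. norm (D2 A' q) \<le> \<kappa>" "graph_over Q' A' = graph_over Q A"
proof -
  obtain q0 where q0: "q0 \<in> Q" "y = q0 + A q0" using y by (auto simp: graph_over_def)
  define w where "w = A q0"
  define Q' where "Q' = (\<lambda>p. p + w) ` Q"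
  define A' where "A' q = A (id_blinfun q + (- w)) + (- w)" for q
  have Q': "is_plane d Q'" "directions Q' = directions Q" unfolding Q'_def by (rule plane_translate[OF Q])+
  note l = c2_compose_lin[OF A, of id_blinfun "- w"]
  note k = c2_affine[OF bounded_linear_zero, of "- w", simplified]
  have D: "D1 A' = D1 (\<lambda>q. A (id_blinfun q + (- w)))"
    unfolding A'_def[abs_def] using c2_add(2)[OF l(1) k(1)] by (simp add: D1_const)
  have n1: "norm (id_blinfun :: 'a \<Rightarrow>\<^sub>L 'a) \<le> 1" by (rule norm_blinfun_id_le)
  show ?thesis
  proof (rule that[OF Q'(1)])
    show "y \<in> Q'" unfolding Q'_def w_def q0(2) using q0(1) by blast
    show "c2 A'" unfolding A'_def[abs_def] by (rule c2_add(1)[OF l(1) k(1)])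
    show "A' q \<in> perp Q'" for q
      using perp_iff[OF Q] Ap unfolding Q'(2) A'_def w_def by (simp add: blinfun.diff_right)
    show "norm (D1 A' q) \<le> \<eta>" for q
      unfolding D using order_trans[OF l(2) mult_mono[OF A1 n1]] order_trans[OF norm_ge_zero A1] by simp
    have "(norm (id_blinfun :: 'a \<Rightarrow>\<^sub>L 'a))\<^sup>2 \<le> 1" using n1 by (simp add: power_le_one)
    then show "norm (D2 A' q) \<le> \<kappa>" for q
      unfolding D using order_trans[OF l(3) mult_mono[OF A2]] order_trans[OF norm_ge_zero A2] by fastforce
    show "graph_over Q' A' = graph_over Q A"
      unfolding graph_over_def Q'_def A'_def by (auto, metis add.assoc add.commute add_diff_cancel_right' diff_add_cancel imageI)
  qed
qed

subsection \<open>Tangent spaces of graphs\<close>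

lemma graph_point:
  assumes Q: "is_plane d Q" and Ap: "\<And>q. A q \<in> perp Q" and z: "z \<in> graph_over Q A"
  shows "z = plane_proj Q z + A (plane_proj Q z)"
  using z plane_proj_eq[OF Q _ Ap] by (auto simp: graph_over_def)

text \<open>A curve in \<open>S\<close> through \<open>z\<close> stays in the graph for small times,
  so it is determined by its projection to \<open>Q\<close>, and the chain rule gives its velocity.
  Conversely, lines in \<open>Q\<close> lift to curves in the graph.\<close>

lemma tangent_space_graph:
  fixes Q :: "'a::real_inner set"
  assumes Q: "is_plane d Q" and A: "c2 A" and Ap: "\<And>q. A q \<in> perp Q"
    and S: "S \<inter> cball y R = graph_over Q A \<inter> cball y R" and z: "z \<in> S" "norm (z - y) < R"
  shows "tangent_space S z = (\<lambda>v. v + D1 A (plane_proj Q z) v) ` directions Q"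
proof -
  let ?q = "plane_proj Q z"
  have zg: "z \<in> graph_over Q A" using S z by (force simp: dist_norm norm_minus_commute)
  have zq: "z = ?q + A ?q" by (rule graph_point[OF Q Ap zg])
  have dA: "(A has_derivative blinfun_apply (D1 A ?q)) (at ?q)" by (rule c1_has_derivative[OF c2_c1[OF A]])
  have ball: "open (ball y R)" "z \<in> ball y R" using z by (auto simp: dist_norm norm_minus_commute)
  show ?thesis
  proof (intro equalityI subsetI)
    fix v assume "v \<in> tangent_space S z"
    then obtain \<gamma> where \<gamma>: "\<gamma> 0 = z" "\<forall>\<^sub>F t in at 0. \<gamma> t \<in> S" "(\<gamma> has_vector_derivative v) (at 0)"
      unfolding tangent_space_def by blast
    have "(\<gamma> \<longlongrightarrow> z) (at 0)"
      using has_vector_derivative_continuous[OF \<gamma>(3)] \<gamma>(1) by (simp add: continuous_within)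
    then have "\<forall>\<^sub>F t in at 0. \<gamma> t \<in> ball y R" using ball by (rule topological_tendstoD)
    with \<gamma>(2) have ev: "\<forall>\<^sub>F t in at 0. \<gamma> t = plane_proj Q (\<gamma> t) + A (plane_proj Q (\<gamma> t))"
    proof eventually_elim
      case (elim t)
      then have "\<gamma> t \<in> S \<inter> cball y R" by auto
      then have "\<gamma> t \<in> graph_over Q A" unfolding S by blast
      then show ?case by (rule graph_point[OF Q Ap])
    qed
    have \<gamma>d: "(\<gamma> has_derivative (\<lambda>t. t *\<^sub>R v)) (at 0)" using \<gamma>(3) by (simp add: has_vector_derivative_def)
    have pd: "((\<lambda>t. plane_proj Q (\<gamma> t)) has_derivative (\<lambda>t. t *\<^sub>R Dp Q v)) (at 0)"
    proof -
      have "(\<lambda>t. plane_proj Q (\<gamma> t)) = (\<lambda>t. Dp Q (\<gamma> t) + plane_proj Q 0)"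
        by (subst plane_proj_affine[OF Q]) (rule refl)
      then show ?thesis
        using has_derivative_add[OF bounded_linear.has_derivative[OF blinfun.bounded_linear_right[of "Dp Q"] \<gamma>d]
            has_derivative_const[of "plane_proj Q 0"]]
        by (simp add: blinfun.scaleR_right)
    qed
    have Ad: "((\<lambda>t. A (plane_proj Q (\<gamma> t))) has_derivative (\<lambda>t. D1 A ?q (t *\<^sub>R Dp Q v))) (at 0)"
      using diff_chain_at[OF pd, of A "blinfun_apply (D1 A ?q)"] dA \<gamma>(1) by (simp add: o_def)
    have "((\<lambda>t. plane_proj Q (\<gamma> t) + A (plane_proj Q (\<gamma> t))) has_derivative
        (\<lambda>t. t *\<^sub>R Dp Q v + D1 A ?q (t *\<^sub>R Dp Q v))) (at 0)"
      by (rule has_derivative_add[OF pd Ad])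
    then have "(\<gamma> has_derivative (\<lambda>t. t *\<^sub>R Dp Q v + D1 A ?q (t *\<^sub>R Dp Q v))) (at 0)"
      by (rule has_derivative_transform_eventually) (use ev zq \<gamma>(1) in \<open>auto elim: eventually_mono\<close>)
    from fun_cong[OF has_derivative_unique[OF \<gamma>d this], of 1]
    have "v = Dp Q v + D1 A ?q (Dp Q v)" by simp
    then show "v \<in> (\<lambda>v. v + D1 A ?q v) ` directions Q" using Dp_in_directions[OF Q, of v] by blast
  next
    fix v assume "v \<in> (\<lambda>v. v + D1 A ?q v) ` directions Q"
    then obtain u where u: "u \<in> directions Q" "v = u + D1 A ?q u" by blast
    define \<gamma> where "\<gamma> t = (?q + t *\<^sub>R u) + A (?q + t *\<^sub>R u)" for t :: real
    have pd: "((\<lambda>t. ?q + t *\<^sub>R u) has_derivative (\<lambda>t. t *\<^sub>R u)) (at 0)"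
      by (auto intro!: derivative_eq_intros)
    have "((\<lambda>t. A (?q + t *\<^sub>R u)) has_derivative (\<lambda>t. D1 A ?q (t *\<^sub>R u))) (at 0)"
      using diff_chain_at[OF pd, of A "blinfun_apply (D1 A ?q)"] dA by (simp add: o_def)
    from has_derivative_add[OF pd this] have "(\<gamma> has_derivative (\<lambda>t. t *\<^sub>R v)) (at 0)"
      unfolding \<gamma>_def[abs_def] u(2) by (simp add: blinfun.scaleR_right scaleR_add_right)
    then have d: "(\<gamma> has_vector_derivative v) (at 0)" by (simp add: has_vector_derivative_def)
    have g0: "\<gamma> 0 = z" using zq by (simp add: \<gamma>_def)
    have "(\<gamma> \<longlongrightarrow> z) (at 0)"
      using has_vector_derivative_continuous[OF d] g0 by (simp add: continuous_within)
    then have "\<forall>\<^sub>F t in at 0. \<gamma> t \<in> ball y R" using ball by (rule topological_tendstoD)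
    then have "\<forall>\<^sub>F t in at 0. \<gamma> t \<in> S"
    proof eventually_elim
      case (elim t)
      have "?q + t *\<^sub>R u \<in> Q"
        using plane_translate_iff[OF Q plane_proj_in[OF Q]] subspace_scale[OF subspace_directions[OF Q] u(1)] by simp
      then have "\<gamma> t \<in> graph_over Q A" by (auto simp: graph_over_def \<gamma>_def)
      then have "\<gamma> t \<in> S \<inter> cball y R" unfolding S using elim by simp
      then show ?case by simp
    qed
    then show "v \<in> tangent_space S z" unfolding tangent_space_def using g0 d by blast
  qed
qed

lemma plane_through_0:
  assumes T: "is_plane d T" "0 \<in> T"
  shows "directions T = T" "plane_proj T v = Dp T v"
  using plane_translate_iff[OF T, of _] plane_proj_add[OF T, of v] by auto

lemma D1_in_perp:
  fixes A :: "'b::real_normed_vector \<Rightarrow> 'a::real_inner"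
  assumes Q: "is_plane d Q" and A: "c2 A" and Ap: "\<And>q. A q \<in> perp Q"
  shows "D1 A q v \<in> perp Q"
proof -
  have "Dp Q (A q) = 0" for q using Ap perp_iff[OF Q] by blast
  then have "D1 (\<lambda>q. Dp Q (A q)) q = 0" by (simp add: D1_const)
  moreover have "D1 (\<lambda>q. Dp Q (A q)) q = Dp Q o\<^sub>L D1 A q"
    using c1_compose(2)[OF c2_c1[OF c2_lin(1)[of "Dp Q" 0]] c2_c1[OF A]] c2_lin(2)[of "Dp Q" 0] by simp
  ultimately have "Dp Q (D1 A q v) = 0" by (metis blinfun_apply_blinfun_compose blinfun.zero_left)
  then show ?thesis using perp_iff[OF Q] by blast
qed

lemma graph_tangent_plane:
  fixes Q :: "'a::real_inner set" and L :: "'a \<Rightarrow>\<^sub>L 'a"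
  assumes Q: "is_plane d Q" and L: "\<And>v. L v \<in> perp Q"
  defines "T \<equiv> (\<lambda>v. v + L v) ` directions Q"
  shows "is_plane d T" "0 \<in> T" "directions T = T" "\<And>t. t \<in> T \<Longrightarrow> t = Dp Q t + L (Dp Q t)"
proof -
  obtain a b where b: "onb d b" "directions Q = span (b ` {..<d})" using plane_onb[OF Q] by metis
  let ?f = "\<lambda>v. v + L v"
  have lin: "linear ?f" by (rule linearI) (auto simp: blinfun.add_right blinfun.scaleR_right scaleR_add_right)
  have dp: "Dp Q (?f v) = v" if "v \<in> directions Q" for v
    using L perp_iff[OF Q] Dp_id[OF Q that] by (simp add: blinfun.add_right)
  have inj: "inj_on ?f (span (b ` {..<d}))"
    by (rule inj_onI) (metis b(2) dp)
  have T: "T = (\<lambda>v. 0 + v) ` span (?f ` b ` {..<d})"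
    unfolding T_def b(2) linear_span_image[OF lin] by simp
  have "card (?f ` b ` {..<d}) = d"
    using card_image[OF inj_on_subset[OF inj span_superset]] onb_independent(1)[OF b(1)] by (simp add: card_image)
  then show pT: "is_plane d T"
    unfolding is_plane_def
    using linear_independent_injective_image[OF lin onb_independent(2)[OF b(1)] inj] T
    by (intro exI[of _ 0] exI[of _ "?f ` b ` {..<d}"]) auto
  show zT: "0 \<in> T" unfolding T using span_zero by force
  show "directions T = T" by (rule plane_through_0(1)[OF pT zT])
  show "t = Dp Q t + L (Dp Q t)" if "t \<in> T" for t using that dp unfolding T_def by force
qed

text \<open>Both planes are graphs over the same directions, so \<open>v + L' v\<close> is a
  competitor for the distance from \<open>v + L v\<close> to the second plane.\<close>

lemma graph_tangent_planes_dist: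
  fixes Q :: "'a::real_inner set" and L L' :: "'a \<Rightarrow>\<^sub>L 'a"
  assumes Q: "is_plane d Q" and L: "\<And>v. L v \<in> perp Q" and L': "\<And>v. L' v \<in> perp Q"
    and \<delta>: "norm (L - L') \<le> \<delta>"
  shows "norm (Dp ((\<lambda>v. v + L v) ` directions Q) - Dp ((\<lambda>v. v + L' v) ` directions Q)) \<le> 2 * \<delta>"
proof -
  have gen: "norm (t - Dp ((\<lambda>v. v + L' v) ` directions Q) t) \<le> \<delta> * norm t"
    if L: "\<And>v. L v \<in> perp Q" and L': "\<And>v. L' v \<in> perp Q" and \<delta>: "norm (L - L') \<le> \<delta>"
      and t: "t \<in> directions ((\<lambda>v. v + L v) ` directions Q)" for L L' :: "'a \<Rightarrow>\<^sub>L 'a" and t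
  proof -
    note g = graph_tangent_plane[OF Q L] and g' = graph_tangent_plane[OF Q L']
    let ?T' = "(\<lambda>v. v + L' v) ` directions Q"
    let ?v = "Dp Q t"
    have te: "t = ?v + L ?v" using g(3,4) t by simp
    have t': "?v + L' ?v \<in> ?T'" using Dp_in_directions[OF Q] by blast
    have "norm (t - Dp ?T' t) \<le> norm (t - (?v + L' ?v))"
      using plane_proj_closest[OF g'(1) t', of t] plane_through_0(2)[OF g'(1,2)] by simp
    also have "t - (?v + L' ?v) = (L - L') ?v" using te by (simp add: blinfun.diff_left algebra_simps)
    also have "norm \<dots> \<le> \<delta> * norm ?v"
      using norm_blinfun[of "L - L'" ?v] mult_right_mono[OF \<delta>, of "norm ?v"] by simp
    also have "\<dots> \<le> \<delta> * norm t"
      using norm_Dp_le[OF Q] order_trans[OF norm_ge_zero \<delta>] by (intro mult_left_mono) auto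
    finally show ?thesis .
  qed
  show ?thesis
    using gen[OF L L' \<delta>] gen[OF L' L] \<delta> order_trans[OF norm_ge_zero \<delta>]
    by (intro norm_Dp_diff_le[OF graph_tangent_plane(1)[OF Q L] graph_tangent_plane(1)[OF Q L']])
      (auto simp: norm_minus_commute)
qed

lemma plane_angle_le:
  fixes V W :: "'a::real_inner set"
  assumes nt: "\<exists>v::'a. v \<noteq> 0" and V: "is_plane d V" "0 \<in> V" and W: "is_plane d W" "0 \<in> W"
  shows "plane_angle V W \<le> norm (Dp V - Dp W)"
proof -
  have gen: "infdist y W \<le> norm (Dp V - Dp W)" if "norm y \<le> 1" "y \<in> V"
    and V: "is_plane d V" "0 \<in> V" and W: "is_plane d W" "0 \<in> W" for y and V W :: "'a set"
  proof -
    have "infdist y W = norm ((Dp V - Dp W) y)"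
      using plane_through_0[OF V] plane_through_0[OF W] infdist_plane[OF W(1), of y] Dp_id[OF V(1), of y] that(2)
      by (simp add: blinfun.diff_left)
    also have "\<dots> \<le> norm (Dp V - Dp W) * norm y" by (rule norm_blinfun)
    also have "\<dots> \<le> norm (Dp V - Dp W) * 1" using that by (intro mult_left_mono) auto
    finally show ?thesis by simp
  qed
  show ?thesis
    unfolding plane_angle_def plane_through_0(1)[OF V] plane_through_0(1)[OF W]
    using gen[OF _ _ V W] gen[OF _ _ W V] by (intro ball_dist_le[OF nt]) (auto simp: norm_minus_commute)
qed

section \<open>The maps of a coherent collection near its centres\<close>

lemma rad_pos [simp]: "rad k > 0" and rad_nonneg [simp]: "rad k \<ge> 0"
  by (simp_all add: rad_def)

lemma rad_Suc: "rad (Suc k) = rad k / 10"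
  by (simp add: rad_def)

lemma rad_scale: "a \<le> u * rad k \<Longrightarrow> u \<le> v \<Longrightarrow> a \<le> v * rad k"
  by (rule order_trans, assumption, rule mult_right_mono) simp_all

lemma rad_0 [simp]: "rad 0 = 1"
  by (simp add: rad_def)

lemma infsum_eq_finite_sum:
  fixes f :: "'i \<Rightarrow> 'b::{comm_monoid_add,t2_space}"
  assumes "finite F" "F \<subseteq> A" "\<And>x. x \<in> A - F \<Longrightarrow> f x = 0"
  shows "infsum f A = sum f F"
proof -
  have "infsum f A = infsum f F"
    by (rule infsum_cong_neutral) (use assms in auto)
  then show ?thesis using assms(1) by simp
qed

text \<open>\<open>MM\<close> bounds, up to powers of \<open>r\<^sub>k\<close>, the first two derivatives of a sum of the bump functions
  that are active at a given point; \<open>C0\<close> bounds the graphs over the planes of the collection, whose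
  constants do not deteriorate from one scale to the next, and \<open>C2\<close> all other quantities.\<close>

definition MM :: "nat \<Rightarrow> (nat \<Rightarrow> real) \<Rightarrow> real" where
  "MM d c = max 1 (max (c 1) (c 2)) * real ((200 * d) ^ d)"

definition C0 :: "nat \<Rightarrow> (nat \<Rightarrow> real) \<Rightarrow> real" where
  "C0 d c = 320000 * MM d c"

definition C2 :: "nat \<Rightarrow> (nat \<Rightarrow> real) \<Rightarrow> real" where
  "C2 d c = 26000 * MM d c * C0 d c"

text \<open>The hypothesis \<open>small\<close> says
  \<open>10 ^ 6 * real d * \<gamma> \<le> 1\<close>. The factor \<open>real d\<close> serves the
  content bound, where a disc of radius \<rho> may be displaced by at most
  \<open>\<rho> / (2 * real d)\<close>. The sort \<open>polish_space\<close> supplies completeness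
  and separability.\<close>

locale coherent_collection =
  fixes d :: nat and c :: "nat \<Rightarrow> real" and \<epsilon> :: real
    and P0 :: "'a::{real_inner, polish_space} set" and J :: "nat \<Rightarrow> 'i set"
    and x :: "nat \<Rightarrow> 'i \<Rightarrow> 'a" and P :: "nat \<Rightarrow> 'i \<Rightarrow> 'a set" and \<theta> :: "nat \<Rightarrow> 'i \<Rightarrow> 'a \<Rightarrow> real"
  assumes d1: "d \<ge> 1" and eps0: "\<epsilon> > 0"
    and collection: "ccbp d \<epsilon> P0 J x P" and family: "partition_family c J x \<theta>"
    and small: "10 ^ 6 * real d * C2 d c * \<epsilon> \<le> 1"
begin

abbreviation "\<sigma> \<equiv> sigma_map J P \<theta>"
abbreviation "S \<equiv> surf \<sigma> P0"
abbreviation "\<pi> k j \<equiv> plane_proj (P k j)"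

definition "m = max 1 (max (c 1) (c 2))"
definition "N = real ((200 * d) ^ d)"
text \<open>Equal to \<open>400 * K\<close>. The number is dictated by the second derivative in
  \<open>adapted_Suc\<close>: there \<open>3800 * K / rad k\<close> has to stay below
  \<open>\<delta> / rad (Suc k)\<close>, which is \<open>4000 * K / rad k\<close>.\<close>

definition "\<delta> = C0 d c * \<epsilon>"
abbreviation "M \<equiv> MM d c"
text \<open>At most \<open>N\<close> bumps are active, and each contributes at most
  \<open>800 * m * \<epsilon>\<close> to \<open>G\<close> and its scaled derivatives.\<close>

definition "K = 800 * M * \<epsilon>"

lemma m1: "m \<ge> 1" and M_def': "M = m * N" and M1: "M \<ge> 1"
proof -
  show m: "m \<ge> 1" by (simp add: m_def)
  have "(200 * d) ^ d \<ge> 1" using d1 by simp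
  then have "real ((200 * d) ^ d) \<ge> 1" by linarith
  then have N: "N \<ge> 1" by (simp add: N_def)
  show e: "M = m * N" by (simp add: MM_def m_def N_def)
  show "M \<ge> 1" unfolding e using m N mult_mono[of 1 m 1 N] by simp
qed

lemma small_bounds: "K > 0" "\<delta> = 400 * K" "C2 d c * \<epsilon> = 26000 * M * \<delta>" "26000 * M * \<delta> \<le> 1 / 10 ^ 6"
  "\<delta> \<le> 1 / 10 ^ 10" "K \<le> 1 / 10 ^ 12" "\<epsilon> \<le> 1 / 10 ^ 14" "8 * \<epsilon> \<le> K" "\<delta> > 0" "\<delta> \<le> M * \<delta>" "M * \<delta> \<le> 1 / 10 ^ 10"
  "800 * \<epsilon> \<le> K"
proof -
  show K: "K > 0" using M1 eps0 by (simp add: K_def)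
  show d: "\<delta> = 400 * K" by (simp add: \<delta>_def K_def C0_def)
  show e: "C2 d c * \<epsilon> = 26000 * M * \<delta>" by (simp add: C2_def \<delta>_def)
  have p: "26000 * M * \<delta> \<ge> 0" using M1 K d by simp
  have "10 ^ 6 * (26000 * M * \<delta>) \<le> real d * (10 ^ 6 * (26000 * M * \<delta>))"
    using d1 p mult_right_mono[of 1 "real d" "10 ^ 6 * (26000 * M * \<delta>)"] by simp
  also have "\<dots> = 10 ^ 6 * real d * C2 d c * \<epsilon>" unfolding e[symmetric] by simp
  also note small
  finally show f: "26000 * M * \<delta> \<le> 1 / 10 ^ 6" by simp
  show g: "\<delta> \<le> M * \<delta>" using mult_right_mono[OF M1, of \<delta>] K d by simp
  show "M * \<delta> \<le> 1 / 10 ^ 10" and dd: "\<delta> \<le> 1 / 10 ^ 10" using f g by simp_all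
  show "\<delta> > 0" "K \<le> 1 / 10 ^ 12" using dd K d by simp_all
  show h: "800 * \<epsilon> \<le> K" using mult_right_mono[OF M1, of \<epsilon>] eps0 by (simp add: K_def)
  show "8 * \<epsilon> \<le> K" "\<epsilon> \<le> 1 / 10 ^ 14" using h dd K d eps0 by simp_all
qed

section \<open>Comparison of neighbouring planes\<close>

lemma plane0: "is_plane d P0" and plane: "j \<in> J k \<Longrightarrow> is_plane d (P k j)" and centre: "j \<in> J k \<Longrightarrow> x k j \<in> P k j"
  using collection unfolding ccbp_def by auto

lemma nontrivial: "\<exists>v::'a. v \<noteq> 0"
proof -
  obtain a b where b: "onb d b" "P0 = (\<lambda>v::'a. a + v) ` span (b ` {..<d})" using plane_onb[OF plane0] by metis
  then have "b 0 \<bullet> b 0 = 1" using d1 by (auto simp: onb_def)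
  then show ?thesis by (intro exI[of _ "b 0"]) auto
qed

lemma separated: "i \<in> J k \<Longrightarrow> j \<in> J k \<Longrightarrow> i \<noteq> j \<Longrightarrow> norm (x k i - x k j) \<ge> rad k"
  using collection unfolding ccbp_def by (auto simp: dist_norm)

lemma parent:
  assumes "j \<in> J (Suc k)"
  obtains i where "i \<in> J k" "norm (x (Suc k) j - x k i) \<le> 2 * rad k"
  using collection assms unfolding ccbp_def V_set_def by (force simp: dist_norm norm_minus_commute)

text \<open>The comparison ball has radius \<open>100 * rad k\<close>, and \<open>plane_near\<close>
  needs base points in its half: hence the distance \<open>50 * rad k\<close>.\<close>

lemma near_same_scale:
  assumes ij: "i \<in> J k" "j \<in> J k" "norm (x k i - x k j) \<le> 50 * rad k"
  shows "norm (Dp (P k i) - Dp (P k j)) \<le> 8 * \<epsilon>"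
    and "norm (\<pi> k i y - \<pi> k j y) \<le> \<epsilon> * (500 * rad k + 8 * norm (y - x k j))"
    and "norm (x k i - \<pi> k j (x k i)) \<le> 100 * rad k * \<epsilon>"
proof -
  have b: "ball_dist (x k j) (100 * rad k) (P k i) (P k j) \<le> \<epsilon>"
  proof -
    have "dist (x k i) (x k j) \<le> 100 * rad k" using ij(3) rad_nonneg[of k] unfolding dist_norm by linarith
    then show ?thesis using collection ij(1,2) unfolding ccbp_def by blast
  qed
  note p = plane_near[OF nontrivial plane[OF ij(1)] plane[OF ij(2)] _ b centre[OF ij(1)] _ centre[OF ij(2)]]
  show "norm (Dp (P k i) - Dp (P k j)) \<le> 8 * \<epsilon>" by (rule p(1)) (use ij in auto)
  show "norm (\<pi> k i y - \<pi> k j y) \<le> \<epsilon> * (500 * rad k + 8 * norm (y - x k j))"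
    using p(2)[of y] ij by simp
  show "norm (x k i - \<pi> k j (x k i)) \<le> 100 * rad k * \<epsilon>"
    by (rule p(4)) (use ij centre in \<open>auto intro: rad_scale\<close>)
qed

lemma near_next_scale:
  assumes i: "i \<in> J k" and j: "j \<in> J (Suc k)" and ij: "norm (x (Suc k) j - x k i) \<le> 2 * rad k"
  shows "norm (Dp (P k i) - Dp (P (Suc k) j)) \<le> 8 * \<epsilon>"
    and "norm (\<pi> k i (x (Suc k) j) - x (Suc k) j) \<le> 20 * rad k * \<epsilon>"
    and "z \<in> P k i \<Longrightarrow> norm (z - x k i) \<le> 20 * rad k \<Longrightarrow> norm (z - \<pi> (Suc k) j z) \<le> 20 * rad k * \<epsilon>"
proof -
  have b: "ball_dist (x k i) (20 * rad k) (P k i) (P (Suc k) j) \<le> \<epsilon>"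
    using collection i j ij unfolding ccbp_def by (auto simp: dist_norm norm_minus_commute)
  note p = plane_near[OF nontrivial plane[OF i] plane[OF j] _ b centre[OF i] _ centre[OF j]]
  show "norm (Dp (P k i) - Dp (P (Suc k) j)) \<le> 8 * \<epsilon>" by (rule p(1)) (use ij in \<open>auto intro: rad_scale\<close>)
  show "norm (\<pi> k i (x (Suc k) j) - x (Suc k) j) \<le> 20 * rad k * \<epsilon>"
    unfolding norm_minus_commute[of "\<pi> k i (x (Suc k) j)"] by (rule p(5)) (use ij centre[OF j] in \<open>auto intro: rad_scale\<close>)
  show "norm (z - \<pi> (Suc k) j z) \<le> 20 * rad k * \<epsilon>" if "z \<in> P k i" "norm (z - x k i) \<le> 20 * rad k"
    by (rule p(4)) (use ij that in \<open>auto intro: rad_scale\<close>)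
qed

lemma near_initial:
  assumes j: "j \<in> J 0"
  shows "norm (Dp P0 - Dp (P 0 j)) \<le> 8 * \<epsilon>" "norm (plane_proj P0 (x 0 j) - x 0 j) \<le> \<epsilon>"
proof -
  have b: "ball_dist (x 0 j) 100 (P 0 j) P0 \<le> \<epsilon>" and i: "infdist (x 0 j) P0 \<le> \<epsilon>"
    using collection j unfolding ccbp_def by auto
  show e: "norm (plane_proj P0 (x 0 j) - x 0 j) \<le> \<epsilon>"
    using i infdist_plane[OF plane0] by (simp add: norm_minus_commute)
  have "norm (Dp (P 0 j) - Dp P0) \<le> 8 * \<epsilon>"
    by (rule plane_near(1)[OF nontrivial plane[OF j] plane0 _ b centre[OF j] _ plane_proj_in[OF plane0, of "x 0 j"]])
      (use e small_bounds(7) in auto)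
  then show "norm (Dp P0 - Dp (P 0 j)) \<le> 8 * \<epsilon>" by (simp add: norm_minus_commute)
qed

section \<open>Bump functions and the decomposition of the maps\<close>

lemma bump:
  assumes j: "j \<in> J k"
  shows "0 \<le> \<theta> k j y" "\<theta> k j y \<le> 1" "\<theta> k j y \<noteq> 0 \<Longrightarrow> norm (y - x k j) \<le> 10 * rad k"
    "c2 (\<theta> k j)" "norm (D1 (\<theta> k j) y) \<le> m / rad k" "norm (D2 (\<theta> k j) y) \<le> m / (rad k)\<^sup>2"
proof -
  note f = family[unfolded partition_family_def, THEN conjunct1, rule_format, OF j]
  show "0 \<le> \<theta> k j y" "\<theta> k j y \<le> 1" using f by auto
  show "norm (y - x k j) \<le> 10 * rad k" if "\<theta> k j y \<noteq> 0"
  proof -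
    have "y \<in> closure {y. \<theta> k j y \<noteq> 0}" using that closure_subset[of "{y. \<theta> k j y \<noteq> 0}"] by auto
    then show ?thesis using f by (auto simp: dist_norm norm_minus_commute)
  qed
  obtain D where D': "(\<forall>n. Cn_with_derivs n UNIV (\<theta> k j) D) \<and>
    (\<forall>m y vs. length vs = m \<longrightarrow> norm (D y vs) \<le> c m / rad k ^ m * prod_list (map norm vs))"
    using f[THEN conjunct2, THEN conjunct2, THEN conjunct2] by (rule exE)
  note D = D'[THEN conjunct1, rule_format] D'[THEN conjunct2, rule_format]
  note e = Cn_with_derivs_UNIV_c2[OF D(1)]
  show "c2 (\<theta> k j)" by (rule e(1))
  have c: "c 1 \<le> m" "c 2 \<le> m" by (auto simp: m_def)
  have c1: "c 1 / rad k \<le> m / rad k" "c 2 / (rad k)\<^sup>2 \<le> m / (rad k)\<^sup>2"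
    using c by (intro divide_right_mono; simp)+
  show "norm (D1 (\<theta> k j) y) \<le> m / rad k"
  proof (rule norm_blinfun_bound)
    show "norm (D1 (\<theta> k j) y v) \<le> m / rad k * norm v" for v
      using D(2)[of "[v]" 1 y] mult_right_mono[OF c1(1), of "norm v"] by (simp add: e(2))
  qed (use m1 in simp)
  show "norm (D2 (\<theta> k j) y) \<le> m / (rad k)\<^sup>2"
  proof (rule norm_blinfun_bound)
    show "norm (D2 (\<theta> k j) y v) \<le> m / (rad k)\<^sup>2 * norm v" for v
    proof (rule norm_blinfun_bound)
      show "norm (D2 (\<theta> k j) y v w) \<le> m / (rad k)\<^sup>2 * norm v * norm w" for w
        using D(2)[of "[v, w]" 2 y] mult_right_mono[OF c1(2), of "norm v * norm w"]
        by (simp add: e(3) mult.assoc)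
    qed (use m1 in simp)
  qed (use m1 in simp)
qed

text \<open>The indices whose bumps can be active at distance up to \<open>30 * rad k\<close> from
  the centre: a support adds \<open>10 * rad k\<close>.\<close>

definition "F k i = {l \<in> J k. norm (x k l - x k i) \<le> 40 * rad k}"
text \<open>The deviation of the averaged projection from the single projection to
  \<open>P k i\<close>. It is small by coherence alone, wherever the surface is.\<close>

definition "G k i y = (\<Sum>l\<in>F k i. \<theta> k l y *\<^sub>R (\<pi> k l y - \<pi> k i y))"
definition "s k i y = (\<Sum>l\<in>F k i. \<theta> k l y)"

lemma finite_F: "i \<in> J k \<Longrightarrow> finite (F k i)" and card_F: "i \<in> J k \<Longrightarrow> real (card (F k i)) \<le> N"
proof -
  assume i: "i \<in> J k"
  have p: "norm (x k l - \<pi> k i (x k l)) \<le> rad k / 10" if "l \<in> F k i" for l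
  proof -
    have "100 * rad k * \<epsilon> \<le> rad k / 10" using small_bounds(7) mult_left_mono[of \<epsilon> "1/1000" "100 * rad k"] by simp
    moreover have "norm (x k l - x k i) \<le> 50 * rad k" "l \<in> J k"
      using that unfolding F_def by (auto intro: rad_scale)
    ultimately show ?thesis using near_same_scale(3)[OF _ i, of l] by linarith
  qed
  have "finite (F k i) \<and> card (F k i) \<le> (200 * d) ^ d"
    by (intro conjI plane_packing[OF plane[OF i] d1 rad_pos[of k], where c="x k" and x="x k i"])
      (use p separated in \<open>auto simp: F_def\<close>)
  then show "finite (F k i)" "real (card (F k i)) \<le> N" by (simp_all only: N_def of_nat_le_iff)
qed

lemma F_active:
  assumes "norm (y - x k i) \<le> 30 * rad k" "l \<in> J k - F k i"
  shows "\<theta> k l y = 0"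
proof (rule ccontr)
  assume "\<theta> k l y \<noteq> 0"
  then have "norm (y - x k l) \<le> 10 * rad k" using bump(3) assms by auto
  then have "norm (x k l - x k i) \<le> 40 * rad k"
    using norm_triangle_ineq4[of "y - x k i" "y - x k l"] assms by simp
  then show False using assms by (auto simp: F_def)
qed

lemma s_le_1: "i \<in> J k \<Longrightarrow> 0 \<le> s k i y \<and> s k i y \<le> 1"
proof -
  assume i: "i \<in> J k"
  have f: "(\<lambda>j. \<theta> k j y) summable_on J k" "(\<Sum>\<^sub>\<infinity>j\<in>J k. \<theta> k j y) \<le> 1"
    using family unfolding partition_family_def by auto
  have "s k i y \<le> (\<Sum>\<^sub>\<infinity>j\<in>J k. \<theta> k j y)"
    unfolding s_def by (rule finite_sum_le_infsum[OF f(1) finite_F[OF i]]) (auto simp: F_def bump)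
  then show ?thesis using f(2) unfolding s_def by (auto intro!: sum_nonneg bump simp: F_def)
qed

lemma s_eq_1:
  assumes i: "i \<in> J k" and y: "norm (y - x k i) \<le> 8 * rad k"
  shows "s k i y = 1"
proof -
  have "y \<in> V_set J x k 8" using assms by (auto simp: V_set_def dist_norm norm_minus_commute)
  then have "(\<Sum>\<^sub>\<infinity>j\<in>J k. \<theta> k j y) = 1" using family unfolding partition_family_def by blast
  moreover have "norm (y - x k i) \<le> 30 * rad k" using y rad_pos[of k] by linarith
  ultimately show ?thesis
    unfolding s_def using infsum_eq_finite_sum[OF finite_F[OF i], of "J k" "\<lambda>j. \<theta> k j y"] F_active
    by (auto simp: F_def)
qed

text \<open>Each term is split as \<open>\<pi> k l y - \<pi> k i y\<close> plus
  \<open>\<pi> k i y - y\<close>. Where the weight \<open>s\<close> is 1, the second part turns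
  \<open>y\<close> into its projection, and the position of \<open>y\<close> off the plane matters
  only through \<open>G\<close>.\<close>

lemma sigma_eq:
  assumes i: "i \<in> J k" and y: "norm (y - x k i) \<le> 30 * rad k"
  shows "\<sigma> k y = y + G k i y + s k i y *\<^sub>R (\<pi> k i y - y)"
proof -
  have "(\<Sum>\<^sub>\<infinity>j\<in>J k. \<theta> k j y *\<^sub>R (\<pi> k j y - y)) = (\<Sum>l\<in>F k i. \<theta> k l y *\<^sub>R (\<pi> k l y - y))"
    by (rule infsum_eq_finite_sum[OF finite_F[OF i]]) (use F_active[OF y] in \<open>auto simp: F_def\<close>)
  also have "\<dots> = (\<Sum>l\<in>F k i. \<theta> k l y *\<^sub>R (\<pi> k l y - \<pi> k i y) + \<theta> k l y *\<^sub>R (\<pi> k i y - y))"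
    by (intro sum.cong) (auto simp: scaleR_add_right[symmetric])
  also have "\<dots> = G k i y + s k i y *\<^sub>R (\<pi> k i y - y)"
    by (simp add: sum.distrib G_def s_def scaleR_sum_left)
  finally show ?thesis by (simp add: sigma_map_def)
qed

lemma sigma_id:
  assumes "y \<notin> V_set J x k 10"
  shows "\<sigma> k y = y"
proof -
  have "\<theta> k j y = 0" if "j \<in> J k" for j
    using bump(3)[OF that, of y] assms that by (auto simp: V_set_def dist_norm norm_minus_commute)
  then have "(\<Sum>\<^sub>\<infinity>j\<in>J k. \<theta> k j y *\<^sub>R (\<pi> k j y - y)) = 0" by (intro infsum_0) auto
  then show ?thesis by (simp add: sigma_map_def)
qed

lemma s_c2:
  assumes i: "i \<in> J k"
  shows "c2 (s k i)" "norm (D1 (s k i) y) \<le> M / rad k" "norm (D2 (s k i) y) \<le> M / (rad k)\<^sup>2"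
proof -
  have b: "c2 (\<theta> k l)" "norm (D1 (\<theta> k l) y) \<le> m / rad k" "norm (D2 (\<theta> k l) y) \<le> m / (rad k)\<^sup>2" if "l \<in> F k i" for l
    using that bump by (auto simp: F_def)
  have e: "s k i = (\<lambda>y. \<Sum>l\<in>F k i. \<theta> k l y)" by (auto simp: s_def)
  show "c2 (s k i)" unfolding e by (rule c2_sum[OF finite_F[OF i], THEN conjunct1]) (rule b(1))
  have "norm (D1 (s k i) y) \<le> real (card (F k i)) * (m / rad k)"
    unfolding e by (rule norm_D_sum_le(1)[OF finite_F[OF i] b(1) b(2)])
  also have "\<dots> \<le> N * (m / rad k)" using card_F[OF i] m1 by (intro mult_right_mono) auto
  finally show "norm (D1 (s k i) y) \<le> M / rad k" by (simp add: M_def' mult_ac)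
  have "norm (D2 (s k i) y) \<le> real (card (F k i)) * (m / (rad k)\<^sup>2)"
    unfolding e by (rule norm_D_sum_le(2)[OF finite_F[OF i] b(1) b(3)])
  also have "\<dots> \<le> N * (m / (rad k)\<^sup>2)" using card_F[OF i] m1 by (intro mult_right_mono) auto
  finally show "norm (D2 (s k i) y) \<le> M / (rad k)\<^sup>2" by (simp add: M_def' mult_ac)
qed

lemma G_c2:
  assumes i: "i \<in> J k"
  shows "c2 (G k i)"
    "norm (y - x k i) \<le> 30 * rad k \<Longrightarrow> norm (G k i y) \<le> K * rad k"
    "norm (y - x k i) \<le> 30 * rad k \<Longrightarrow> norm (D1 (G k i) y) \<le> K"
    "norm (y - x k i) \<le> 30 * rad k \<Longrightarrow> norm (D2 (G k i) y) \<le> K / rad k"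
proof -
  let ?r = "rad k"
  define h where "h l y = \<pi> k l y - \<pi> k i y" for l y
  have he: "h l = (\<lambda>y. (Dp (P k l) - Dp (P k i)) y + (\<pi> k l 0 - \<pi> k i 0))" if "l \<in> F k i" for l
  proof
    fix y
    have "\<pi> k l y = \<pi> k l 0 + Dp (P k l) y" "\<pi> k i y = \<pi> k i 0 + Dp (P k i) y"
      using plane_proj_diff[OF plane, of l k y 0] plane_proj_diff[OF plane[OF i], of y 0] that by (auto simp: F_def)
    then show "h l y = (Dp (P k l) - Dp (P k i)) y + (\<pi> k l 0 - \<pi> k i 0)"
      unfolding h_def by (simp only: blinfun.diff_left) (simp add: algebra_simps)
  qed
  have ch: "c2 (h l)" "D1 (h l) y = Dp (P k l) - Dp (P k i)" "D2 (h l) y = 0" if "l \<in> F k i" for l y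
    unfolding he[OF that] by (simp_all only: c2_lin D1_const)
  have h1: "norm (D1 (h l) y) \<le> 8 * \<epsilon>" if "l \<in> F k i" for l y
    unfolding ch(2)[OF that] using near_same_scale(1)[of l k i] that i rad_scale[of _ 40 k 50] by (auto simp: F_def)
  \<comment> \<open>The number 740 is \<open>500 + 8 * 30\<close>, from
    \<open>near_same_scale\<close> at distance \<open>30 * rad k\<close>.\<close>
  have h0: "norm (h l y) \<le> 740 * (\<epsilon> * ?r)" if l: "l \<in> F k i" and y: "norm (y - x k i) \<le> 30 * ?r" for l y
  proof -
    have "norm (h l y) \<le> \<epsilon> * (500 * ?r + 8 * norm (y - x k i))"
      unfolding h_def using near_same_scale(2)[of l k i y] l i rad_scale[of _ 40 k 50] by (auto simp: F_def)
    also have "\<dots> \<le> \<epsilon> * (500 * ?r + 8 * (30 * ?r))" using y eps0 by (intro mult_left_mono add_left_mono) auto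
    finally show ?thesis by (simp add: algebra_simps)
  qed
  define t where "t l y = \<theta> k l y *\<^sub>R h l y" for l y
  have F: "l \<in> J k" if "l \<in> F k i" for l using that by (simp add: F_def)
  have te: "t l = (\<lambda>y. \<theta> k l y *\<^sub>R h l y)" for l by (auto simp: t_def)
  have tc: "c2 (t l)"
    "norm (D1 (t l) y) \<le> \<bar>\<theta> k l y\<bar> * norm (D1 (h l) y) + norm (D1 (\<theta> k l) y) * norm (h l y)"
    "norm (D2 (t l) y) \<le> \<bar>\<theta> k l y\<bar> * norm (D2 (h l) y) + 2 * norm (D1 (\<theta> k l) y) * norm (D1 (h l) y)
      + norm (D2 (\<theta> k l) y) * norm (h l y)" if "l \<in> F k i" for l y
    unfolding te by (rule c2_scaleR[OF bump(4)[OF F[OF that]] ch(1)[OF that]])+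
  have G: "G k i = (\<lambda>y. \<Sum>l\<in>F k i. t l y)" by (auto simp: G_def t_def h_def)
  show "c2 (G k i)" unfolding G by (rule c2_sum[OF finite_F[OF i], THEN conjunct1]) (rule tc(1); assumption)
  have me: "\<epsilon> \<le> m * \<epsilon>" using mult_right_mono[OF m1, of \<epsilon>] eps0 by simp
  have KN: "real (card (F k i)) * (800 * (m * \<epsilon>)) \<le> K"
  proof -
    have "real (card (F k i)) * (800 * (m * \<epsilon>)) \<le> N * (800 * (m * \<epsilon>))"
      using card_F[OF i] m1 eps0 by (intro mult_right_mono) auto
    then show ?thesis by (simp add: K_def M_def' mult_ac)
  qed
  show "norm (G k i y) \<le> K * ?r" if y: "norm (y - x k i) \<le> 30 * ?r"
  proof -
    have "norm (t l y) \<le> 800 * (m * \<epsilon>) * ?r" if l: "l \<in> F k i" for l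
    proof -
      have "norm (t l y) \<le> 1 * (740 * (\<epsilon> * ?r))"
        unfolding t_def norm_scaleR using bump(1,2)[OF F[OF l], of y] h0[OF l y] by (intro mult_mono) auto
      also have "\<dots> \<le> 800 * (m * \<epsilon>) * ?r" using mult_right_mono[OF me, of ?r] eps0 by simp
      finally show ?thesis .
    qed
    then have "norm (G k i y) \<le> real (card (F k i)) * (800 * (m * \<epsilon>) * ?r)"
      unfolding G by (rule sum_norm_bound)
    also have "\<dots> \<le> K * ?r" using mult_right_mono[OF KN, of ?r] by simp
    finally show ?thesis .
  qed
  show "norm (D1 (G k i) y) \<le> K" if y: "norm (y - x k i) \<le> 30 * ?r"
  proof -
    have "norm (D1 (t l) y) \<le> 800 * (m * \<epsilon>)" if l: "l \<in> F k i" for l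
    proof -
      have "norm (D1 (t l) y) \<le> 1 * (8 * \<epsilon>) + m / ?r * (740 * (\<epsilon> * ?r))"
        by (rule order_trans[OF tc(2)[OF l]], intro add_mono mult_mono h1 h0 bump F l y)
          (use bump(1,2)[OF F[OF l], of y] m1 in auto)
      also have "\<dots> = 8 * \<epsilon> + 740 * (m * \<epsilon>)" by (simp add: less_imp_neq[OF rad_pos, symmetric])
      finally show ?thesis using me eps0 by linarith
    qed
    from norm_D_sum_le(1)[of _ t, OF finite_F[OF i] tc(1) this] show ?thesis unfolding G using KN by simp
  qed
  show "norm (D2 (G k i) y) \<le> K / ?r" if y: "norm (y - x k i) \<le> 30 * ?r"
  proof -
    have "norm (D2 (t l) y) \<le> 800 * (m * \<epsilon>) / ?r" if l: "l \<in> F k i" for l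
    proof -
      have "norm (D2 (t l) y) \<le> 1 * 0 + 2 * (m / ?r) * (8 * \<epsilon>) + m / ?r\<^sup>2 * (740 * (\<epsilon> * ?r))"
        by (rule order_trans[OF tc(3)[OF l]], intro add_mono mult_mono h1 h0 bump F l y order_refl)
          (use bump(1,2)[OF F[OF l], of y] m1 ch(3)[OF l] in auto)
      also have "\<dots> = 756 * (m * \<epsilon>) / ?r" by (simp add: less_imp_neq[OF rad_pos, symmetric] power2_eq_square field_simps)
      also have "\<dots> \<le> 800 * (m * \<epsilon>) / ?r" using m1 eps0 by (intro divide_right_mono) auto
      finally show ?thesis .
    qed
    from norm_D_sum_le(2)[of _ t, OF finite_F[OF i] tc(1) this]
    have "norm (D2 (G k i) y) \<le> real (card (F k i)) * (800 * (m * \<epsilon>)) / ?r" unfolding G by simp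
    also have "\<dots> \<le> K / ?r" using KN by (intro divide_right_mono) auto
    finally show ?thesis .
  qed
qed

section \<open>Induction over the scales\<close>

text \<open>The induction hypothesis, with the same \<delta> at all scales. The function is defined
  on the whole space but describes the surface only in a ball; the radius factor 50 exceeds the 49
  of the cylinders, and at the next scale it amounts to \<open>5 * rad k\<close>.\<close>

definition adapted :: "nat \<Rightarrow> 'i \<Rightarrow> ('a \<Rightarrow> 'a) \<Rightarrow> bool" where
  "adapted k j A \<longleftrightarrow> c2 A \<and> (\<forall>q. A q \<in> perp (P k j)) \<and> (\<forall>q. norm (D1 A q) \<le> \<delta>) \<and>
    (\<forall>q. norm (D2 A q) \<le> \<delta> / rad k) \<and> norm (A (x k j)) \<le> \<delta> * rad k \<and>
    S k \<inter> cball (x k j) (50 * rad k) = graph_over (P k j) A \<inter> cball (x k j) (50 * rad k)"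

section \<open>One map along an adapted graph\<close>

context
  fixes k :: nat and i :: 'i and A :: "'a \<Rightarrow> 'a"
  assumes i: "i \<in> J k" and A: "adapted k i A"
begin

private abbreviation "r \<equiv> rad k"

lemma adapted_c2: "c2 A" and adapted_perp: "A q \<in> perp (P k i)"
  and adapted_D1: "norm (D1 A q) \<le> \<delta>" and adapted_D2: "norm (D2 A q) \<le> \<delta> / rad k"
  and adapted_centre: "norm (A (x k i)) \<le> \<delta> * rad k"
  and adapted_surf: "S k \<inter> cball (x k i) (50 * rad k) = graph_over (P k i) A \<inter> cball (x k i) (50 * rad k)"
  using A unfolding adapted_def by blast+

lemma adapted_norm: "norm (A q) \<le> \<delta> * (r + norm (q - x k i))"
proof -
  have "norm (A q - A (x k i)) \<le> \<delta> * norm (q - x k i)"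
    by (rule c1_lipschitz[OF c2_c1[OF adapted_c2] convex_UNIV]) (auto simp: adapted_D1)
  then show ?thesis
    using adapted_centre norm_triangle_ineq[of "A q - A (x k i)" "A (x k i)"] by (simp add: algebra_simps)
qed

lemma adapted_norm_le:
  assumes "norm (q - x k i) \<le> 25 * r"
  shows "norm (A q) \<le> 26 * \<delta> * r" "norm (A q) \<le> r / 100"
proof -
  have "\<delta> * (r + norm (q - x k i)) \<le> \<delta> * (r + 25 * r)"
    using assms small_bounds(9) by (intro mult_left_mono) auto
  then show *: "norm (A q) \<le> 26 * \<delta> * r" using adapted_norm[of q] by simp
  have "26 * \<delta> * r \<le> 1 / 100 * r" using small_bounds(5) by (intro mult_right_mono) auto
  then show "norm (A q) \<le> r / 100" using * by linarith
qed

lemma surf_point: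
  assumes "y \<in> S k" "norm (y - x k i) \<le> 50 * r"
  shows "\<pi> k i y \<in> P k i" "y = \<pi> k i y + A (\<pi> k i y)" "norm (\<pi> k i y - x k i) \<le> norm (y - x k i)"
proof -
  show "\<pi> k i y \<in> P k i" by (rule plane_proj_in[OF plane[OF i]])
  have "y \<in> S k \<inter> cball (x k i) (50 * r)" using assms by (simp add: dist_norm norm_minus_commute)
  then have "y \<in> graph_over (P k i) A" unfolding adapted_surf by simp
  then show "y = \<pi> k i y + A (\<pi> k i y)" by (rule graph_point[OF plane[OF i] adapted_perp])
  show "norm (\<pi> k i y - x k i) \<le> norm (y - x k i)"
    using dist_plane_proj_le[OF plane[OF i], of y "x k i"] plane_proj_id[OF plane[OF i] centre[OF i]] by simp
qed

lemma graph_in_surf: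
  assumes "q \<in> P k i" "norm (q - x k i) \<le> 25 * r"
  shows "q + A q \<in> S k" "norm (q + A q - x k i) \<le> norm (q - x k i) + r / 100" "\<pi> k i (q + A q) = q"
proof -
  show n: "norm (q + A q - x k i) \<le> norm (q - x k i) + r / 100"
    using norm_triangle_ineq[of "q - x k i" "A q"] adapted_norm_le(2)[OF assms(2)] by (simp add: algebra_simps)
  have "norm (q + A q - x k i) \<le> 50 * r" using n assms(2) rad_pos[of k] by linarith
  then have "q + A q \<in> graph_over (P k i) A \<inter> cball (x k i) (50 * r)"
    using assms(1) by (auto simp: graph_over_def dist_norm norm_minus_commute)
  then show "q + A q \<in> S k" unfolding adapted_surf[symmetric] by simp
  show "\<pi> k i (q + A q) = q" by (rule plane_proj_eq[OF plane[OF i] assms(1) adapted_perp])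
qed

text \<open>The displacement of the point \<open>q + A q\<close>, as a function of its foot
  \<open>q\<close>: there the vector from the point to its projection is
  \<open>- A q\<close>.\<close>

definition "h q = G k i (q + A q) + (- s k i (q + A q)) *\<^sub>R A q"

lemma sigma_graph:
  assumes "q \<in> P k i" "norm (q - x k i) \<le> 25 * r"
  shows "\<sigma> k (q + A q) = q + A q + h q"
proof -
  have "norm (q + A q - x k i) \<le> 30 * r"
    using graph_in_surf(2)[OF assms] assms(2) rad_pos[of k] by linarith
  then show ?thesis
    using sigma_eq[OF i, of "q + A q"] graph_in_surf(3)[OF assms] by (simp add: h_def)
qed

lemma Y_c2: "c2 (\<lambda>q. q + A q)" "norm (D1 (\<lambda>q. q + A q) q) \<le> 1.1" "norm (D2 (\<lambda>q. q + A q) q) \<le> \<delta> / r"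
proof -
  note l = c2_lin[of "id_blinfun :: 'a \<Rightarrow>\<^sub>L 'a" 0, simplified]
  note a = c2_add[OF l(1) adapted_c2]
  show "c2 (\<lambda>q. q + A q)" by (rule a(1))
  show "norm (D1 (\<lambda>q. q + A q) q) \<le> 1.1"
    unfolding a(2) l(2) using norm_triangle_ineq[of id_blinfun "D1 A q"] norm_blinfun_id_le[where 'a='a]
      adapted_D1[of q] small_bounds(5) by simp
  show "norm (D2 (\<lambda>q. q + A q) q) \<le> \<delta> / r" unfolding a(3) l(3) using adapted_D2 by simp
qed

lemma Y_near:
  assumes "norm (q - x k i) \<le> 20 * r"
  shows "norm (q + A q - x k i) \<le> 30 * r"
proof -
  have "norm (q - x k i) \<le> 25 * r" using assms by (rule rad_scale) simp
  then have "norm (A q) \<le> r / 100" by (rule adapted_norm_le(2))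
  then show ?thesis
    using norm_triangle_ineq[of "q - x k i" "A q"] assms rad_pos[of k]
    by (simp only: add_diff_eq[symmetric] diff_add_eq)
qed

text \<open>The graph enters only through crude bounds such as \<open>\<delta> \<le> 1\<close>, so
  the result is in terms of \<open>K\<close> and not of \<delta>. This is what allows the induction
  to close.\<close>

lemma GY_c2:
  shows "c2 (\<lambda>q. G k i (q + A q))"
    and "norm (q - x k i) \<le> 20 * r \<Longrightarrow> norm (G k i (q + A q)) \<le> K * r"
    and "norm (q - x k i) \<le> 20 * r \<Longrightarrow> norm (D1 (\<lambda>q. G k i (q + A q)) q) \<le> 2 * K"
    and "norm (q - x k i) \<le> 20 * r \<Longrightarrow> norm (D2 (\<lambda>q. G k i (q + A q)) q) \<le> 5 * K / r"
proof -
  note c = c2_compose[OF G_c2(1)[OF i] Y_c2(1)]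
  show "c2 (\<lambda>q. G k i (q + A q))" by (rule c(1))
  assume q: "norm (q - x k i) \<le> 20 * r"
  show "norm (G k i (q + A q)) \<le> K * r" by (rule G_c2(2)[OF i Y_near[OF q]])
  have "norm (D1 (\<lambda>q. G k i (q + A q)) q) \<le> K * 1.1"
    by (rule order_trans[OF c(2)], intro mult_mono G_c2(3)[OF i] Y_near q Y_c2) (use small_bounds(1) in auto)
  then show "norm (D1 (\<lambda>q. G k i (q + A q)) q) \<le> 2 * K" using small_bounds(1) by simp
  have "norm (D2 (\<lambda>q. G k i (q + A q)) q) \<le> K * (\<delta> / r) + K / r * 1.1\<^sup>2"
    by (rule order_trans[OF c(3)], intro add_mono mult_mono power_mono G_c2(3,4)[OF i] Y_near q Y_c2)
      (use small_bounds(1) in auto)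
  also have "\<dots> \<le> K * (1 / r) + K / r * 2"
    using small_bounds(1,5) by (intro add_mono mult_left_mono divide_right_mono) (auto simp: power2_eq_square)
  also have "\<dots> \<le> 5 * K / r" using small_bounds(1) by (simp add: field_simps)
  finally show "norm (D2 (\<lambda>q. G k i (q + A q)) q) \<le> 5 * K / r" .
qed

text \<open>Differentiating the weight in front of \<open>A\<close> costs a factor \<open>M\<close>
  over \<delta>. These bounds hold also where the bumps do not add up to 1; they are used for
  displacements and for \<open>local_graph\<close>, but not fed back into the induction for
  \<open>adapted\<close>.\<close>

lemma h_c2:
  shows "c2 h"
    and "norm (q - x k i) \<le> 19 * r \<Longrightarrow> norm (h q) \<le> 21 * \<delta> * r"
    and "norm (q - x k i) \<le> 19 * r \<Longrightarrow> norm (D1 h q) \<le> 42 * M * \<delta>"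
    and "norm (q - x k i) \<le> 19 * r \<Longrightarrow> norm (D2 h q) \<le> 106 * M * \<delta> / r"
proof -
  define t where "t q = - s k i (q + A q)" for q
  have te: "t = (\<lambda>q. (- id_blinfun) (s k i (q + A q)))"
    by (auto simp: t_def blinfun.minus_left)
  note sy = c2_compose[OF s_c2(1)[OF i] Y_c2(1)]
  note tc = c2_lin_compose[OF sy(1), of "- id_blinfun", folded te]
  have n1: "norm (- id_blinfun :: real \<Rightarrow>\<^sub>L real) \<le> 1" by (simp add: norm_blinfun_id_le)
  have \<delta>0: "\<delta> \<ge> 0" using small_bounds by simp
  have t1: "norm (D1 t q) \<le> 2 * M / r" for q
  proof -
    have "norm (D1 (\<lambda>q. s k i (q + A q)) q) \<le> M / r * 1.1"
      by (rule order_trans[OF sy(2)], intro mult_mono s_c2 i Y_c2) (use M1 in auto)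
    then have "norm (D1 t q) \<le> 1 * (M / r * 1.1)"
      by (intro order_trans[OF tc(2)] mult_mono n1) auto
    also have "\<dots> \<le> 2 * M / r" using M1 by (simp add: field_simps)
    finally show ?thesis .
  qed
  have t2: "norm (D2 t q) \<le> 5 * M / r\<^sup>2" for q
  proof -
    have "norm (D2 (\<lambda>q. s k i (q + A q)) q) \<le> M / r * (\<delta> / r) + M / r\<^sup>2 * 1.1\<^sup>2"
      by (rule order_trans[OF sy(3)], intro add_mono mult_mono power_mono s_c2 i Y_c2) (use M1 in auto)
    also have "\<dots> \<le> M / r * (1 / r) + M / r\<^sup>2 * 2"
      using small_bounds(5) M1 by (intro add_mono mult_left_mono divide_right_mono) (auto simp: power2_eq_square)
    also have "\<dots> \<le> 5 * M / r\<^sup>2" using M1 by (simp add: field_simps power2_eq_square)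
    finally have "norm (D2 t q) \<le> 1 * (5 * M / r\<^sup>2)"
      by (intro order_trans[OF tc(3)] mult_mono n1) auto
    then show ?thesis by simp
  qed
  have t0: "\<bar>t q\<bar> \<le> 1" for q using s_le_1[OF i, of "q + A q"] by (auto simp: t_def)
  note p = c2_scaleR[OF tc(1) adapted_c2]
  note hc = c2_add[OF GY_c2(1) p(1)]
  have h: "h = (\<lambda>q. G k i (q + A q) + t q *\<^sub>R A q)" by (auto simp: h_def t_def)
  show "c2 h" unfolding h by (rule hc(1))
  assume q: "norm (q - x k i) \<le> 19 * r"
  then have q20: "norm (q - x k i) \<le> 20 * r" by (rule rad_scale) simp
  have Aq: "norm (A q) \<le> 20 * \<delta> * r"
  proof -
    have "\<delta> * (r + norm (q - x k i)) \<le> \<delta> * (r + 19 * r)"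
      using q \<delta>0 by (intro mult_left_mono) auto
    then show ?thesis using adapted_norm[of q] by simp
  qed
  have Kd: "K = \<delta> / 400" using small_bounds(2) by simp
  have "norm (t q *\<^sub>R A q) \<le> 1 * (20 * \<delta> * r)"
    unfolding norm_scaleR by (intro mult_mono t0 Aq) auto
  then have "norm (h q) \<le> K * r + 20 * \<delta> * r"
    unfolding h using norm_triangle_ineq[of "G k i (q + A q)" "t q *\<^sub>R A q"] GY_c2(2)[OF q20] by simp
  also have "\<dots> \<le> 21 * \<delta> * r" unfolding Kd using \<delta>0 by simp
  finally show "norm (h q) \<le> 21 * \<delta> * r" .
  have Md: "\<delta> \<le> M * \<delta>" by (rule small_bounds(10))
  have "norm (D1 (\<lambda>q. t q *\<^sub>R A q) q) \<le> 1 * \<delta> + 2 * M / r * (20 * \<delta> * r)"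
    by (rule order_trans[OF p(2)], intro add_mono mult_mono t0 t1 adapted_D1 Aq) (use M1 in auto)
  also have "\<dots> = \<delta> + 40 * M * \<delta>" by (simp add: less_imp_neq[OF rad_pos, symmetric])
  finally have "norm (D1 h q) \<le> 2 * K + (\<delta> + 40 * M * \<delta>)"
    unfolding h hc(2)
    by (intro order_trans[OF norm_triangle_ineq] add_mono GY_c2(3)[OF q20])
  also have "\<dots> \<le> 42 * M * \<delta>" unfolding Kd using Md \<delta>0 by simp
  finally show "norm (D1 h q) \<le> 42 * M * \<delta>" .
  have "norm (D2 (\<lambda>q. t q *\<^sub>R A q) q) \<le> 1 * (\<delta> / r) + 2 * (2 * M / r) * \<delta> + 5 * M / r\<^sup>2 * (20 * \<delta> * r)"
    by (rule order_trans[OF p(3)], intro add_mono mult_mono t0 t1 t2 adapted_D1 adapted_D2 Aq order_refl) (use M1 in auto)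
  also have "\<dots> = (\<delta> + 104 * M * \<delta>) / r"
    by (simp add: power2_eq_square field_simps less_imp_neq[OF rad_pos, symmetric])
  finally have "norm (D2 h q) \<le> 5 * K / r + (\<delta> + 104 * M * \<delta>) / r"
    unfolding h hc(3)
    by (intro order_trans[OF norm_triangle_ineq] add_mono GY_c2(4)[OF q20])
  also have "\<dots> = (5 * K + (\<delta> + 104 * M * \<delta>)) / r" by (simp add: add_divide_distrib)
  also have "\<dots> \<le> 106 * M * \<delta> / r" unfolding Kd using Md \<delta>0 by (intro divide_right_mono) auto
  finally show "norm (D2 h q) \<le> 106 * M * \<delta> / r" .
qed

end

section \<open>From one scale to the next\<close>

lemma sigma_displacement:
  assumes ad: "\<And>j. j \<in> J k \<Longrightarrow> \<exists>A. adapted k j A" and y: "y \<in> S k"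
  shows "norm (\<sigma> k y - y) \<le> 21 * \<delta> * rad k"
proof (cases "y \<in> V_set J x k 10")
  case True
  then obtain i where i: "i \<in> J k" "norm (y - x k i) \<le> 10 * rad k"
    by (auto simp: V_set_def dist_norm norm_minus_commute)
  obtain A where A: "adapted k i A" using ad[OF i(1)] by blast
  note p = surf_point[OF i(1) A y rad_scale[OF i(2)], simplified]
  have q: "norm (\<pi> k i y - x k i) \<le> 10 * rad k" using p(3) i(2) by linarith
  have "\<sigma> k y = y + h k i A (\<pi> k i y)"
    using sigma_graph[OF i(1) A p(1) rad_scale[OF q]] p(2) by simp
  then show ?thesis using h_c2(2)[OF i(1) A rad_scale[OF q]] by simp
next
  case False
  then show ?thesis using sigma_id small_bounds(9) by simp
qed

lemma surf_Suc_eq: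
  assumes ad: "\<And>j. j \<in> J k \<Longrightarrow> \<exists>A. adapted k j A" and i: "i \<in> J k" and A: "adapted k i A"
    and g: "\<And>q. q \<in> P k i \<Longrightarrow> norm (q - x k i) \<le> \<rho> * rad k \<Longrightarrow> q + g q = \<sigma> k (q + A q)"
    and gn: "\<And>q. norm (g q) \<le> rad k / 100" and \<rho>: "\<rho> \<le> 18" "norm (y - x k i) + R \<le> (\<rho> - 1/20) * rad k"
  shows "S (Suc k) \<inter> cball y R = (\<lambda>q. q + g q) ` P k i \<inter> cball y R"
proof (intro equalityI subsetI)
  let ?r = "rad k"
  fix z assume "z \<in> S (Suc k) \<inter> cball y R"
  then obtain z' where z: "z' \<in> S k" "z = \<sigma> k z'" "norm (z - y) \<le> R"
    by (auto simp: dist_norm norm_minus_commute)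
  have "21 * \<delta> * ?r \<le> 1 / 100 * ?r" using small_bounds(5) by (intro mult_right_mono) auto
  then have "norm (z - z') \<le> ?r / 100" using sigma_displacement[OF ad z(1)] unfolding z(2) by linarith
  moreover have "norm (z' - x k i) \<le> norm (z - z') + norm (z - y) + norm (y - x k i)"
    using norm_triangle_ineq4[of "z - x k i" "z - z'"] norm_triangle_ineq[of "z - y" "y - x k i"] by simp
  moreover have "(\<rho> - 1/20) * ?r = \<rho> * ?r - ?r / 20" by (simp add: algebra_simps)
  ultimately have n: "norm (z' - x k i) \<le> \<rho> * ?r" using z(3) \<rho>(2) rad_pos[of k] by linarith
  note p = surf_point[OF i A z(1) rad_scale[OF n]]
  have "\<rho> \<le> 50" using \<rho> by simp
  note p = p[OF this]
  have "z = \<pi> k i z' + g (\<pi> k i z')"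
    using g[OF p(1) order_trans[OF p(3) n]] p(2) z(2) by simp
  then show "z \<in> (\<lambda>q. q + g q) ` P k i \<inter> cball y R"
    using p(1) z(3) by (auto simp: dist_norm norm_minus_commute)
next
  let ?r = "rad k"
  fix z assume "z \<in> (\<lambda>q. q + g q) ` P k i \<inter> cball y R"
  then obtain q where q: "q \<in> P k i" "z = q + g q" "norm (z - y) \<le> R"
    by (auto simp: dist_norm norm_minus_commute)
  have "norm (q - x k i) \<le> norm (g q) + norm (z - y) + norm (y - x k i)"
    using norm_triangle_ineq4[of "z - x k i" "g q"] norm_triangle_ineq[of "z - y" "y - x k i"] q(2) by simp
  moreover have "(\<rho> - 1/20) * ?r = \<rho> * ?r - ?r / 20" by (simp add: algebra_simps)
  ultimately have n: "norm (q - x k i) \<le> \<rho> * ?r" using q(3) gn[of q] \<rho>(2) rad_pos[of k] by linarith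
  have "q + A q \<in> S k" by (rule graph_in_surf(1)[OF i A q(1) rad_scale[OF n]]) (use \<rho> in simp)
  then show "z \<in> S (Suc k) \<inter> cball y R"
    using g[OF q(1) n] q(2,3) by (auto simp: dist_norm norm_minus_commute)
qed

lemma adapted_0:
  assumes j: "j \<in> J 0"
  shows "\<exists>A. adapted 0 j A"
proof -
  have z: "c2 (\<lambda>x::'a. 0::'a)" "D1 (\<lambda>x::'a. 0::'a) = (\<lambda>x. 0)" "D2 (\<lambda>x::'a. 0::'a) = (\<lambda>x. 0)"
    using c2_lin[of "0 :: 'a \<Rightarrow>\<^sub>L 'a" 0] by (simp_all add: D1_const)
  obtain A where A: "c2 A" "\<And>q. A q \<in> perp (P 0 j)" "\<And>q. norm (D1 A q) \<le> 4 * (8 * \<epsilon>)" "\<And>q. norm (D2 A q) \<le> 5 * 0"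
    "norm (A (x 0 j)) \<le> 4 * \<epsilon>" "graph_over (P 0 j) A = (\<lambda>q. q + 0) ` P0"
    by (rule reparam_graph[OF plane0 plane[OF j] z(1) near_initial(1)[OF j], where \<kappa>=0 and a=\<epsilon> and ?x0.0="x 0 j"])
      (use near_initial(2)[OF j] eps0 centre[OF j] small_bounds(7) z in auto)
  have "32 * \<epsilon> \<le> \<delta>" using small_bounds(1,2,8) by simp
  then have "adapted 0 j A"
    unfolding adapted_def using A eps0 by (auto intro: order_trans simp: small_bounds(9)[THEN less_imp_le])
  then show ?thesis by blast
qed

text \<open>On \<open>V\<^sub>k\<^sup>8\<close> the bump functions add up to \<open>1\<close>, so that \<open>\<sigma>\<^sub>k\<close> is a perturbation of \<open>\<pi>\<^sub>i\<close> whose size does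
  not depend on the graph at the previous scale.\<close>

lemma adapted_Suc:
  assumes ad: "\<And>j. j \<in> J k \<Longrightarrow> \<exists>A. adapted k j A" and j: "j \<in> J (Suc k)"
  shows "\<exists>A. adapted (Suc k) j A"
proof -
  let ?r = "rad k"
  obtain i where i: "i \<in> J k" "norm (x (Suc k) j - x k i) \<le> 2 * ?r" using parent[OF j] by metis
  obtain A where A: "adapted k i A" using ad[OF i(1)] by blast
  have K0: "0 \<le> K" using small_bounds(1) by simp
  have r71: "norm (y - x k i) \<le> 20 * ?r" if "norm (y - x k i) \<le> 1.05 * (7.1 * ?r)" for y
    using that by (rule order_trans) simp
  have r71p: "7.1 * ?r > 0" by simp
  \<comment> \<open>The radius 7.1 lies between two constraints: the new ball of radius
    \<open>5 * rad k\<close> around a centre at distance at most \<open>2 * rad k\<close> must be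
    reached with margin 1/20, and the graph over the radius must stay within
    \<open>8 * rad k\<close>, where the bumps add up to 1.\<close>
  obtain g where g: "c2 g" "\<And>q. norm (q - x k i) \<le> 7.1 * ?r \<Longrightarrow> g q = G k i (q + A q)"
    "\<And>q. norm (g q) \<le> K * ?r" "\<And>q. norm (D1 g q) \<le> 2 * K + 200 * (K * ?r) / (7.1 * ?r)"
    "\<And>q. norm (D2 g q) \<le> 5 * K / ?r + 400 * (2 * K) / (7.1 * ?r) + 32000 * (K * ?r) / (7.1 * ?r)\<^sup>2"
    using cutoff_extension[OF GY_c2(1)[OF i(1) A] r71p GY_c2(2)[OF i(1) A r71] GY_c2(3)[OF i(1) A r71]
      GY_c2(4)[OF i(1) A r71]] by metis
  have g1: "norm (D1 g q) \<le> 31 * K" for q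
  proof -
    have "2 * K + 200 * (K * ?r) / (7.1 * ?r) \<le> 31 * K" using K0 by (simp add: less_imp_neq[OF rad_pos, symmetric])
    then show ?thesis using g(4)[of q] by linarith
  qed
  have g2: "norm (D2 g q) \<le> 760 * K / ?r" for q
  proof -
    have "5 * K / ?r + 400 * (2 * K) / (7.1 * ?r) + 32000 * (K * ?r) / (7.1 * ?r)\<^sup>2 =
      (5 + 400 * 2 / 7.1 + 32000 / 7.1\<^sup>2) * (K / ?r)"
      by (simp add: less_imp_neq[OF rad_pos, symmetric] power2_eq_square field_simps)
    also have "\<dots> \<le> 760 * (K / ?r)" using K0 by (intro mult_right_mono) (auto simp: power2_eq_square)
    finally show ?thesis using g(5)[of q] by simp
  qed
  have Kr: "K * ?r \<le> ?r / 100"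
    using mult_right_mono[of K "1/100" ?r] small_bounds(6) by simp
  have eq: "q + g q = \<sigma> k (q + A q)" if q: "q \<in> P k i" "norm (q - x k i) \<le> 7.1 * ?r" for q
  proof -
    have q25: "norm (q - x k i) \<le> 25 * ?r" using q(2) by (rule rad_scale) simp
    have "norm (q + A q - x k i) \<le> 8 * ?r"
      using graph_in_surf(2)[OF i(1) A q(1) q25] q(2) rad_pos[of k] by linarith
    \<comment> \<open>With weight 1 the summand \<open>- A q\<close> in \<open>h\<close> cancels
      \<open>A q\<close>: the old graph survives only as an argument of \<open>G\<close>.\<close>
    from s_eq_1[OF i(1) this] show ?thesis
      unfolding sigma_graph[OF i(1) A q(1) q25] h_def[OF i(1) A] g(2)[OF q(2)] by simp
  qed
  have surf: "S (Suc k) \<inter> cball (x (Suc k) j) (5 * ?r) = (\<lambda>q. q + g q) ` P k i \<inter> cball (x (Suc k) j) (5 * ?r)"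
  proof (rule surf_Suc_eq[OF ad i(1) A eq])
    show "norm (g q) \<le> ?r / 100" for q using g(3)[of q] Kr by linarith
    have "(7.1 - 1/20) * ?r \<ge> 7 * ?r" by (intro mult_right_mono) auto
    then show "norm (x (Suc k) j - x k i) + 5 * ?r \<le> (7.1 - 1/20) * ?r" using i(2) by linarith
  qed auto
  have "20 * \<epsilon> \<le> K" using small_bounds(12) eps0 by linarith
  from mult_right_mono[OF this, of ?r] have "20 * ?r * \<epsilon> \<le> K * ?r" by (simp add: mult_ac)
  then have e20: "norm (\<pi> k i (x (Suc k) j) - x (Suc k) j) \<le> K * ?r"
    using near_next_scale(2)[OF i(1) j i(2)] by linarith
  obtain B where B: "c2 B" "\<And>q. B q \<in> perp (P (Suc k) j)" "\<And>q. norm (D1 B q) \<le> 4 * (31 * K)"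
    "\<And>q. norm (D2 B q) \<le> 5 * (760 * K / ?r)" "norm (B (x (Suc k) j)) \<le> 4 * (K * ?r)"
    "graph_over (P (Suc k) j) B = (\<lambda>q. q + g q) ` P k i"
    by (rule reparam_graph[OF plane[OF i(1)] plane[OF j] g(1) _ g1 g2 _ centre[OF j] e20 g(3)])
      (use near_next_scale(1)[OF i(1) j i(2)] small_bounds(1,6,8) in auto)
  have "adapted (Suc k) j B"
    unfolding adapted_def
  proof (intro conjI allI)
    show "norm (D1 B q) \<le> \<delta>" for q using B(3)[of q] small_bounds(1,2) by linarith
    \<comment> \<open>The tightest of the three bounds, 3800 against 4000; it determines
      \<delta>.\<close>
    have "5 * (760 * K / ?r) \<le> \<delta> / rad (Suc k)"
      using K0 unfolding small_bounds(2) rad_Suc by (simp add: field_simps)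
    then show "norm (D2 B q) \<le> \<delta> / rad (Suc k)" for q using B(4)[of q] by linarith
    have "4 * (K * ?r) \<le> \<delta> * rad (Suc k)" using K0 unfolding small_bounds(2) rad_Suc by simp
    then show "norm (B (x (Suc k) j)) \<le> \<delta> * rad (Suc k)" using B(5) by linarith
    show "S (Suc k) \<inter> cball (x (Suc k) j) (50 * rad (Suc k)) =
      graph_over (P (Suc k) j) B \<inter> cball (x (Suc k) j) (50 * rad (Suc k))"
      using surf unfolding B(6) rad_Suc by simp
  qed (use B in auto)
  then show ?thesis by blast
qed

lemma adapted_exists: "j \<in> J k \<Longrightarrow> \<exists>A. adapted k j A"
proof (induction k arbitrary: j)
  case 0 then show ?case by (rule adapted_0)
next
  case (Suc k) then show ?case by (intro adapted_Suc) auto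
qed

lemma displacement: "y \<in> S k \<Longrightarrow> norm (\<sigma> k y - y) \<le> 21 * \<delta> * rad k"
  by (rule sigma_displacement[OF adapted_exists])

lemma displacement_small: "y \<in> S k \<Longrightarrow> norm (\<sigma> k y - y) \<le> rad k / 100"
proof -
  assume y: "y \<in> S k"
  have "21 * \<delta> * rad k \<le> 1/100 * rad k" using small_bounds(5) by (intro mult_right_mono) auto
  then show ?thesis using displacement[OF y] by linarith
qed

text \<open>Either both points are fixed, or one is within \<open>10 * rad k\<close> of a centre and
  then the other within \<open>11 * rad k\<close>, so both displacements are values of the same
  function \<open>h\<close>.\<close>

lemma displacement_lipschitz:
  assumes y: "y \<in> S k" and z: "z \<in> S k" and yz: "norm (y - z) \<le> rad k"
  shows "norm ((\<sigma> k y - y) - (\<sigma> k z - z)) \<le> 42 * M * \<delta> * norm (y - z)"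
proof (cases "y \<in> V_set J x k 10 \<or> z \<in> V_set J x k 10")
  case False
  then show ?thesis using sigma_id small_bounds(9) M1 by simp
next
  case True
  then obtain i where i: "i \<in> J k" "norm (y - x k i) \<le> 10 * rad k \<or> norm (z - x k i) \<le> 10 * rad k"
    by (auto simp: V_set_def dist_norm norm_minus_commute)
  have "norm (y - x k i) \<le> norm (y - z) + norm (z - x k i)" "norm (z - x k i) \<le> norm (y - z) + norm (y - x k i)"
    using norm_triangle_ineq[of "y - z" "z - x k i"] norm_triangle_ineq[of "z - y" "y - x k i"]
    by (simp_all add: norm_minus_commute)
  then have n: "norm (y - x k i) \<le> 11 * rad k" "norm (z - x k i) \<le> 11 * rad k"
    using i(2) yz by linarith+
  obtain A where A: "adapted k i A" using adapted_exists[OF i(1)] by blast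
  note p = surf_point[OF i(1) A y rad_scale[OF n(1)], simplified]
  note q = surf_point[OF i(1) A z rad_scale[OF n(2)], simplified]
  let ?h = "h k i A"
  have py: "norm (\<pi> k i y - x k i) \<le> 11 * rad k" and qz: "norm (\<pi> k i z - x k i) \<le> 11 * rad k"
    using p(3) q(3) n by linarith+
  have "\<sigma> k y - y = ?h (\<pi> k i y)" "\<sigma> k z - z = ?h (\<pi> k i z)"
    using sigma_graph[OF i(1) A p(1) rad_scale[OF py]] p(2) sigma_graph[OF i(1) A q(1) rad_scale[OF qz]] q(2)
    by simp_all
  moreover have "norm (?h (\<pi> k i y) - ?h (\<pi> k i z)) \<le> 42 * M * \<delta> * norm (\<pi> k i y - \<pi> k i z)"
  proof (rule c1_lipschitz[OF c2_c1[OF h_c2(1)[OF i(1) A]] convex_cball])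
    show "norm (D1 ?h w) \<le> 42 * M * \<delta>" if "w \<in> cball (x k i) (19 * rad k)" for w
      by (rule h_c2(3)[OF i(1) A]) (use that in \<open>auto simp: dist_norm norm_minus_commute\<close>)
    show "\<pi> k i y \<in> cball (x k i) (19 * rad k)" "\<pi> k i z \<in> cball (x k i) (19 * rad k)"
      using rad_scale[OF py, of 19] rad_scale[OF qz, of 19] by (simp_all add: dist_norm norm_minus_commute)
  qed
  moreover have "42 * M * \<delta> * norm (\<pi> k i y - \<pi> k i z) \<le> 42 * M * \<delta> * norm (y - z)"
    using dist_plane_proj_le[OF plane[OF i(1)]] M1 small_bounds(9) by (intro mult_left_mono) auto
  ultimately show ?thesis by simp
qed

subsection \<open>Local graph representation around every point\<close>

text \<open>The 26000 exceeds \<open>42 * 600\<close>, so that the Lipschitz constant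
  \<open>42 * M * \<delta>\<close> of the displacement is at most \<open>\<gamma> / 600\<close>, as
  used in \<open>tangent_plane_step\<close>. The local graphs alone would need only 2900.\<close>

definition "\<gamma> = C2 d c * \<epsilon>"

lemma \<gamma>_eq: "\<gamma> = 26000 * M * \<delta>" and \<gamma>_pos: "\<gamma> > 0" and \<gamma>_small: "10 ^ 6 * real d * \<gamma> \<le> 1" "\<gamma> \<le> 1 / 10 ^ 6"
  and \<delta>_\<gamma>: "\<delta> \<le> \<gamma> / 26000" "42 * M * \<delta> \<le> \<gamma> / 600"
proof -
  show e: "\<gamma> = 26000 * M * \<delta>" by (simp add: \<gamma>_def small_bounds(3))
  show "\<gamma> > 0" unfolding e using M1 small_bounds(9) by simp
  then show "42 * M * \<delta> \<le> \<gamma> / 600" unfolding e by simp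
  show "10 ^ 6 * real d * \<gamma> \<le> 1" using small by (simp add: \<gamma>_def mult.assoc)
  show "\<gamma> \<le> 1 / 10 ^ 6" unfolding e by (rule small_bounds(4))
  show "\<delta> \<le> \<gamma> / 26000" unfolding e using small_bounds(10) by simp
qed

definition local_graph :: "nat \<Rightarrow> 'a \<Rightarrow> 'a set \<Rightarrow> ('a \<Rightarrow> 'a) \<Rightarrow> bool" where
  "local_graph k y Q A \<longleftrightarrow> is_plane d Q \<and> y \<in> Q \<and> c2 A \<and> (\<forall>q. A q \<in> perp Q) \<and>
    (\<forall>q. norm (D1 A q) \<le> \<gamma>) \<and> (\<forall>q. norm (D2 A q) \<le> \<gamma> / rad k) \<and>
    S k \<inter> cball y (19 * rad k) = graph_over Q A \<inter> cball y (19 * rad k)"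

text \<open>Beyond \<open>8 * rad k\<close> the weight may be less than 1 and \<open>A\<close> does
  not cancel, so the perturbation \<open>E = A + h\<close> has size of order
  \<open>M * \<delta>\<close>. The loss does not accumulate, because the argument starts from an
  adapted graph and not from a \<open>local_graph\<close>.\<close>

lemma local_graph_near_centre:
  assumes i: "i \<in> J k" and y: "y \<in> S k" and yi: "norm (y - x k i) \<le> 12 * rad k"
  shows "\<exists>Q A. local_graph (Suc k) (\<sigma> k y) Q A"
proof -
  let ?r = "rad k"
  obtain A where A: "adapted k i A" using adapted_exists[OF i] by blast
  define E where "E q = A q + h k i A q" for q
  note Ec = c2_add[OF adapted_c2[OF i A] h_c2(1)[OF i A], folded E_def[abs_def]]
  have Md: "\<delta> \<le> M * \<delta>" "0 < \<delta>" by (rule small_bounds(10), rule small_bounds(9))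
  have r18: "norm (q - x k i) \<le> 19 * ?r" if "norm (q - x k i) \<le> 1.05 * (18 * ?r)" for q
    using that by (rule order_trans) simp
  have E0: "norm (E q) \<le> 47 * \<delta> * ?r" if "norm (q - x k i) \<le> 1.05 * (18 * ?r)" for q
    using norm_triangle_ineq[of "A q" "h k i A q"] adapted_norm_le(1)[OF i A rad_scale[OF r18[OF that]]]
      h_c2(2)[OF i A r18[OF that]] by (simp add: E_def)
  have E1: "norm (D1 E q) \<le> 43 * M * \<delta>" if "norm (q - x k i) \<le> 1.05 * (18 * ?r)" for q
    unfolding Ec(2) using norm_triangle_ineq[of "D1 A q" "D1 (h k i A) q"] adapted_D1[OF i A, of q]
      h_c2(3)[OF i A r18[OF that]] Md by linarith
  have E2: "norm (D2 E q) \<le> 107 * M * \<delta> / ?r" if "norm (q - x k i) \<le> 1.05 * (18 * ?r)" for q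
  proof -
    have "norm (D2 E q) \<le> \<delta> / ?r + 106 * M * \<delta> / ?r"
      unfolding Ec(3) by (intro order_trans[OF norm_triangle_ineq] add_mono adapted_D2[OF i A] h_c2(4)[OF i A r18[OF that]])
    also have "\<dots> = (\<delta> + 106 * M * \<delta>) / ?r" by (simp add: add_divide_distrib)
    also have "\<dots> \<le> 107 * M * \<delta> / ?r" using Md by (intro divide_right_mono) auto
    finally show ?thesis .
  qed
  have r18p: "18 * ?r > 0" by simp
  \<comment> \<open>The radius 18 covers 12 for \<open>y\<close>, 2 for the new ball and the
    margins, and with its layer \<open>1.05 * 18 = 18.9\<close> it stays below 19, where
    \<open>h_c2\<close> applies.\<close>
  obtain g where g: "c2 g" "\<And>q. norm (q - x k i) \<le> 18 * ?r \<Longrightarrow> g q = E q"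
    "\<And>q. norm (g q) \<le> 47 * \<delta> * ?r" "\<And>q. norm (D1 g q) \<le> 43 * M * \<delta> + 200 * (47 * \<delta> * ?r) / (18 * ?r)"
    "\<And>q. norm (D2 g q) \<le> 107 * M * \<delta> / ?r + 400 * (43 * M * \<delta>) / (18 * ?r) + 32000 * (47 * \<delta> * ?r) / (18 * ?r)\<^sup>2"
    using cutoff_extension[OF Ec(1) r18p E0 E1 E2] by metis
  have g1: "norm (D1 g q) \<le> 600 * M * \<delta>" for q
  proof -
    have "43 * M * \<delta> + 200 * (47 * \<delta> * ?r) / (18 * ?r) = 43 * M * \<delta> + 4700 / 9 * \<delta>"
      by (simp add: less_imp_neq[OF rad_pos, symmetric])
    then show ?thesis using g(4)[of q] Md by linarith
  qed
  have g2: "norm (D2 g q) \<le> 5800 * M * \<delta> / ?r" for q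
  proof -
    have "107 * M * \<delta> / ?r + 400 * (43 * M * \<delta>) / (18 * ?r) + 32000 * (47 * \<delta> * ?r) / (18 * ?r)\<^sup>2 =
      ((107 + 400 * 43 / 18) * (M * \<delta>) + 32000 * 47 / 18\<^sup>2 * \<delta>) / ?r"
      by (simp add: less_imp_neq[OF rad_pos, symmetric] power2_eq_square field_simps)
    also have "\<dots> \<le> 5800 * (M * \<delta>) / ?r"
    proof (intro divide_right_mono)
      have "(107 + 400 * 43 / 18) * X + 32000 * 47 / 18\<^sup>2 * \<delta> \<le> 5800 * X" if "\<delta> \<le> X" for X
        using that Md(2) by (simp add: power2_eq_square)
      then show "(107 + 400 * 43 / 18) * (M * \<delta>) + 32000 * 47 / 18\<^sup>2 * \<delta> \<le> 5800 * (M * \<delta>)" using Md(1) by blast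
    qed simp
    finally show ?thesis using g(5)[of q] by (simp add: mult.assoc)
  qed
  have eq: "q + g q = \<sigma> k (q + A q)" if "q \<in> P k i" "norm (q - x k i) \<le> 18 * ?r" for q
    using sigma_graph[OF i A that(1) rad_scale[OF that(2)]] g(2)[OF that(2)] by (simp add: E_def)
  have small_move: "47 * \<delta> * ?r \<le> ?r / 100"
    using mult_right_mono[of "47 * \<delta>" "1/100" ?r] small_bounds(5) by simp
  have ny: "norm (\<sigma> k y - y) \<le> ?r / 100" by (rule displacement_small[OF y])
  have surf: "S (Suc k) \<inter> cball (\<sigma> k y) (2 * ?r) = (\<lambda>q. q + g q) ` P k i \<inter> cball (\<sigma> k y) (2 * ?r)"
  proof (rule surf_Suc_eq[OF adapted_exists i A eq])
    show "norm (g q) \<le> ?r / 100" for q using g(3)[of q] small_move by linarith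
    have "norm (\<sigma> k y - x k i) \<le> norm (\<sigma> k y - y) + norm (y - x k i)"
      using norm_triangle_ineq[of "\<sigma> k y - y" "y - x k i"] by simp
    moreover have "(18 - 1/20) * ?r \<ge> 17 * ?r" by (intro mult_right_mono) auto
    ultimately show "norm (\<sigma> k y - x k i) + 2 * ?r \<le> (18 - 1/20) * ?r"
      using yi ny rad_pos[of k] by linarith
  qed auto
  obtain B where B: "c2 B" "\<And>q. B q \<in> perp (P k i)" "\<And>q. norm (D1 B q) \<le> 4 * (600 * M * \<delta>)"
    "\<And>q. norm (D2 B q) \<le> 5 * (5800 * M * \<delta> / ?r)" "graph_over (P k i) B = (\<lambda>q. q + g q) ` P k i"
    by (rule reparam_graph[OF plane[OF i] plane[OF i] g(1) _ g1 g2 _ centre[OF i], of "47 * \<delta> * ?r"])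
      (use g(3) small_bounds(11) M1 Md plane_proj_id[OF plane[OF i] centre[OF i]] in auto)
  have "\<sigma> k y \<in> S (Suc k) \<inter> cball (\<sigma> k y) (2 * ?r)" using y by simp
  then have yB: "\<sigma> k y \<in> graph_over (P k i) B" unfolding surf B(5) by simp
  obtain Q B' where Q: "is_plane d Q" "\<sigma> k y \<in> Q" "c2 B'" "\<And>q. B' q \<in> perp Q"
    "\<And>q. norm (D1 B' q) \<le> 4 * (600 * M * \<delta>)" "\<And>q. norm (D2 B' q) \<le> 5 * (5800 * M * \<delta> / ?r)"
    "graph_over Q B' = graph_over (P k i) B"
    by (rule graph_translate[OF plane[OF i] B(1,2) yB B(3,4)]) (rule that)
  have "local_graph (Suc k) (\<sigma> k y) Q B'"
    unfolding local_graph_def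
  proof (intro conjI allI)
    have Md0: "0 < M * \<delta>" using Md by linarith
    show "norm (D1 B' q) \<le> \<gamma>" for q using Q(5)[of q] Md0 unfolding \<gamma>_eq by simp
    have "5 * (5800 * M * \<delta> / ?r) \<le> \<gamma> / rad (Suc k)" unfolding \<gamma>_eq rad_Suc using Md0 by (simp add: field_simps)
    then show "norm (D2 B' q) \<le> \<gamma> / rad (Suc k)" for q using Q(6)[of q] by linarith
    have "cball (\<sigma> k y) (19 * rad (Suc k)) \<subseteq> cball (\<sigma> k y) (2 * ?r)" unfolding rad_Suc by (rule subset_cball) simp
    then show "S (Suc k) \<inter> cball (\<sigma> k y) (19 * rad (Suc k)) = graph_over Q B' \<inter> cball (\<sigma> k y) (19 * rad (Suc k))"
      using surf unfolding Q(7) B(5) by blast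
  qed (use Q in auto)
  then show ?thesis by blast
qed

text \<open>Around \<open>y\<close> the map is the identity on the ball of radius
  \<open>2 * rad k\<close>, and points from outside move too little to enter the ball of radius
  \<open>1.9 * rad k\<close>, which is \<open>19 * rad (Suc k)\<close>. The old graph is kept, and
  the admissible second derivative only grows with \<open>k\<close>.\<close>

lemma local_graph_far:
  assumes far: "\<And>i. i \<in> J k \<Longrightarrow> norm (y - x k i) > 12 * rad k" and y: "y \<in> S k" and lg: "local_graph k y Q A"
  shows "local_graph (Suc k) (\<sigma> k y) Q A"
proof -
  let ?r = "rad k"
  have far': "z \<notin> V_set J x k 10" if "norm (z - y) \<le> 2 * ?r" for z
  proof
    assume "z \<in> V_set J x k 10"
    then obtain i where i: "i \<in> J k" "norm (z - x k i) \<le> 10 * ?r"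
      by (auto simp: V_set_def dist_norm norm_minus_commute)
    have "norm (y - x k i) \<le> 12 * ?r"
      using norm_triangle_ineq4[of "z - x k i" "z - y"] i(2) that by simp
    then show False using far[OF i(1)] by simp
  qed
  have yy: "\<sigma> k y = y" by (rule sigma_id[OF far']) simp
  have eq: "S (Suc k) \<inter> cball y (1.9 * ?r) = S k \<inter> cball y (1.9 * ?r)"
  proof (intro equalityI subsetI)
    fix z assume "z \<in> S (Suc k) \<inter> cball y (1.9 * ?r)"
    then obtain z' where z: "z' \<in> S k" "z = \<sigma> k z'" "norm (z - y) \<le> 1.9 * ?r"
      by (auto simp: dist_norm norm_minus_commute)
    have "norm (z' - y) \<le> norm (z - y) + norm (z - z')"
      using norm_triangle_ineq4[of "z - y" "z - z'"] by simp
    also have "\<dots> \<le> 2 * ?r" using z(3) displacement_small[OF z(1)] rad_pos[of k] unfolding z(2) by linarith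
    finally have "z = z'" using sigma_id[OF far'] z(2) by simp
    then show "z \<in> S k \<inter> cball y (1.9 * ?r)" using z by (auto simp: dist_norm norm_minus_commute)
  next
    fix z assume z: "z \<in> S k \<inter> cball y (1.9 * ?r)"
    then have "norm (z - y) \<le> 1.9 * ?r" by (auto simp: dist_norm norm_minus_commute)
    then have "norm (z - y) \<le> 2 * ?r" by (rule order_trans) simp
    then have "\<sigma> k z = z" by (rule sigma_id[OF far'])
    then show "z \<in> S (Suc k) \<inter> cball y (1.9 * ?r)" using z by (auto intro: rev_image_eqI)
  qed
  have lg': "is_plane d Q" "y \<in> Q" "c2 A" "\<And>q. A q \<in> perp Q" "\<And>q. norm (D1 A q) \<le> \<gamma>"
    "\<And>q. norm (D2 A q) \<le> \<gamma> / ?r" "S k \<inter> cball y (19 * ?r) = graph_over Q A \<inter> cball y (19 * ?r)"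
    using lg unfolding local_graph_def by blast+
  show ?thesis
    unfolding local_graph_def yy
  proof (intro conjI allI)
    have "\<gamma> / ?r \<le> \<gamma> / rad (Suc k)" unfolding rad_Suc using \<gamma>_pos by (intro divide_left_mono) auto
    then show "norm (D2 A q) \<le> \<gamma> / rad (Suc k)" for q using lg'(6)[of q] by linarith
    have "cball y (1.9 * ?r) \<subseteq> cball y (19 * ?r)" by (rule subset_cball) simp
    then show "S (Suc k) \<inter> cball y (19 * rad (Suc k)) = graph_over Q A \<inter> cball y (19 * rad (Suc k))"
      using eq lg'(7) unfolding rad_Suc by auto
  qed (use lg' in auto)
qed

lemma local_graph_exists: "y \<in> S k \<Longrightarrow> \<exists>Q A. local_graph k y Q A"
proof (induction k arbitrary: y)
  case 0
  have z: "c2 (\<lambda>x::'a. 0::'a)" "D1 (\<lambda>x::'a. 0::'a) = (\<lambda>x. 0)" "D2 (\<lambda>x::'a. 0::'a) = (\<lambda>x. 0)"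
    using c2_lin[of "0 :: 'a \<Rightarrow>\<^sub>L 'a" 0] by (simp_all add: D1_const)
  have "local_graph 0 y P0 (\<lambda>_. 0)"
    unfolding local_graph_def
    using 0 z \<gamma>_pos plane0 by (auto simp: graph_over_def perp_iff[OF plane0] blinfun.zero_right)
  then show ?case by blast
next
  case (Suc k)
  then obtain y' where y: "y' \<in> S k" "y = \<sigma> k y'" by auto
  show ?case
  proof (cases "\<exists>i\<in>J k. norm (y' - x k i) \<le> 12 * rad k")
    case True
    then show ?thesis using local_graph_near_centre y by blast
  next
    case False
    obtain Q A where "local_graph k y' Q A" using Suc.IH[OF y(1)] by blast
    then show ?thesis using local_graph_far[OF _ y(1)] False y(2) by (meson not_le)
  qed
qed

end

section \<open>The limit map\<close>

lemma f_seq_add: "f_seq \<sigma> (k + n) y = f_seq (\<lambda>m. \<sigma> (k + m)) n (f_seq \<sigma> k y)"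
  by (induction n) auto

lemma surf_f_seq: "surf \<sigma> P0 k = f_seq \<sigma> k ` P0"
  by (induction k) (auto simp: image_image)

lemma fold_f_seq: "fold \<sigma> [0..<n] y = f_seq \<sigma> n y"
  by (induction n) auto

lemma has_vector_derivative_quotient:
  assumes "(f has_vector_derivative w) (at (0::real))"
  shows "((\<lambda>t. (f t - f 0) /\<^sub>R t) \<longlongrightarrow> w) (at 0)"
proof -
  have "((\<lambda>t. norm (f t - f 0 - t *\<^sub>R w) / norm t) \<longlongrightarrow> 0) (at 0)"
    using assms unfolding has_vector_derivative_def has_derivative_iff_norm by simp
  moreover have "norm (f t - f 0 - t *\<^sub>R w) / norm t = norm ((f t - f 0) /\<^sub>R t - w)" if "t \<noteq> 0" for t
  proof -
    have "(f t - f 0) /\<^sub>R t - w = (f t - f 0 - t *\<^sub>R w) /\<^sub>R t"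
      using that by (simp add: scaleR_diff_right)
    then show ?thesis by (simp add: divide_inverse mult.commute)
  qed
  then have "\<forall>\<^sub>F t in at 0. norm (f t - f 0 - t *\<^sub>R w) / norm t = norm ((f t - f 0) /\<^sub>R t - w)"
    by (auto simp: eventually_at_filter)
  ultimately have "((\<lambda>t. norm ((f t - f 0) /\<^sub>R t - w)) \<longlongrightarrow> 0) (at 0)"
    by (rule Lim_transform_eventually)
  then show ?thesis by (simp add: tendsto_norm_zero_iff LIM_zero_cancel)
qed

text \<open>The displacement is Lipschitz only along the surface; comparing velocities of curves in
  the surface turns this into a bound on tangent vectors.\<close>

lemma vector_derivative_norm_le:
  assumes f: "(f has_vector_derivative w) (at (0::real))" and g: "(g has_vector_derivative v) (at 0)"
    and le: "\<forall>\<^sub>F t in at 0. norm (f t - f 0) \<le> \<eta> * norm (g t - g 0)"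
  shows "norm w \<le> \<eta> * norm v"
proof (rule tendsto_le)
  show "((\<lambda>t. norm ((f t - f 0) /\<^sub>R t)) \<longlongrightarrow> norm w) (at 0)"
    by (intro tendsto_norm has_vector_derivative_quotient f)
  show "((\<lambda>t. \<eta> * norm ((g t - g 0) /\<^sub>R t)) \<longlongrightarrow> \<eta> * norm v) (at 0)"
    by (intro tendsto_mult_left tendsto_norm has_vector_derivative_quotient g)
  show "\<forall>\<^sub>F t in at 0. norm ((f t - f 0) /\<^sub>R t) \<le> \<eta> * norm ((g t - g 0) /\<^sub>R t)"
    using le by eventually_elim (auto simp: mult.left_commute[of \<eta>] intro!: mult_left_mono)
qed simp

lemma norm_quadrilateral:
  fixes a b c e :: "'b::real_normed_vector"
  shows "norm (a - b) \<le> norm (c - e) + norm (c - a) + norm (e - b)"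
  using norm_triangle_ineq[of "(c - e) - (c - a)" "e - b"] norm_triangle_ineq4[of "c - e" "c - a"] by simp

context coherent_collection
begin

section \<open>Orbits and their limits\<close>

definition "fs k n = f_seq (\<lambda>m. \<sigma> (k + m)) n"
text \<open>The limit map started at scale \<open>k\<close>. It moves points of \<open>S k\<close>
  by an amount of order \<open>\<delta> * rad k\<close> only and still has image \<Sigma>, so
  \<Sigma> can be studied at scale \<open>k\<close> as a small perturbation of
  \<open>S k\<close>.\<close>

definition "FF k = f_lim (\<lambda>m. \<sigma> (k + m))"
abbreviation "f \<equiv> f_lim \<sigma>"
abbreviation "\<Sigma> \<equiv> f ` P0"

lemma FF_0: "FF 0 = f" by (simp add: FF_def)

lemma fs_0: "fs 0 n = f_seq \<sigma> n" by (simp add: fs_def)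

lemma fs_surf: "y \<in> S k \<Longrightarrow> fs k n y \<in> S (k + n)"
  by (induction n) (auto simp: fs_def)

lemma f_seq_surf: "u \<in> P0 \<Longrightarrow> f_seq \<sigma> k u \<in> S k"
  by (simp add: surf_f_seq)

lemma fs_step: "y \<in> S k \<Longrightarrow> norm (fs k (Suc n) y - fs k n y) \<le> 21 * \<delta> * rad (k + n)"
  using displacement[OF fs_surf, of y k n] by (simp add: fs_def)

text \<open>Summation of a geometric series in telescoping form: 24 suffices because
  \<open>24 * (1 - 1 / 10) = 21.6\<close> is at least 21.\<close>

lemma fs_dist:
  assumes y: "y \<in> S k"
  shows "norm (fs k (n + p) y - fs k n y) \<le> 24 * \<delta> * (rad (k + n) - rad (k + n + p))"
proof (induction p)
  case (Suc p)
  have "norm (fs k (n + Suc p) y - fs k n y) \<le>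
      norm (fs k (Suc (n + p)) y - fs k (n + p) y) + norm (fs k (n + p) y - fs k n y)"
    using norm_triangle_ineq[of "fs k (Suc (n + p)) y - fs k (n + p) y" "fs k (n + p) y - fs k n y"] by simp
  also have "\<dots> \<le> 21 * \<delta> * rad (k + n + p) + 24 * \<delta> * (rad (k + n) - rad (k + n + p))"
    using fs_step[OF y, of "n + p"] Suc.IH by (simp add: add.assoc)
  also have "21 * \<delta> * rad (k + n + p) \<le> 24 * \<delta> * (rad (k + n + p) - rad (k + n + Suc p))"
  proof -
    have e: "24 * \<delta> * (rad (k + n + p) - rad (k + n + Suc p)) = 21.6 * \<delta> * rad (k + n + p)"
      by (simp add: rad_Suc)
    show ?thesis unfolding e using small_bounds(9) by (intro mult_right_mono) auto
  qed
  finally show ?case by (simp add: algebra_simps)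
qed simp

lemma rad_tendsto_0: "rad \<longlonglongrightarrow> 0"
proof -
  have "(\<lambda>k. (1/10 :: real) ^ k) \<longlonglongrightarrow> 0" by (rule LIMSEQ_realpow_zero) auto
  then show ?thesis unfolding rad_def[abs_def] by (simp add: power_divide)
qed

lemma rad_antimono: "k \<le> l \<Longrightarrow> rad l \<le> rad k"
  unfolding rad_def by (intro divide_left_mono power_increasing) auto

lemma fs_convergent:
  assumes y: "y \<in> S k"
  shows "(\<lambda>n. fs k n y) \<longlonglongrightarrow> FF k y"
proof -
  have "Cauchy (\<lambda>n. fs k n y)"
    unfolding Cauchy_altdef
  proof (intro allI impI)
    fix e :: real assume e: "e > 0"
    obtain n0 where n0: "\<And>n. n \<ge> n0 \<Longrightarrow> norm (rad n - 0) < e"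
      using LIMSEQ_D[OF rad_tendsto_0 e] by blast
    show "\<exists>M. \<forall>m\<ge>M. \<forall>n>m. dist (fs k m y) (fs k n y) < e"
    proof (intro exI allI impI)
      fix m n assume mn: "m \<ge> n0" "n > m"
      have "norm (fs k (m + (n - m)) y - fs k m y) \<le> 24 * \<delta> * (rad (k + m) - rad (k + m + (n - m)))"
        by (rule fs_dist[OF y])
      also have "\<dots> \<le> 1 * rad (k + m)"
        using small_bounds(5,9) rad_antimono[of "k + m" "k + m + (n - m)" for m] by (intro mult_mono) auto
      also have "\<dots> < e" using n0[of "k + m"] mn by simp
      finally show "dist (fs k m y) (fs k n y) < e" using mn by (simp add: dist_norm norm_minus_commute)
    qed
  qed
  then have "convergent (\<lambda>n. fs k n y)" using Cauchy_convergent_iff by blast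
  then show ?thesis unfolding FF_def f_lim_def fs_def by (rule convergent_LIMSEQ_iff[THEN iffD1])
qed

lemma FF_dist:
  assumes y: "y \<in> S k"
  shows "norm (FF k y - fs k n y) \<le> 24 * \<delta> * rad (k + n)"
proof (rule Lim_norm_ubound[OF sequentially_bot])
  show "(\<lambda>p. fs k (n + p) y - fs k n y) \<longlonglongrightarrow> FF k y - fs k n y"
    using LIMSEQ_ignore_initial_segment[OF fs_convergent[OF y], of n]
    by (intro tendsto_diff tendsto_const) (simp add: add.commute)
  have "norm (fs k (n + p) y - fs k n y) \<le> 24 * \<delta> * rad (k + n)" for p
    by (rule order_trans[OF fs_dist[OF y]], intro mult_left_mono) (use small_bounds(9) in auto)
  then show "\<forall>\<^sub>F p in sequentially. norm (fs k (n + p) y - fs k n y) \<le> 24 * \<delta> * rad (k + n)" by simp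
qed

lemma FF_dist_0: "y \<in> S k \<Longrightarrow> norm (FF k y - y) \<le> 24 * \<delta> * rad k"
  using FF_dist[of y k 0] by (simp add: fs_def)

lemma FF_f_seq:
  assumes u: "u \<in> P0"
  shows "FF k (f_seq \<sigma> k u) = f u"
proof -
  have "(\<lambda>n. fs 0 n u) \<longlonglongrightarrow> f u" using fs_convergent[of u 0] u by (simp add: FF_0)
  from LIMSEQ_ignore_initial_segment[OF this, of k]
  have "(\<lambda>n. fs k n (f_seq \<sigma> k u)) \<longlonglongrightarrow> f u" by (simp add: fs_def add.commute[of _ k] f_seq_add)
  then show ?thesis using fs_convergent[OF f_seq_surf[OF u]] LIMSEQ_unique by blast
qed

lemma FF_image: "FF k ` S k = \<Sigma>"
  unfolding surf_f_seq image_image using FF_f_seq by (intro image_cong) auto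

lemma f_dist: "u \<in> P0 \<Longrightarrow> norm (f u - f_seq \<sigma> k u) \<le> 24 * \<delta> * rad k"
  using FF_dist_0[OF f_seq_surf, of u k] FF_f_seq by simp

section \<open>Distortion of distances and injectivity\<close>

lemma sigma_lipschitz:
  assumes "y \<in> S k" "z \<in> S k" "norm (y - z) \<le> rad k"
  shows "norm (\<sigma> k y - \<sigma> k z) \<le> (101/100) * norm (y - z)" "(99/100) * norm (y - z) \<le> norm (\<sigma> k y - \<sigma> k z)"
proof -
  have "42 * M * \<delta> * norm (y - z) \<le> (1/100) * norm (y - z)"
    using small_bounds(11) by (intro mult_right_mono) auto
  then have 1: "norm ((\<sigma> k y - y) - (\<sigma> k z - z)) \<le> (1/100) * norm (y - z)"
    using displacement_lipschitz[OF assms] by linarith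
  have "norm (\<sigma> k y - \<sigma> k z) \<le> norm ((\<sigma> k y - y) - (\<sigma> k z - z)) + norm (y - z)"
    using norm_triangle_ineq[of "(\<sigma> k y - y) - (\<sigma> k z - z)" "y - z"] by (simp add: algebra_simps)
  then show "norm (\<sigma> k y - \<sigma> k z) \<le> (101/100) * norm (y - z)" using 1 by simp
  have "norm (y - z) \<le> norm (\<sigma> k y - \<sigma> k z) + norm ((\<sigma> k y - y) - (\<sigma> k z - z))"
    using norm_triangle_ineq4[of "\<sigma> k y - \<sigma> k z" "(\<sigma> k y - y) - (\<sigma> k z - z)"] by (simp add: algebra_simps)
  then show "(99/100) * norm (y - z) \<le> norm (\<sigma> k y - \<sigma> k z)" using 1 by simp
qed

lemma sigma_continuous: "continuous_on (S k) (\<sigma> k)"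
  unfolding continuous_on_iff
proof (intro ballI allI impI)
  fix y and e :: real assume y: "y \<in> S k" and e: "e > 0"
  show "\<exists>d>0. \<forall>z\<in>S k. dist z y < d \<longrightarrow> dist (\<sigma> k z) (\<sigma> k y) < e"
  proof (intro exI conjI ballI impI)
    show "min (rad k) (e / 2) > 0" using e by simp
    fix z assume z: "z \<in> S k" "dist z y < min (rad k) (e / 2)"
    then have "norm (z - y) \<le> rad k" "norm (z - y) < e / 2" by (auto simp: dist_norm)
    then show "dist (\<sigma> k z) (\<sigma> k y) < e"
      using sigma_lipschitz(1)[OF z(1) y] e unfolding dist_norm by linarith
  qed
qed

lemma fs_continuous: "continuous_on (S k) (fs k n)"
proof (induction n)
  case 0 then show ?case by (simp add: fs_def continuous_on_id)
next
  case (Suc n)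
  have "fs k (Suc n) = (\<lambda>y. \<sigma> (k + n) (fs k n y))" by (auto simp: fs_def)
  moreover have "continuous_on (S k) (\<lambda>y. \<sigma> (k + n) (fs k n y))"
    by (rule continuous_on_compose2[OF sigma_continuous Suc.IH]) (use fs_surf in auto)
  ultimately show ?case by simp
qed

lemma FF_continuous: "continuous_on (S k) (FF k)"
proof (rule uniform_limit_theorem[OF _ _ sequentially_bot])
  show "\<forall>\<^sub>F n in sequentially. continuous_on (S k) (fs k n)" by (simp add: fs_continuous)
  show "uniform_limit (S k) (fs k) (FF k) sequentially"
    unfolding uniform_limit_sequentially_iff
  proof (intro allI impI)
    fix e :: real assume e: "e > 0"
    obtain n0 where n0: "\<And>n. n \<ge> n0 \<Longrightarrow> norm (rad n - 0) < e"
      using LIMSEQ_D[OF rad_tendsto_0 e] by blast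
    show "\<exists>N. \<forall>n\<ge>N. \<forall>y\<in>S k. dist (fs k n y) (FF k y) < e"
    proof (intro exI allI impI ballI)
      fix n y assume n: "n \<ge> n0" and y: "y \<in> S k"
      have "norm (FF k y - fs k n y) \<le> 24 * \<delta> * rad (k + n)" by (rule FF_dist[OF y])
      also have "\<dots> \<le> 1 * rad (k + n)" using small_bounds(5) by (intro mult_right_mono) auto
      also have "\<dots> < e" using n0[of "k + n"] n by simp
      finally show "dist (fs k n y) (FF k y) < e" by (simp add: dist_norm norm_minus_commute)
    qed
  qed
qed

lemma delta24: "24 * \<delta> \<le> \<gamma> / 1000" "48 * \<delta> \<le> 1 / 100"
  using \<delta>_\<gamma>(1) \<gamma>_pos small_bounds(5) by simp_all

text \<open>Up to the first scale at which the two orbits are separated, their distance changes by a bounded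
  factor per scale; afterwards it stays essentially constant.\<close>

lemma bi_hoelder:
  assumes u: "u \<in> P0" and v: "v \<in> P0" and uv: "norm (u - v) \<le> 1"
  shows "1 / 4 * norm (u - v) powr (1 + 1/2) \<le> norm (f u - f v)"
    and "norm (f u - f v) \<le> 10 * norm (u - v) powr (1 - 1/2)"
proof -
  have "1 / 4 * norm (u - v) powr (1 + 1/2) \<le> norm (f u - f v) \<and> norm (f u - f v) \<le> 10 * norm (u - v) powr (1 - 1/2)"
  proof (cases "u = v")
    case False
    define a where "a k = norm (f_seq \<sigma> k u - f_seq \<sigma> k v)" for k
    have a0: "a 0 > 0" "a 0 \<le> 1" "a 0 = norm (u - v)" using False uv by (auto simp: a_def)
    have step: "(99/100) * a k \<le> a (Suc k)" "a (Suc k) \<le> (101/100) * a k" if "a k \<le> rad k" for k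
      using sigma_lipschitz[OF f_seq_surf[OF u] f_seq_surf[OF v], of k] that by (auto simp: a_def)
    have iter: "(99/100) ^ k * a 0 \<le> a k \<and> a k \<le> (101/100) ^ k * a 0" if "\<And>l. l < k \<Longrightarrow> a l \<le> rad l" for k
      using that
    proof (induction k)
      case (Suc k)
      then have IH: "(99/100) ^ k * a 0 \<le> a k" "a k \<le> (101/100) ^ k * a 0" "a k \<le> rad k" by auto
      have "(99/100) ^ Suc k * a 0 = (99/100) * ((99/100) ^ k * a 0)" "(101/100) ^ Suc k * a 0 = (101/100) * ((101/100) ^ k * a 0)" by simp_all
      then show ?case using IH step[OF IH(3)] by linarith
    qed simp
    \<comment> \<open>Distances shrink by at most 99/100 per step and radii by 10, so otherwise
      \<open>(99/10) ^ n * a 0\<close> would stay bounded. Below, \<open>K\<close> denotes the first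
      such scale and not the constant of that name.\<close>
    have "\<exists>k. a k > rad k"
    proof (rule ccontr)
      assume "\<nexists>k. a k > rad k"
      then have al: "a k \<le> rad k" for k by (meson not_le)
      obtain n where n: "1 / a 0 < (99/10) ^ n" using real_arch_pow[of "99/10" "1 / a 0"] by auto
      have "(99/100) ^ n * a 0 \<le> rad n" using iter[of n] al order_trans[OF _ al[of n]] by simp
      then have "((99/100) ^ n * 10 ^ n) * a 0 \<le> 1" by (simp add: rad_def field_simps)
      then have "(99/10) ^ n * a 0 \<le> 1" by (simp add: power_mult_distrib[symmetric])
      moreover have "1 < (99/10) ^ n * a 0" using n a0(1) by (simp add: field_simps)
      ultimately show False by linarith
    qed
    then obtain K where K: "a K > rad K" "\<And>l. l < K \<Longrightarrow> a l \<le> rad l"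
      using exists_least_iff[of "\<lambda>k. a k > rad k"] by (meson not_le)
    have "K \<noteq> 0" using K(1) a0(2) by (auto intro: ccontr)
    then obtain k where k: "K = Suc k" using not0_implies_Suc by blast
    \<comment> \<open>The square root corresponds to \<tau> = 1/2. From
      \<open>4 ^ k * a 0 \<le> 1\<close> follows \<open>2 ^ k * w \<le> 1\<close>, so
      \<open>w\<close> absorbs both the growth \<open>(101/100) ^ k\<close> and the decay
      \<open>(99/100) ^ k\<close>.\<close>
    define w where "w = sqrt (a 0)"
    have w: "w > 0" "w * w = a 0" using a0 by (auto simp: w_def)
    have "(99/100) ^ k * a 0 \<le> a k" using iter[of k] K(2) k by simp
    then have "(99/100) ^ k * a 0 \<le> rad k" using K(2)[of k] k by simp
    then have "((99/100) ^ k * 10 ^ k) * a 0 \<le> 1" by (simp add: rad_def field_simps)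
    then have "(99/10) ^ k * a 0 \<le> 1" by (simp add: power_mult_distrib[symmetric])
    moreover have "4 ^ k * a 0 \<le> (99/10) ^ k * a 0" using a0(1) by (intro mult_right_mono power_mono) auto
    ultimately have "4 ^ k * a 0 \<le> 1" by linarith
    moreover have "(2 ^ k * w)\<^sup>2 = 4 ^ k * a 0"
    proof -
      have "(2::real) ^ k * 2 ^ k = 4 ^ k" by (simp add: power_mult_distrib[symmetric])
      moreover have "(2 ^ k * w)\<^sup>2 = (2 ^ k * 2 ^ k) * (w * w)" by (simp add: power2_eq_square mult_ac)
      ultimately show ?thesis using w(2) by simp
    qed
    ultimately have "(2 ^ k * w)\<^sup>2 \<le> 1\<^sup>2" by simp
    then have w1: "2 ^ k * w \<le> 1" by (rule power2_le_imp_le) simp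
    \<comment> \<open>From scale \<open>K\<close> on, each orbit moves by at most
      \<open>24 * \<delta> * rad K\<close> in total, one per cent of the distance for both
      together.\<close>
    have fK: "norm (f u - f v) \<le> (101/100) * a K" "(99/100) * a K \<le> norm (f u - f v)"
    proof -
      let ?A = "f u - f_seq \<sigma> K u" and ?B = "f v - f_seq \<sigma> K v"
      have n: "norm (?A - ?B) \<le> 48 * \<delta> * rad K"
        using norm_triangle_ineq4[of ?A ?B] f_dist[OF u, of K] f_dist[OF v, of K] by simp
      have "48 * \<delta> * rad K \<le> (1/100) * rad K" using delta24 by (intro mult_right_mono) auto
      then have n: "norm (?A - ?B) \<le> (1/100) * a K" using n K(1) by linarith
      have "f u - f v = (?A - ?B) + (f_seq \<sigma> K u - f_seq \<sigma> K v)" by simp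
      then have "norm (f u - f v) \<le> norm (?A - ?B) + a K" unfolding a_def by (metis norm_triangle_ineq)
      then show "norm (f u - f v) \<le> (101/100) * a K" using n by simp
      have "f_seq \<sigma> K u - f_seq \<sigma> K v = (f u - f v) - (?A - ?B)" by simp
      then have "a K \<le> norm (f u - f v) + norm (?A - ?B)" unfolding a_def by (metis norm_triangle_ineq4)
      then show "(99/100) * a K \<le> norm (f u - f v)" using n by simp
    qed
    have aK: "(99/100) ^ K * a 0 \<le> a K" "a K \<le> (101/100) ^ K * a 0" using iter[of K] K(2) by auto
    have up: "norm (f u - f v) \<le> 10 * w"
    proof -
      have "(101/100) ^ K * a 0 = (101/100) * ((101/100) ^ k * w) * w" using w(2) by (simp add: k mult.assoc)
      also have "\<dots> \<le> (101/100) * (2 ^ k * w) * w"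
        using w(1) by (intro mult_right_mono mult_left_mono power_mono) auto
      also have "\<dots> \<le> (101/100) * 1 * w" using w1 w(1) by (intro mult_right_mono mult_left_mono) auto
      finally show ?thesis using fK(1) aK(2) w(1) by simp
    qed
    have low: "1/4 * (a 0 * w) \<le> norm (f u - f v)"
    proof -
      have "w \<le> (1/2) ^ k" using w1 by (simp add: field_simps power_divide)
      also have "\<dots> \<le> (99/100) ^ k" by (rule power_mono) auto
      finally have "(99/100) * (a 0 * w) \<le> (99/100) * (a 0 * (99/100) ^ k)" using a0(1) by (intro mult_left_mono) auto
      also have "\<dots> = (99/100) ^ K * a 0" by (simp add: k)
      finally have "(99/100) * (a 0 * w) \<le> a K" using aK(1) by linarith
      moreover have "0 < a 0 * w" using a0 w by simp
      ultimately show ?thesis using fK(2) by linarith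
    qed
    have "norm (u - v) powr (1 - 1/2) = w" unfolding a0(3)[symmetric] w_def using a0(1) by (simp add: powr_half_sqrt)
    moreover have "norm (u - v) powr (1 + 1/2) = a 0 * w"
      unfolding a0(3)[symmetric] w_def powr_add using a0(1) by (simp add: powr_half_sqrt)
    ultimately show ?thesis using up low by simp
  qed simp
  then show "1 / 4 * norm (u - v) powr (1 + 1/2) \<le> norm (f u - f v)"
    "norm (f u - f v) \<le> 10 * norm (u - v) powr (1 - 1/2)" by auto
qed

lemma f_far:
  assumes u: "u \<in> P0" and v: "v \<in> P0" and uv: "norm (u - v) > 1"
  shows "norm (f u - f v) \<ge> 1/2"
proof -
  have "f_seq \<sigma> 0 u = u" "f_seq \<sigma> 0 v = v" by auto
  then have n: "norm (f u - u) \<le> 24 * \<delta>" "norm (f v - v) \<le> 24 * \<delta>"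
    using f_dist[OF u, of 0] f_dist[OF v, of 0] by simp_all
  have "norm (u - v) \<le> norm (f u - f v) + norm (f u - u) + norm (f v - v)"
    using norm_triangle_ineq4[of "f u - f v" "(f u - u) - (f v - v)"] norm_triangle_ineq4[of "f u - u" "f v - v"] by simp
  then show ?thesis using n uv delta24(2) by linarith
qed

lemma f_inj: "inj_on f P0"
proof (rule inj_onI, rule ccontr)
  fix u v assume uv: "u \<in> P0" "v \<in> P0" "f u = f v" "u \<noteq> v"
  show False
  proof (cases "norm (u - v) \<le> 1")
    case True
    then show False using bi_hoelder(1)[OF uv(1,2)] uv(3,4) by simp
  next
    case False
    then show False using f_far[OF uv(1,2)] uv(3) by simp
  qed
qed

section \<open>Closedness and limit points of the centres\<close>

lemma closed_limit_surface: "closed \<Sigma>"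
  unfolding closed_sequential_limits
proof (intro allI impI)
  fix y l assume y: "(\<forall>n. y n \<in> \<Sigma>) \<and> y \<longlonglongrightarrow> l"
  then have "\<forall>n. \<exists>u. u \<in> P0 \<and> y n = f u" by blast
  from choice[OF this] obtain u where u: "\<And>n. u n \<in> P0" "\<And>n. y n = f (u n)" by blast
  have "Cauchy u"
    unfolding Cauchy_def
  proof (intro allI impI)
    fix e :: real assume e: "e > 0"
    \<comment> \<open>The bound 1/2 excludes pairs at distance more than 1 by \<open>f_far\<close>;
      for the others the lower Hoelder bound applies.\<close>
    define e' where "e' = min (1/2) (1/4 * e powr (1 + 1/2))"
    have "e' > 0" using e by (simp add: e'_def)
    moreover have "Cauchy y" using y LIMSEQ_imp_Cauchy by blast
    ultimately obtain N where N: "\<And>m n. m \<ge> N \<Longrightarrow> n \<ge> N \<Longrightarrow> dist (y m) (y n) < e'"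
      unfolding Cauchy_def by blast
    show "\<exists>M. \<forall>m\<ge>M. \<forall>n\<ge>M. dist (u m) (u n) < e"
    proof (intro exI allI impI)
      fix m n assume mn: "m \<ge> N" "n \<ge> N"
      have d: "norm (f (u m) - f (u n)) < e'" using N[OF mn] u(2) by (simp add: dist_norm)
      have "norm (u m - u n) \<le> 1"
        using f_far[OF u(1) u(1), of m n] d by (force simp: e'_def)
      from bi_hoelder(1)[OF u(1) u(1) this]
      have "1/4 * norm (u m - u n) powr (1 + 1/2) < 1/4 * e powr (1 + 1/2)" using d by (simp add: e'_def)
      then have lt: "norm (u m - u n) powr (1 + 1/2) < e powr (1 + 1/2)" by simp
      show "dist (u m) (u n) < e"
      proof (rule ccontr)
        assume "\<not> dist (u m) (u n) < e"
        then have "e \<le> norm (u m - u n)" by (simp add: dist_norm)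
        then have "e powr (1 + 1/2) \<le> norm (u m - u n) powr (1 + 1/2)" using e by (intro powr_mono2) auto
        then show False using lt by simp
      qed
    qed
  qed
  moreover have "complete P0" using closed_plane[OF plane0] complete_eq_closed by blast
  ultimately obtain u0 where u0: "u0 \<in> P0" "u \<longlonglongrightarrow> u0" unfolding complete_def using u(1) by blast
  have "continuous_on P0 f" using FF_continuous[of 0] by (simp add: FF_0)
  then have "(\<lambda>n. f (u n)) \<longlonglongrightarrow> f u0"
    using continuous_on_tendsto_compose[OF _ u0(2) u0(1)] u(1) by simp
  moreover have "y = (\<lambda>n. f (u n))" using u(2) by auto
  ultimately have "l = f u0" using y LIMSEQ_unique by blast
  then show "l \<in> \<Sigma>" using u0(1) by blast
qed

lemma infdist_limit_surface: "y \<in> S k \<Longrightarrow> infdist y \<Sigma> \<le> 24 * \<delta> * rad k"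
proof -
  assume y: "y \<in> S k"
  have "FF k y \<in> \<Sigma>" using FF_image y by blast
  from infdist_le[OF this, of y] show ?thesis using FF_dist_0[OF y] by (simp add: dist_norm norm_minus_commute)
qed

text \<open>A centre lies in its own plane, so the point of \<open>S k\<close> above it is at
  distance at most \<open>\<delta> * rad k\<close>, and from there \<Sigma> is at distance at most
  \<open>24 * \<delta> * rad k\<close>. Limit points of centres at growing scales thus have distance
  0 from the closed set \<Sigma>.\<close>

lemma centres_limit_subset: "(\<Inter>K\<in>{1..}. closure (\<Union>k\<in>{K..}. x k ` J k)) \<subseteq> \<Sigma>"
proof
  fix z assume z: "z \<in> (\<Inter>K\<in>{1..}. closure (\<Union>k\<in>{K..}. x k ` J k))"
  have ne: "\<Sigma> \<noteq> {}" using plane_proj_in[OF plane0] by blast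
  have c: "infdist (x k j) \<Sigma> \<le> rad k" if j: "j \<in> J k" for k j
  proof -
    obtain A where A: "adapted k j A" using adapted_exists[OF j] by blast
    let ?p = "x k j + A (x k j)"
    have p: "?p \<in> S k" by (rule graph_in_surf(1)[OF j A centre[OF j]]) simp
    have "infdist (x k j) \<Sigma> \<le> dist (x k j) ?p + infdist ?p \<Sigma>"
      using infdist_triangle[of "x k j" \<Sigma> ?p] by simp
    also have "\<dots> \<le> \<delta> * rad k + 24 * \<delta> * rad k"
    proof (rule add_mono)
      show "dist (x k j) ?p \<le> \<delta> * rad k" using adapted_centre[OF j A] by (simp add: dist_norm)
    qed (rule infdist_limit_surface[OF p])
    also have "\<dots> = 25 * \<delta> * rad k" by simp
    also have "\<dots> \<le> 1 * rad k" using small_bounds(5) by (intro mult_right_mono) auto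
    finally show ?thesis by simp
  qed
  have "infdist z \<Sigma> \<le> e" if e: "e > 0" for e
  proof -
    obtain n0 where n0: "\<And>n. n \<ge> n0 \<Longrightarrow> norm (rad n - 0) < e / 2"
      using LIMSEQ_D[OF rad_tendsto_0, of "e / 2"] e by auto
    have "z \<in> closure (\<Union>k\<in>{max 1 n0..}. x k ` J k)" using z by auto
    then have "\<exists>p\<in>(\<Union>k\<in>{max 1 n0..}. x k ` J k). dist p z < e / 2"
      unfolding closure_approachable using e half_gt_zero by blast
    then obtain k j where kj: "k \<ge> n0" "j \<in> J k" "dist (x k j) z < e / 2" by auto
    have "infdist z \<Sigma> \<le> dist z (x k j) + infdist (x k j) \<Sigma>"
      using infdist_triangle[of z \<Sigma> "x k j"] by simp
    then show ?thesis using c[OF kj(2)] n0[OF kj(1)] kj(3) by (simp add: dist_commute)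
  qed
  then have "infdist z \<Sigma> \<le> 0" by (meson dense_ge)
  then have "infdist z \<Sigma> = 0" using infdist_nonneg[of z \<Sigma>] by linarith
  then show "z \<in> \<Sigma>" using in_closed_iff_infdist_zero[OF closed_limit_surface ne] by blast
qed

section \<open>The surface in cylinders\<close>

lemma near_initial_point:
  assumes j: "j \<in> J 0" and z: "z \<in> P0" "norm (z - x 0 j) \<le> 100"
  shows "norm (z - \<pi> 0 j z) \<le> 100 * \<epsilon>"
proof -
  have b: "ball_dist (x 0 j) 100 (P 0 j) P0 \<le> \<epsilon>" using collection j unfolding ccbp_def by auto
  have "norm (plane_proj P0 (x 0 j) - x 0 j) \<le> 100 / 2"
    using near_initial(2)[OF j] small_bounds(7) by simp
  then show ?thesis
    using plane_near(5)[OF nontrivial plane[OF j] plane0 _ b centre[OF j] _ plane_proj_in[OF plane0, of "x 0 j"], of z] z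
    by simp
qed

text \<open>In the cylinder one only knows a priori that the point has distance at most \<open>98 r\<^sub>k\<close> from the centre;
  the previous scale shows that it is close to the plane.\<close>

lemma surf_near_plane:
  assumes j: "j \<in> J k" and y: "y \<in> S k" and n: "norm (y - x k j) \<le> 98 * rad k"
  shows "norm (y - \<pi> k j y) \<le> rad k / 2"
proof (cases k)
  case 0
  have "norm (y - \<pi> 0 j y) \<le> 100 * \<epsilon>"
    using near_initial_point[of j y] assms 0 by simp
  then show ?thesis using small_bounds(7) 0 by simp
next
  case (Suc l)
  let ?r = "rad l"
  have r: "rad k = ?r / 10" by (simp add: Suc rad_Suc)
  obtain i where i: "i \<in> J l" "norm (x k j - x l i) \<le> 2 * ?r" using parent j Suc by blast
  obtain y' where y': "y' \<in> S l" "y = \<sigma> l y'" using y Suc by auto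
  obtain A where A: "adapted l i A" using adapted_exists[OF i(1)] by blast
  have d: "norm (y - y') \<le> ?r / 100" using displacement_small[OF y'(1)] y'(2) by simp
  have "norm (y' - x l i) \<le> norm (y - y') + norm (y - x k j) + norm (x k j - x l i)"
    using norm_triangle_ineq4[of "y - x l i" "y - y'"] norm_triangle_ineq[of "y - x k j" "x k j - x l i"] by simp
  \<comment> \<open>In units of the coarser radius \<open>?r\<close> this is 9.8 for the distance to
    the centre, 2 for the parent and 1/100 for the displacement.\<close>
  then have n': "norm (y' - x l i) \<le> 12 * ?r" using d i(2) n rad_pos[of l] unfolding r by linarith
  note p = surf_point[OF i(1) A y'(1) rad_scale[OF n'], simplified]
  let ?q = "\<pi> l i y'"
  have q12: "norm (?q - x l i) \<le> 12 * ?r" using p(3) n' by linarith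
  have 1: "norm (?q - \<pi> k j ?q) \<le> 20 * ?r * \<epsilon>"
    using near_next_scale(3)[OF i(1), of j ?q] j i(2) p(1) rad_scale[OF q12, of 20] Suc by simp
  have 2: "norm (A ?q) \<le> ?r / 100" by (rule adapted_norm_le(2)[OF i(1) A rad_scale[OF q12]]) simp
  have "y' - ?q = A ?q" using p(2) by (metis add_diff_cancel_left')
  then have 3: "norm (y' - ?q) \<le> ?r / 100" using 2 by simp
  have "norm (y - \<pi> k j y) \<le> norm (y - \<pi> k j ?q)"
    by (rule plane_proj_closest[OF plane[OF j] plane_proj_in[OF plane[OF j]]])
  also have "\<dots> \<le> norm (y - y') + norm (y' - ?q) + norm (?q - \<pi> k j ?q)"
    using norm_triangle_ineq[of "y - y'" "y' - \<pi> k j ?q"] norm_triangle_ineq[of "y' - ?q" "?q - \<pi> k j ?q"] by simp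
  also have "\<dots> \<le> ?r / 100 + ?r / 100 + 20 * ?r * \<epsilon>" using d 3 1 by linarith
  also have "20 * ?r * \<epsilon> \<le> 20 * ?r * (1 / 2000)" using small_bounds(7) by (intro mult_left_mono) auto
  finally show ?thesis unfolding r using rad_pos[of l] by linarith
qed

lemma cylinder_point:
  assumes j: "j \<in> J k" and y: "y \<in> cylinder (x k j) (P k j) (49 * rad k)"
  shows "norm (\<pi> k j y - x k j) \<le> 49 * rad k" "norm (y - \<pi> k j y) \<le> 49 * rad k" "\<pi> k j y \<in> P k j"
proof -
  obtain z w where zw: "y = z + w" "z \<in> P k j \<inter> cball (x k j) (49 * rad k)" "w \<in> perp (P k j) \<inter> cball 0 (49 * rad k)"
    using y unfolding cylinder_def by blast
  have "\<pi> k j y = z" unfolding zw(1) by (rule plane_proj_eq[OF plane[OF j]]) (use zw in auto)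
  then show "norm (\<pi> k j y - x k j) \<le> 49 * rad k" "norm (y - \<pi> k j y) \<le> 49 * rad k" "\<pi> k j y \<in> P k j"
    using zw by (auto simp: dist_norm norm_minus_commute)
qed

lemma graph_in_cylinder:
  assumes j: "j \<in> J k"
  shows "\<exists>A. A ` (P k j \<inter> cball (x k j) (49 * rad k)) \<subseteq> perp (P k j) \<and>
           (\<exists>L. L-lipschitz_on (P k j \<inter> cball (x k j) (49 * rad k)) A) \<and>
           norm (A (x k j)) \<le> \<delta> * rad k \<and>
           (\<forall>y\<in>P k j \<inter> cball (x k j) (49 * rad k). \<exists>DA.
              (A has_derivative DA) (at y within P k j \<inter> cball (x k j) (49 * rad k)) \<and>
              (\<forall>v\<in>directions (P k j). norm (DA v) \<le> \<delta> * norm v)) \<and>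
           S k \<inter> cylinder (x k j) (P k j) (49 * rad k) =
             graph_over (P k j \<inter> cball (x k j) (49 * rad k)) A \<inter>
             cylinder (x k j) (P k j) (49 * rad k)"
proof -
  obtain A where A: "adapted k j A" using adapted_exists[OF j] by blast
  let ?U = "P k j \<inter> cball (x k j) (49 * rad k)" and ?D = "cylinder (x k j) (P k j) (49 * rad k)"
  note c = c2_c1[OF adapted_c2[OF j A]]
  have "\<delta>-lipschitz_on ?U A"
    using c1_lipschitz[OF c convex_UNIV adapted_D1[OF j A]] small_bounds(9)
    by (auto simp: lipschitz_on_def dist_norm)
  moreover have "\<exists>DA. (A has_derivative DA) (at y within ?U) \<and> (\<forall>v\<in>directions (P k j). norm (DA v) \<le> \<delta> * norm v)"
    for y
  proof (intro exI conjI ballI)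
    show "(A has_derivative D1 A y) (at y within ?U)"
      using c1_has_derivative[OF c] has_derivative_at_withinI by blast
    show "norm (D1 A y v) \<le> \<delta> * norm v" for v
      using norm_blinfun[of "D1 A y" v] mult_right_mono[OF adapted_D1[OF j A, of y], of "norm v"] by simp
  qed
  moreover have "S k \<inter> ?D = graph_over ?U A \<inter> ?D"
  proof (intro equalityI subsetI)
    fix y assume y: "y \<in> S k \<inter> ?D"
    note z = cylinder_point[OF j, of y]
    have "norm (y - x k j) \<le> norm (y - \<pi> k j y) + norm (\<pi> k j y - x k j)"
      using norm_triangle_ineq[of "y - \<pi> k j y" "\<pi> k j y - x k j"] by simp
    moreover have "norm (\<pi> k j y - x k j) \<le> 49 * rad k" "norm (y - \<pi> k j y) \<le> 49 * rad k" using z y by auto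
    \<comment> \<open>Both legs of the cylinder give 98; once \<open>surf_near_plane\<close> has
      reduced the normal leg to 1/2, the point is in the ball of radius factor 50 where the graph is
      known.\<close>
    ultimately have 98: "norm (y - x k j) \<le> 98 * rad k"
      and 50: "norm (y - \<pi> k j y) \<le> rad k / 2 \<Longrightarrow> norm (y - x k j) \<le> 50 * rad k"
      using rad_pos[of k] by linarith+
    have "norm (y - x k j) \<le> 50 * rad k" using 50 surf_near_plane[OF j _ 98] y by blast
    from surf_point(1,2)[OF j A _ this] show "y \<in> graph_over ?U A \<inter> ?D"
      using y z by (auto simp: graph_over_def dist_norm norm_minus_commute intro!: exI[of _ "\<pi> k j y"])
  next
    fix y assume y: "y \<in> graph_over ?U A \<inter> ?D"
    then obtain q where q: "q \<in> P k j" "norm (q - x k j) \<le> 49 * rad k" "y = q + A q"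
      by (auto simp: graph_over_def dist_norm norm_minus_commute)
    have "norm (A q) \<le> \<delta> * (rad k + 49 * rad k)"
      by (rule order_trans[OF adapted_norm[OF j A]], intro mult_left_mono add_left_mono q) (use small_bounds(9) in auto)
    also have "\<dots> = 50 * \<delta> * rad k" by simp
    also have "\<dots> \<le> 1 * rad k" using small_bounds(5) by (intro mult_right_mono) auto
    finally have "norm (y - x k j) \<le> 50 * rad k"
      using norm_triangle_ineq[of "q - x k j" "A q"] q(2) unfolding q(3) by (simp add: algebra_simps)
    then have "y \<in> graph_over (P k j) A \<inter> cball (x k j) (50 * rad k)"
      using q by (auto simp: graph_over_def dist_norm norm_minus_commute)
    then show "y \<in> S k \<inter> ?D" unfolding adapted_surf[OF j A, symmetric] using y by simp
  qed
  ultimately show ?thesis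
    using adapted_perp[OF j A] adapted_centre[OF j A] by (intro exI[of _ A]) auto
qed

section \<open>Reifenberg flatness\<close>

lemma local_graphD:
  assumes "local_graph k y Q A"
  shows "is_plane d Q" "y \<in> Q" "c2 A" "A q \<in> perp Q" "norm (D1 A q) \<le> \<gamma>" "norm (D2 A q) \<le> \<gamma> / rad k"
    "S k \<inter> cball y (19 * rad k) = graph_over Q A \<inter> cball y (19 * rad k)"
    "norm (A q - A q') \<le> \<gamma> * norm (q - q')" "y \<in> S k \<Longrightarrow> A y = 0"
proof -
  show *: "is_plane d Q" "y \<in> Q" "c2 A" "A q \<in> perp Q" "norm (D1 A q) \<le> \<gamma>" "norm (D2 A q) \<le> \<gamma> / rad k"
    "S k \<inter> cball y (19 * rad k) = graph_over Q A \<inter> cball y (19 * rad k)" for q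
    using assms unfolding local_graph_def by auto
  show "norm (A q - A q') \<le> \<gamma> * norm (q - q')"
    by (rule c1_lipschitz[OF c2_c1[OF *(3)] convex_UNIV *(5)]) auto
  show "A y = 0" if "y \<in> S k"
  proof -
    have "y \<in> S k \<inter> cball y (19 * rad k)" using that by simp
    then have "y \<in> graph_over Q A" unfolding *(7) by simp
    from graph_point[OF *(1) *(4) this] show ?thesis using plane_proj_id[OF *(1,2)] by simp
  qed
qed

lemma rad_scale_exists:
  assumes t: "0 < t" "t < 1"
  shows "\<exists>k. rad k / 10 \<le> t \<and> t < rad k"
proof -
  obtain n where "norm (rad n - 0) < t" using LIMSEQ_D[OF rad_tendsto_0 t(1)] by blast
  then have "\<exists>n. rad n \<le> t" by (intro exI[of _ n]) simp
  then obtain n where n: "rad n \<le> t" "\<And>l. l < n \<Longrightarrow> \<not> rad l \<le> t"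
    using exists_least_iff[of "\<lambda>n. rad n \<le> t"] by blast
  then have "n \<noteq> 0" using t by (auto intro: ccontr)
  then obtain k where "n = Suc k" using not0_implies_Suc by blast
  then show ?thesis using n(1) n(2)[of k] unfolding rad_Suc[symmetric] by auto
qed

text \<open>At the scale with \<open>rad k / 10 \<le> t < rad k\<close> the plane of the local graph
  at the k-th iterate works: \<Sigma> deviates from \<open>S k\<close>, and \<open>S k\<close> from
  the plane, by at most \<open>2 * \<gamma> * rad k\<close> together, hence by
  \<open>20 * \<gamma> * t\<close>.\<close>

lemma reifenberg_flat:
  assumes z: "z \<in> \<Sigma>" and t: "0 < t" "t < 1"
  shows "\<exists>Q. is_plane d Q \<and> ball_dist z t \<Sigma> Q \<le> 20 * \<gamma>"
proof -
  obtain k where k: "rad k / 10 \<le> t" "t < rad k" using rad_scale_exists[OF t] by auto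
  let ?r = "rad k"
  obtain u where u: "u \<in> P0" "z = f u" using z by blast
  let ?y = "f_seq \<sigma> k u"
  have y: "?y \<in> S k" by (rule f_seq_surf[OF u(1)])
  obtain Q A where lg: "local_graph k ?y Q A" using local_graph_exists[OF y] by blast
  note l = local_graphD[OF lg]
  have d24: "24 * \<delta> * ?r \<le> \<gamma> * ?r" using delta24(1) \<gamma>_pos by (intro mult_right_mono) auto
  have zy: "norm (z - ?y) \<le> \<gamma> * ?r" using f_dist[OF u(1), of k] d24 unfolding u(2) by linarith
  have gr: "\<gamma> * ?r \<le> ?r / 100" using mult_right_mono[OF \<gamma>_small(2), of ?r] rad_pos[of k] by simp
  have "ball_dist z t \<Sigma> Q \<le> 20 * \<gamma>"
  proof (rule ball_dist_le[OF nontrivial t(1)])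
    have g2: "2 * (\<gamma> * ?r) \<le> t * (20 * \<gamma>)" using mult_left_mono[OF k(1), of "20 * \<gamma>"] \<gamma>_pos by (simp add: mult_ac)
    show "0 \<le> 20 * \<gamma>" using \<gamma>_pos by simp
    fix p assume p: "p \<in> Q" "norm (p - z) \<le> t"
    have "norm (p - ?y) \<le> norm (p - z) + norm (z - ?y)"
      using norm_triangle_ineq[of "p - z" "z - ?y"] by simp
    then have py: "norm (p - ?y) \<le> (11/10) * ?r" using p(2) zy gr k(2) rad_pos[of k] by linarith
    have Ap: "norm (A p) \<le> \<gamma> * norm (p - ?y)" using l(8)[of p ?y] l(9)[OF y] by simp
    have A1: "\<gamma> * norm (p - ?y) \<le> \<gamma> * ((11/10) * ?r)" using py \<gamma>_pos by (intro mult_left_mono) auto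
    have e: "\<gamma> * ((11/10) * ?r) = (11/10) * (\<gamma> * ?r)" by simp
    have Apr: "norm (A p) \<le> ?r" using Ap A1 gr rad_pos[of k] unfolding e by linarith
    have "norm (p + A p - ?y) \<le> 19 * ?r"
    proof -
      have "norm (p + A p - ?y) \<le> norm (p - ?y) + norm (A p)"
        using norm_triangle_ineq[of "p - ?y" "A p"] by (simp add: algebra_simps)
      then show ?thesis using Apr py rad_pos[of k] by linarith
    qed
    then have "p + A p \<in> graph_over Q A \<inter> cball ?y (19 * ?r)"
      using p(1) by (auto simp: graph_over_def dist_norm norm_minus_commute)
    then have pS: "p + A p \<in> S k" unfolding l(7)[symmetric] by simp
    have "infdist p \<Sigma> \<le> dist p (p + A p) + infdist (p + A p) \<Sigma>"
      using infdist_triangle[of p \<Sigma> "p + A p"] by simp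
    also have "\<dots> \<le> \<gamma> * ((11/10) * ?r) + 24 * \<delta> * ?r"
      using Ap A1 infdist_limit_surface[OF pS] by (intro add_mono) (auto simp: dist_norm)
    also have "24 * \<delta> * ?r \<le> (9/10) * (\<gamma> * ?r)"
    proof -
      have "24 * \<delta> * ?r \<le> (9/10) * \<gamma> * ?r" using delta24(1) \<gamma>_pos by (intro mult_right_mono) auto
      then show ?thesis by simp
    qed
    finally show "infdist p \<Sigma> \<le> t * (20 * \<gamma>)" using g2 by simp
  next
    have g2: "2 * (\<gamma> * ?r) \<le> t * (20 * \<gamma>)" using mult_left_mono[OF k(1), of "20 * \<gamma>"] \<gamma>_pos by (simp add: mult_ac)
    fix p assume p: "p \<in> \<Sigma>" "norm (p - z) \<le> t"
    obtain v where v: "v \<in> P0" "p = f v" using p(1) by blast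
    let ?v = "f_seq \<sigma> k v"
    have vS: "?v \<in> S k" by (rule f_seq_surf[OF v(1)])
    have pv: "norm (p - ?v) \<le> 24 * \<delta> * ?r" using f_dist[OF v(1), of k] v(2) by simp
    have "norm (?v - ?y) \<le> norm (p - ?v) + norm (p - z) + norm (z - ?y)"
      using norm_triangle_ineq4[of "p - ?y" "p - ?v"] norm_triangle_ineq[of "p - z" "z - ?y"] by simp
    then have vy: "norm (?v - ?y) \<le> (11/10) * ?r" using p(2) zy gr k(2) pv d24 rad_pos[of k] by linarith
    then have "norm (?v - ?y) \<le> 19 * ?r" by (rule order_trans) simp
    then have "?v \<in> S k \<inter> cball ?y (19 * ?r)" using vS by (simp add: dist_norm norm_minus_commute)
    then have vg: "?v \<in> graph_over Q A" unfolding l(7) by simp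
    note gp = graph_point[OF l(1) l(4) vg]
    let ?q = "plane_proj Q ?v"
    have "norm (?q - ?y) \<le> (11/10) * ?r"
      using dist_plane_proj_le[OF l(1), of ?v ?y] plane_proj_id[OF l(1,2)] vy by simp
    then have "\<gamma> * norm (?q - ?y) \<le> \<gamma> * ((11/10) * ?r)" using \<gamma>_pos by (intro mult_left_mono) auto
    then have Aq: "norm (A ?q) \<le> \<gamma> * ((11/10) * ?r)" using l(8)[of ?q ?y] l(9)[OF y] by simp
    have "?v - ?q = A ?q" using gp by (metis add_diff_cancel_left')
    then have vq: "norm (?v - ?q) \<le> \<gamma> * ((11/10) * ?r)" using Aq by simp
    have "infdist p Q \<le> norm (p - ?q)" using infdist_le[OF plane_proj_in[OF l(1)]] by (simp add: dist_norm)
    also have "\<dots> \<le> norm (p - ?v) + norm (?v - ?q)" using norm_triangle_ineq[of "p - ?v" "?v - ?q"] by simp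
    also have "\<dots> \<le> (9/10) * (\<gamma> * ?r) + \<gamma> * ((11/10) * ?r)"
    proof (intro add_mono vq)
      have "24 * \<delta> * ?r \<le> (9/10) * \<gamma> * ?r" using delta24(1) \<gamma>_pos by (intro mult_right_mono) auto
      then show "norm (p - ?v) \<le> (9/10) * (\<gamma> * ?r)" using pv by linarith
    qed
    finally show "infdist p Q \<le> t * (20 * \<gamma>)" using g2 by simp
  qed
  then show ?thesis using l(1) by blast
qed

section \<open>Comparison with a single projection\<close>

lemma eps_at_upper:
  assumes l: "l \<in> J k" and i: "i \<in> J k" and y: "norm (y - x k l) \<le> 100 * rad k" "norm (y - x k i) \<le> 100 * rad k"
  shows "ball_dist (x k i) (10 ^ 4 * rad k) (P k l) (P k i) \<le> eps_at J x P k y"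
  unfolding eps_at_def
proof (rule cSup_upper)
  let ?A = "{ball_dist (x l i) (10 ^ 4 * rad l) (P k j) (P l i) | j l i.
        j \<in> J k \<and> \<bar>int l - int k\<bar> \<le> 2 \<and> i \<in> J l \<and> y \<in> cball (x k j) (100 * rad k) \<inter> cball (x l i) (100 * rad l)}"
  show "ball_dist (x k i) (10 ^ 4 * rad k) (P k l) (P k i) \<in> insert 0 ?A"
    using assms by (intro insertI2 CollectI exI[of _ l] exI[of _ k] exI[of _ i])
      (auto simp: dist_norm norm_minus_commute)
  \<comment> \<open>A supremum of reals dominates its members only if the set is bounded. As
    \<open>l \<le> k + 2\<close> gives \<open>rad k \<le> 100 * rad l\<close>, all distances
    involved are at most \<open>(10000 + 100 + 10000) * rad l\<close>.\<close>
  have "b \<le> 3" if "b \<in> ?A" for b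
  proof -
    obtain j l i where b: "b = ball_dist (x l i) (10 ^ 4 * rad l) (P k j) (P l i)" "j \<in> J k" "\<bar>int l - int k\<bar> \<le> 2"
      "i \<in> J l" "norm (y - x k j) \<le> 100 * rad k" "norm (y - x l i) \<le> 100 * rad l"
      using \<open>b \<in> ?A\<close> by (auto simp: dist_norm norm_minus_commute)
    have "l \<le> k + 2" using b(3) by linarith
    then have "rad (k + 2) \<le> rad l" by (rule rad_antimono)
    then have kl: "rad k \<le> 100 * rad l" by (simp add: rad_Suc numeral_2_eq_2)
    show ?thesis
      unfolding b(1)
    proof (rule ball_dist_le[OF nontrivial])
      let ?R = "10 ^ 4 * rad l"
      show "0 < ?R" by simp
      have R: "?R = 10000 * rad l" by simp
      fix p
      show "infdist p (P l i) \<le> ?R * 3" if "norm (p - x l i) \<le> ?R"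
      proof -
        have "infdist p (P l i) \<le> norm (p - x l i)" using infdist_le[OF centre[OF b(4)], of p] by (simp add: dist_norm)
        then show ?thesis using that rad_pos[of l] unfolding R by linarith
      qed
      show "infdist p (P k j) \<le> ?R * 3" if "norm (p - x l i) \<le> ?R"
      proof -
        have "infdist p (P k j) \<le> norm (p - x k j)" using infdist_le[OF centre[OF b(2)], of p] by (simp add: dist_norm)
        also have "\<dots> \<le> norm (p - x l i) + norm (y - x l i) + norm (y - x k j)"
          using norm_triangle_ineq[of "p - x l i" "x l i - x k j"] norm_triangle_ineq4[of "y - x k j" "y - x l i"] by simp
        also have "\<dots> \<le> ?R + 100 * rad l + 100 * rad k" using that b by linarith
        finally show ?thesis using kl rad_pos[of l] unfolding R by linarith
      qed
    qed simp
  qed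
  then have "bdd_above ?A" by (rule bdd_aboveI)
  then show "bdd_above (insert 0 ?A)" by simp
qed

text \<open>Where the bumps add up to 1, the difference is exactly \<open>G\<close>, an average of
  differences of projections with weights \<open>\<theta> k l y\<close>. Comparing the planes at
  radius \<open>10 ^ 4 * rad k\<close> gives \<open>5 * 10 ^ 4 + 8 * 10\<close>, less than
  60000.\<close>

lemma sigma_near_projection:
  assumes y: "y \<in> V_set J x k 8" and i: "i \<in> J k" and yi: "norm (y - x k i) \<le> 10 * rad k"
  shows "norm (\<sigma> k y - \<pi> k i y) \<le> 60000 * eps_at J x P k y * rad k"
proof -
  let ?e = "eps_at J x P k y" and ?B = "60000 * eps_at J x P k y * rad k"
  have y30: "norm (y - x k i) \<le> 30 * rad k" using yi by (rule rad_scale) simp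
  have "(\<Sum>\<^sub>\<infinity>j\<in>J k. \<theta> k j y) = 1" using family y unfolding partition_family_def by blast
  then have s1: "s k i y = 1"
    unfolding s_def using infsum_eq_finite_sum[OF finite_F[OF i], of "J k" "\<lambda>j. \<theta> k j y"] F_active[OF y30]
    by (auto simp: F_def)
  have B: "norm (\<pi> k l y - \<pi> k i y) \<le> ?B" if l: "l \<in> F k i" and a: "\<theta> k l y \<noteq> 0" for l
  proof -
    have lJ: "l \<in> J k" and li: "norm (x k l - x k i) \<le> 40 * rad k" using l by (auto simp: F_def)
    have yl: "norm (y - x k l) \<le> 100 * rad k" using bump(3)[OF lJ a] by (rule rad_scale) simp
    have b: "ball_dist (x k i) (10 ^ 4 * rad k) (P k l) (P k i) \<le> ?e"
      by (rule eps_at_upper[OF lJ i yl rad_scale[OF yi]]) simp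
    have r: "0 < 10 ^ 4 * rad k" by simp
    note pn = plane_near[OF nontrivial plane[OF lJ] plane[OF i] r b centre[OF lJ] _ centre[OF i]]
    have n: "norm (x k l - x k i) \<le> 10 ^ 4 * rad k / 2" using rad_scale[OF li, of 5000] by simp
    have "norm (\<pi> k l y - \<pi> k i y) \<le> ?e * (5 * (10 ^ 4 * rad k) + 8 * norm (y - x k i))"
      by (rule pn(2)[OF n]) simp
    also have "\<dots> \<le> ?e * (5 * (10 ^ 4 * rad k) + 8 * (10 * rad k))"
      using pn(3)[OF n] yi by (intro mult_left_mono add_left_mono) auto
    also have "\<dots> \<le> ?B" using pn(3)[OF n] by (simp add: mult_ac)
    finally show ?thesis .
  qed
  have e0: "0 \<le> ?e"
    using infdist_le_ball_dist(3)[OF nontrivial, of "10 ^ 4 * rad k" "P k i" "P k i" "x k i"]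
      eps_at_upper[OF i i rad_scale[OF yi] rad_scale[OF yi]] centre[OF i] by fastforce
  have "\<sigma> k y - \<pi> k i y = G k i y" using sigma_eq[OF i y30] s1 by simp
  also have "norm \<dots> \<le> (\<Sum>l\<in>F k i. \<theta> k l y * ?B)"
    unfolding G_def
  proof (rule order_trans[OF norm_sum], rule sum_mono)
    fix l assume l: "l \<in> F k i"
    have t: "0 \<le> \<theta> k l y" using l bump(1) by (auto simp: F_def)
    show "norm (\<theta> k l y *\<^sub>R (\<pi> k l y - \<pi> k i y)) \<le> \<theta> k l y * ?B"
      using B[OF l] t by (cases "\<theta> k l y = 0") (auto intro!: mult_left_mono)
  qed
  also have "\<dots> = s k i y * ?B" by (simp add: s_def sum_distrib_right)
  finally show ?thesis using s1 by simp
qed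

subsection \<open>Tangent planes\<close>

abbreviation "TS k y \<equiv> tangent_space (S k) y"

lemma tangent_plane:
  assumes y: "y \<in> S k"
  shows "is_plane d (TS k y)" "0 \<in> TS k y" "directions (TS k y) = TS k y"
proof -
  obtain Q A where lg: "local_graph k y Q A" using local_graph_exists[OF y] by blast
  note l = local_graphD[OF lg]
  have t: "TS k y = (\<lambda>v. v + D1 A (plane_proj Q y) v) ` directions Q"
    by (rule tangent_space_graph[OF l(1,3,4,7) y]) simp
  note p = D1_in_perp[OF l(1,3,4)]
  show "is_plane d (TS k y)" "0 \<in> TS k y" "directions (TS k y) = TS k y"
    unfolding t by (rule graph_tangent_plane[OF l(1) p])+
qed

text \<open>Both points lie in the graph around \<open>y\<close>, whose second derivative bound
  makes \<open>D1 A\<close> Lipschitz with constant \<open>\<gamma> / rad k\<close>.\<close>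

lemma tangent_planes_close:
  assumes y: "y \<in> S k" and z: "z \<in> S k" and yz: "norm (y - z) \<le> 10 * rad k"
  shows "norm (Dp (TS k y) - Dp (TS k z)) \<le> 2 * (\<gamma> * (norm (y - z) / rad k))"
proof -
  obtain Q A where lg: "local_graph k y Q A" using local_graph_exists[OF y] by blast
  note l = local_graphD[OF lg]
  have t: "TS k w = (\<lambda>v. v + D1 A (plane_proj Q w) v) ` directions Q" if "w \<in> S k" "norm (w - y) < 19 * rad k" for w
    by (rule tangent_space_graph[OF l(1,3,4,7) that])
  have zy: "norm (z - y) < 19 * rad k"
    using yz rad_pos[of k] unfolding norm_minus_commute[of z] by linarith
  note p = D1_in_perp[OF l(1,3,4)]
  let ?q = "plane_proj Q y" and ?q' = "plane_proj Q z"
  have "norm (D1 A ?q - D1 A ?q') \<le> \<gamma> / rad k * norm (?q - ?q')"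
    by (rule c1_lipschitz[OF c2_D1[OF l(3)] convex_UNIV l(6)]) auto
  also have "\<dots> \<le> \<gamma> / rad k * norm (y - z)"
    using dist_plane_proj_le[OF l(1), of y z] \<gamma>_pos by (intro mult_left_mono) auto
  finally have "norm (D1 A ?q - D1 A ?q') \<le> \<gamma> * (norm (y - z) / rad k)" by simp
  from graph_tangent_planes_dist[OF l(1) p p this] show ?thesis
    using t[OF y] t[OF z zy] by simp
qed

lemma sigma_differentiable: "\<sigma> k differentiable (at y)"
proof (cases "\<exists>i\<in>J k. norm (y - x k i) \<le> 12 * rad k")
  case True
  then obtain i where i: "i \<in> J k" "norm (y - x k i) \<le> 12 * rad k" by blast
  let ?g = "\<lambda>y. (y + G k i y) + s k i y *\<^sub>R (plane_proj (P k i) y - y)"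
  have c: "c2 (\<lambda>y. (Dp (P k i) - id_blinfun) y + \<pi> k i 0)" by (rule c2_lin(1))
  have e: "(\<lambda>y. (Dp (P k i) - id_blinfun) y + \<pi> k i 0) = (\<lambda>y. plane_proj (P k i) y - y)"
    by (subst (2) plane_proj_affine[OF plane[OF i(1)]]) (auto simp: blinfun.diff_left algebra_simps)
  have c': "c2 (\<lambda>y. y + G k i y)"
    using c2_add(1)[OF c2_lin(1)[of "id_blinfun :: 'a \<Rightarrow>\<^sub>L 'a" 0] G_c2(1)[OF i(1)]] by simp
  have "c2 ?g"
    by (rule c2_add(1)[OF c' c2_scaleR(1)[OF s_c2(1)[OF i(1)] c[unfolded e]]])
  then have "?g differentiable (at y)" by (simp add: c2_def)
  moreover have "open (ball (x k i) (20 * rad k))" "y \<in> ball (x k i) (20 * rad k)"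
  proof -
    have "norm (y - x k i) < 20 * rad k" using i(2) rad_pos[of k] by linarith
    then show "y \<in> ball (x k i) (20 * rad k)" by (simp add: dist_norm norm_minus_commute)
  qed simp
  moreover have "?g z = \<sigma> k z" if "z \<in> ball (x k i) (20 * rad k)" for z
  proof -
    have "norm (z - x k i) \<le> 20 * rad k" using that by (simp add: dist_norm norm_minus_commute)
    then show ?thesis using sigma_eq[OF i(1) rad_scale[of _ 20 k 30]] by simp
  qed
  ultimately show ?thesis
    unfolding differentiable_def using has_derivative_transform_within_open by blast
next
  case False
  have "z = \<sigma> k z" if "z \<in> ball y (2 * rad k)" for z
  proof -
    have zy: "norm (z - y) < 2 * rad k" using that by (simp add: dist_norm norm_minus_commute)
    have "z \<notin> V_set J x k 10"
    proof
      assume "z \<in> V_set J x k 10"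
      then obtain i where i: "i \<in> J k" "norm (z - x k i) \<le> 10 * rad k"
        by (auto simp: V_set_def dist_norm norm_minus_commute)
      have "norm (y - x k i) \<le> 12 * rad k"
        using norm_triangle_ineq4[of "z - x k i" "z - y"] i(2) zy by simp
      then show False using False i(1) by blast
    qed
    then show ?thesis using sigma_id by simp
  qed
  moreover have "((\<lambda>z. z) has_derivative (\<lambda>z. z)) (at y)" by (rule has_derivative_ident)
  ultimately show ?thesis
    unfolding differentiable_def
    using has_derivative_transform_within_open[of "\<lambda>z. z" "\<lambda>z. z" y UNIV "ball y (2 * rad k)" "\<sigma> k"] by auto
qed

text \<open>The map sends curves in \<open>S k\<close> to curves in \<open>S (Suc k)\<close>, so the
  image \<open>L v\<close> of a tangent vector is tangent and differs from \<open>v\<close> by at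
  most \<open>\<gamma> / 600\<close> of its length. This bounds one gap;
  \<open>gap_symmetric\<close> supplies the other.\<close>

lemma tangent_plane_step:
  assumes y: "y \<in> S k"
  shows "norm (Dp (TS k y) - Dp (TS (Suc k) (\<sigma> k y))) \<le> \<gamma> / 100"
proof -
  let ?\<eta> = "\<gamma> / 600"
  have y': "\<sigma> k y \<in> S (Suc k)" using y by simp
  note T = tangent_plane[OF y] and T' = tangent_plane[OF y']
  have gap: "norm (v - Dp (TS (Suc k) (\<sigma> k y)) v) \<le> ?\<eta> * norm v" if v: "v \<in> directions (TS k y)" for v
  proof -
    obtain g where g: "g 0 = y" "\<forall>\<^sub>F t in at 0. g t \<in> S k" "(g has_vector_derivative v) (at 0)"
      using v[unfolded T(3)] unfolding tangent_space_def by blast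
    obtain L where L: "(\<sigma> k has_derivative L) (at y)" using sigma_differentiable by (auto simp: differentiable_def)
    let ?h = "\<lambda>t. \<sigma> k (g t)"
    have h: "(?h has_vector_derivative L v) (at 0)"
    proof -
      have "(g has_derivative (\<lambda>t. t *\<^sub>R v)) (at 0)" using g(3) by (simp add: has_vector_derivative_def)
      from diff_chain_at[OF this, of "\<sigma> k" L] L g(1)
      have "(?h has_derivative (\<lambda>t. L (t *\<^sub>R v))) (at 0)" by (simp add: o_def)
      moreover have "linear L" using L has_derivative_linear by blast
      ultimately show ?thesis by (simp add: has_vector_derivative_def linear_scale)
    qed
    have "\<forall>\<^sub>F t in at 0. ?h t \<in> S (Suc k)" using g(2) by eventually_elim simp
    then have Lv: "L v \<in> TS (Suc k) (\<sigma> k y)" unfolding tangent_space_def using g(1) h by auto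
    have "(g \<longlongrightarrow> y) (at 0)"
      using has_vector_derivative_continuous[OF g(3)] g(1) by (simp add: continuous_within)
    then have "\<forall>\<^sub>F t in at 0. dist (g t) y < rad k" by (rule tendstoD) simp
    with g(2) have ev: "\<forall>\<^sub>F t in at 0. norm ((?h t - g t) - (?h 0 - g 0)) \<le> ?\<eta> * norm (g t - g 0)"
    proof eventually_elim
      case (elim t)
      have "norm ((?h t - g t) - (?h 0 - g 0)) \<le> 42 * M * \<delta> * norm (g t - y)"
        using displacement_lipschitz[OF elim(1) y] elim(2) g(1) by (simp add: dist_norm)
      also have "\<dots> \<le> ?\<eta> * norm (g t - y)" using \<delta>_\<gamma>(2) by (intro mult_right_mono) auto
      finally show ?case using g(1) by simp
    qed
    have n: "norm (L v - v) \<le> ?\<eta> * norm v"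
      by (rule vector_derivative_norm_le[OF has_vector_derivative_diff[OF h g(3)] g(3) ev])
    have "norm (v - Dp (TS (Suc k) (\<sigma> k y)) v) \<le> norm (v - L v)"
      using plane_proj_closest[OF T'(1) Lv, of v] plane_through_0(2)[OF T'(1,2)] by simp
    then show ?thesis using n by (simp add: norm_minus_commute)
  qed
  have \<eta>: "?\<eta> \<le> 1/2" "0 \<le> ?\<eta>" using \<gamma>_small(2) \<gamma>_pos by simp_all
  have "norm (Dp (TS k y) - Dp (TS (Suc k) (\<sigma> k y))) \<le> 2 * (2 * ?\<eta>)"
  proof (rule norm_Dp_diff_le[OF T(1) T'(1)])
    show "norm (v - Dp (TS k y) v) \<le> 2 * ?\<eta> * norm v" if "v \<in> directions (TS (Suc k) (\<sigma> k y))" for v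
      by (rule gap_symmetric[OF T(1) T'(1) \<eta>(1) gap that])
    show "norm (v - Dp (TS (Suc k) (\<sigma> k y)) v) \<le> 2 * ?\<eta> * norm v" if "v \<in> directions (TS k y)" for v
    proof -
      have "0 \<le> ?\<eta> * norm v" using \<eta>(2) by simp
      then show ?thesis using gap[OF that] by linarith
    qed
  qed (use \<eta> in simp)
  then show ?thesis using \<gamma>_pos by simp
qed

text \<open>Points at distance more than \<open>10 r\<^sub>k\<close> are compared at the previous scale; the error of one step is
  absorbed since the normalized distance decreases by a factor \<open>10\<close>.\<close>

lemma tangent_planes_dist:
  assumes u: "u \<in> P0" and v: "v \<in> P0"
  shows "norm (Dp (TS k (f_seq \<sigma> k u)) - Dp (TS k (f_seq \<sigma> k v)))
    \<le> 2 * \<gamma> * (norm (f_seq \<sigma> k u - f_seq \<sigma> k v) / rad k)"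
proof (induction k)
  case 0
  have "tangent_space P0 w = directions P0" if w: "w \<in> P0" for w
  proof -
    have "tangent_space P0 w = (\<lambda>v. v + D1 (\<lambda>_. 0) (plane_proj P0 w) v) ` directions P0"
    proof (rule tangent_space_graph[OF plane0 _ _ _ w])
      show "c2 (\<lambda>_::'a. 0::'a)" using c2_lin(1)[of "0 :: 'a \<Rightarrow>\<^sub>L 'a" 0] by simp
      show "(0::'a) \<in> perp P0" by (simp add: perp_iff[OF plane0] blinfun.zero_right)
      show "P0 \<inter> cball w 1 = graph_over P0 (\<lambda>_. 0) \<inter> cball w 1" by (simp add: graph_over_def)
      show "norm (w - w) < 1" by simp
    qed
    then show ?thesis by (simp add: D1_const)
  qed
  then show ?case using u v \<gamma>_pos by simp
next
  case (Suc k)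
  define y where "y = f_seq \<sigma> k u"
  define z where "z = f_seq \<sigma> k v"
  have yz: "y \<in> S k" "z \<in> S k" using f_seq_surf u v by (auto simp: y_def z_def)
  let ?r' = "rad (Suc k)" and ?a = "norm (\<sigma> k y - \<sigma> k z)"
  have goal: "norm (Dp (TS (Suc k) (\<sigma> k y)) - Dp (TS (Suc k) (\<sigma> k z))) \<le> 2 * \<gamma> * (?a / ?r')"
  proof (cases "?a \<le> 10 * ?r'")
    case True
    then show ?thesis using tangent_planes_close[of "\<sigma> k y" "Suc k" "\<sigma> k z"] yz by simp
  next
    case False
    then have big: "10 < ?a / ?r'" by (simp add: less_divide_eq)
    have "norm (y - z) \<le> ?a + norm (\<sigma> k y - y) + norm (\<sigma> k z - z)"
      using norm_triangle_ineq4[of "\<sigma> k y - \<sigma> k z" "(\<sigma> k y - y) - (\<sigma> k z - z)"]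
        norm_triangle_ineq4[of "\<sigma> k y - y" "\<sigma> k z - z"] by (simp add: algebra_simps)
    then have "norm (y - z) \<le> ?a + rad k / 50"
      using displacement_small[OF yz(1)] displacement_small[OF yz(2)] by linarith
    then have "norm (y - z) / rad k \<le> (?a + rad k / 50) / rad k" by (intro divide_right_mono) auto
    also have "\<dots> = ?a / ?r' / 10 + 1 / 50"
      by (simp add: rad_Suc add_divide_distrib less_imp_neq[OF rad_pos, symmetric])
    finally have q: "norm (y - z) / rad k \<le> ?a / ?r' / 10 + 1 / 50" .
    have IH: "norm (Dp (TS k y) - Dp (TS k z)) \<le> 2 * \<gamma> * (norm (y - z) / rad k)"
      using Suc.IH by (simp add: y_def z_def)
    have "2 * \<gamma> * (norm (y - z) / rad k) \<le> 2 * \<gamma> * (?a / ?r' / 10 + 1 / 50)"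
      using q \<gamma>_pos by (intro mult_left_mono) auto
    then have IH': "norm (Dp (TS k y) - Dp (TS k z)) \<le> 2 * \<gamma> * (?a / ?r' / 10 + 1 / 50)"
      using IH by linarith
    let ?Y = "Dp (TS (Suc k) (\<sigma> k y))" and ?Z = "Dp (TS (Suc k) (\<sigma> k z))"
    have "norm (?Y - ?Z) \<le> norm (Dp (TS k y) - Dp (TS k z)) + norm (Dp (TS k y) - ?Y) + norm (Dp (TS k z) - ?Z)"
      by (rule norm_quadrilateral)
    also have "\<dots> \<le> 2 * \<gamma> * (?a / ?r' / 10 + 1 / 50) + \<gamma> / 100 + \<gamma> / 100"
      using IH' tangent_plane_step[OF yz(1)] tangent_plane_step[OF yz(2)] by linarith
    also have "\<dots> = \<gamma> * (?a / ?r' / 5 + 3 / 50)" by (simp add: algebra_simps)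
    \<comment> \<open>The normalized distance exceeds 10 here, so the additive term 3/50 is
      absorbed.\<close>
    also have "\<dots> \<le> \<gamma> * (2 * (?a / ?r'))" using big \<gamma>_pos by (intro mult_left_mono) auto
    finally show ?thesis by (simp add: mult_ac)
  qed
  then show ?case by (simp add: y_def z_def)
qed

lemma tangent_angle:
  assumes y: "y \<in> S k" and z: "z \<in> S k"
  shows "plane_angle (TS k y) (TS k z) \<le> 2 * \<gamma> * (norm (y - z) / rad k)"
proof -
  obtain u v where uv: "u \<in> P0" "v \<in> P0" "y = f_seq \<sigma> k u" "z = f_seq \<sigma> k v"
    using y z unfolding surf_f_seq by blast
  have "plane_angle (TS k y) (TS k z) \<le> norm (Dp (TS k y) - Dp (TS k z))"
    by (rule plane_angle_le[OF nontrivial]) (use tangent_plane[OF y] tangent_plane[OF z] in auto)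
  then show ?thesis using tangent_planes_dist[OF uv(1,2), of k] uv(3,4) by simp
qed

end

section \<open>Hausdorff content\<close>

lemma tendsto_coordinatewise:
  fixes r :: "'b \<Rightarrow> 'i \<Rightarrow> 'c::topological_space"
  assumes "\<And>i. ((\<lambda>p. r p i) \<longlongrightarrow> t i) F"
  shows "(r \<longlongrightarrow> t) F"
proof -
  have "limitin (product_topology (\<lambda>i. euclidean) UNIV) r t F"
    unfolding limitin_componentwise using assms by auto
  then show ?thesis by (simp add: euclidean_product_topology)
qed

lemma tendsto_coordinate:
  fixes r :: "'b \<Rightarrow> 'i \<Rightarrow> 'c::topological_space"
  assumes "(r \<longlongrightarrow> t) F"
  shows "((\<lambda>p. r p i) \<longlongrightarrow> t i) F"
  using continuous_on_tendsto_compose[OF continuous_on_product_coordinates assms] by simp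

text \<open>All coordinates are kept, so that the dimension can be a number and compactness is
  Tychonoff's theorem; the grid points below are 0 in the coordinates from \<open>n\<close>
  on.\<close>

definition unit_cube :: "(nat \<Rightarrow> real) set" where
  "unit_cube = (UNIV :: nat set) \<rightarrow>\<^sub>E {0..1}"

lemma compact_unit_cube: "compact unit_cube"
proof -
  have "compactin (product_topology (\<lambda>i::nat. euclidean) UNIV) (UNIV \<rightarrow>\<^sub>E {0..1::real})"
    unfolding compactin_PiE by simp
  then show ?thesis by (simp add: euclidean_product_topology unit_cube_def)
qed

text \<open>The library has Brouwer's theorem only for dimensions that are types; the Poincare--Miranda form for
  an arbitrary number \<open>n\<close> of coordinates follows from the same combinatorial lemma.\<close>

lemma poincare_miranda:
  fixes F :: "(nat \<Rightarrow> real) \<Rightarrow> nat \<Rightarrow> real"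
  assumes cont: "\<And>i. i < n \<Longrightarrow> continuous_on unit_cube (\<lambda>t. F t i)"
    and lo: "\<And>t i. t \<in> unit_cube \<Longrightarrow> i < n \<Longrightarrow> t i = 0 \<Longrightarrow> F t i \<ge> 0"
    and hi: "\<And>t i. t \<in> unit_cube \<Longrightarrow> i < n \<Longrightarrow> t i = 1 \<Longrightarrow> F t i \<le> 0"
  shows "\<exists>t\<in>unit_cube. \<forall>i<n. F t i = 0"
proof -
  define pt where "pt p q i = (if i < n then real (q i) / real p else 0)" for p :: nat and q :: "nat \<Rightarrow> nat" and i
  have cube: "pt p q \<in> unit_cube" if "p > 0" "\<And>i. i < n \<Longrightarrow> q i \<le> p" for p q
    using that by (auto simp: pt_def unit_cube_def)
  have "\<exists>q. (\<forall>i<n. q i < Suc p) \<and> (\<forall>i<n. \<exists>r s. (\<forall>j<n. q j \<le> r j \<and> r j \<le> q j + 1) \<and>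
      (\<forall>j<n. q j \<le> s j \<and> s j \<le> q j + 1) \<and> F (pt (Suc p) r) i \<ge> 0 \<and> F (pt (Suc p) s) i \<le> 0)" for p
  proof -
    \<comment> \<open>On the two faces the labels are forced, as the combinatorial lemma demands;
      the hypotheses \<open>lo\<close> and \<open>hi\<close> make them agree with the sign of
      \<open>F\<close> there, so every label certifies a sign.\<close>
    define label where "label q i = (if q i = 0 then 0 else if q i = Suc p then 1 else
      if F (pt (Suc p) q) i \<ge> 0 then 0 else (1::nat))" for q i
    have l0: "F (pt (Suc p) q) i \<ge> 0" if "label q i = 0" "\<And>j. j < n \<Longrightarrow> q j \<le> Suc p" "i < n" for q i
      using lo[OF cube[of "Suc p" q]] that by (auto simp: label_def pt_def split: if_splits)
    have l1: "F (pt (Suc p) q) i \<le> 0" if "label q i = 1" "\<And>j. j < n \<Longrightarrow> q j \<le> Suc p" "i < n" for q i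
      using hi[OF cube[of "Suc p" q]] that by (auto simp: label_def pt_def split: if_splits)
    obtain q where q: "\<forall>i<n. q i < Suc p" "\<forall>i<n. \<exists>r s. (\<forall>j<n. q j \<le> r j \<and> r j \<le> q j + 1) \<and>
        (\<forall>j<n. q j \<le> s j \<and> s j \<le> q j + 1) \<and> label r i \<noteq> label s i"
      by (rule kuhn_lemma[of "Suc p" n label]) (auto simp: label_def)
    have "\<exists>r s. (\<forall>j<n. q j \<le> r j \<and> r j \<le> q j + 1) \<and>
      (\<forall>j<n. q j \<le> s j \<and> s j \<le> q j + 1) \<and> F (pt (Suc p) r) i \<ge> 0 \<and> F (pt (Suc p) s) i \<le> 0" if i: "i < n" for i
    proof -
      obtain r s where rs: "\<forall>j<n. q j \<le> r j \<and> r j \<le> q j + 1" "\<forall>j<n. q j \<le> s j \<and> s j \<le> q j + 1" "label r i \<noteq> label s i"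
        using q(2) i by blast
      have b: "r j \<le> Suc p" "s j \<le> Suc p" if "j < n" for j
        using rs(1,2) q(1) that by fastforce+
      have "label q i = 0 \<or> label q i = 1" for q by (auto simp: label_def)
      then consider "label r i = 0" "label s i = 1" | "label r i = 1" "label s i = 0" using rs(3) by metis
      then show ?thesis
      proof cases
        case 1
        show ?thesis
          by (rule exI[of _ r], rule exI[of _ s], intro conjI rs(1,2) l0[OF 1(1) b(1) i] l1[OF 1(2) b(2) i])
      next
        case 2
        show ?thesis
          by (rule exI[of _ s], rule exI[of _ r], intro conjI rs(1,2) l0[OF 2(2) b(2) i] l1[OF 2(1) b(1) i])
      qed
    qed
    then show ?thesis using q(1) by blast
  qed
  then obtain Q where Q: "\<And>p i. i < n \<Longrightarrow> Q p i < Suc p" "\<And>p i. i < n \<Longrightarrow> \<exists>r s. (\<forall>j<n. Q p j \<le> r j \<and> r j \<le> Q p j + 1) \<and>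
      (\<forall>j<n. Q p j \<le> s j \<and> s j \<le> Q p j + 1) \<and> F (pt (Suc p) r) i \<ge> 0 \<and> F (pt (Suc p) s) i \<le> 0"
    by metis
  have "seq_compact unit_cube" using compact_unit_cube compact_imp_seq_compact by blast
  moreover have "\<forall>p. pt (Suc p) (Q p) \<in> unit_cube"
    using Q(1) by (auto intro!: cube less_imp_le)
  ultimately obtain t \<phi> where t: "t \<in> unit_cube" "strict_mono (\<phi> :: nat \<Rightarrow> nat)"
    "((\<lambda>p. pt (Suc p) (Q p)) \<circ> \<phi>) \<longlonglongrightarrow> t"
    by (rule seq_compactE)
  \<comment> \<open>All vertices of the chosen small cubes have the same limit, so both sign
    conditions pass to the single point \<open>t\<close>.\<close>
  have conv: "(\<lambda>p. pt (Suc (\<phi> p)) (r p)) \<longlonglongrightarrow> t"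
    if r: "\<And>p j. j < n \<Longrightarrow> Q (\<phi> p) j \<le> r p j \<and> r p j \<le> Q (\<phi> p) j + 1" for r
  proof (rule tendsto_coordinatewise)
    fix j
    have c: "(\<lambda>p. pt (Suc (\<phi> p)) (Q (\<phi> p)) j) \<longlonglongrightarrow> t j"
      using tendsto_coordinate[OF t(3), of j] by (simp add: o_def)
    have "(\<lambda>p. pt (Suc (\<phi> p)) (r p) j - pt (Suc (\<phi> p)) (Q (\<phi> p)) j) \<longlonglongrightarrow> 0"
    proof (rule Lim_null_comparison)
      have "(\<lambda>p. 1 / real (Suc p)) \<longlonglongrightarrow> 0" by (rule LIMSEQ_Suc[OF lim_1_over_n])
      then show "(\<lambda>p. 1 / real (Suc (\<phi> p))) \<longlonglongrightarrow> 0"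
        using LIMSEQ_subseq_LIMSEQ[OF _ t(2)] by (fastforce simp: o_def)
      have "norm (pt (Suc (\<phi> p)) (r p) j - pt (Suc (\<phi> p)) (Q (\<phi> p)) j) \<le> 1 / real (Suc (\<phi> p))" for p
      proof (cases "j < n")
        case True
        have "real (Q (\<phi> p) j) \<le> real (r p j)" "real (r p j) \<le> real (Q (\<phi> p) j) + 1"
          using r[OF True, of p] by linarith+
        then have "\<bar>real (r p j) - real (Q (\<phi> p) j)\<bar> \<le> 1" by linarith
        then show ?thesis
          using True by (simp add: pt_def diff_divide_distrib[symmetric] divide_right_mono del: of_nat_Suc)
      qed (simp add: pt_def)
      then show "\<forall>\<^sub>F p in sequentially. norm (pt (Suc (\<phi> p)) (r p) j - pt (Suc (\<phi> p)) (Q (\<phi> p)) j) \<le> 1 / real (Suc (\<phi> p))"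
        by simp
    qed
    from tendsto_add[OF this c] show "(\<lambda>p. pt (Suc (\<phi> p)) (r p) j) \<longlonglongrightarrow> t j" by simp
  qed
  have "F t i = 0" if i: "i < n" for i
  proof -
    have "\<forall>p. \<exists>r. (\<forall>j<n. Q (\<phi> p) j \<le> r j \<and> r j \<le> Q (\<phi> p) j + 1) \<and> F (pt (Suc (\<phi> p)) r) i \<ge> 0"
      using Q(2)[OF i] by blast
    from choice[OF this] obtain r where
      r: "\<And>p j. j < n \<Longrightarrow> Q (\<phi> p) j \<le> r p j \<and> r p j \<le> Q (\<phi> p) j + 1" "\<And>p. F (pt (Suc (\<phi> p)) (r p)) i \<ge> 0"
      by blast
    have "\<forall>p. \<exists>s. (\<forall>j<n. Q (\<phi> p) j \<le> s j \<and> s j \<le> Q (\<phi> p) j + 1) \<and> F (pt (Suc (\<phi> p)) s) i \<le> 0"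
      using Q(2)[OF i] by blast
    from choice[OF this] obtain s where
      s: "\<And>p j. j < n \<Longrightarrow> Q (\<phi> p) j \<le> s p j \<and> s p j \<le> Q (\<phi> p) j + 1" "\<And>p. F (pt (Suc (\<phi> p)) (s p)) i \<le> 0"
      by blast

    have br: "r p j \<le> Suc (\<phi> p)" and bs: "s p j \<le> Suc (\<phi> p)" if "j < n" for p j
      using Q(1)[OF that, of "\<phi> p"] r(1)[OF that, of p] s(1)[OF that, of p] by linarith+
    have "(\<lambda>p. F (pt (Suc (\<phi> p)) (r p)) i) \<longlonglongrightarrow> F t i"
      by (rule continuous_on_tendsto_compose[OF cont[OF i] conv t(1)], rule r(1), assumption)
        (intro always_eventually allI cube zero_less_Suc br)
    then have "F t i \<ge> 0" by (rule LIMSEQ_le_const) (use r(2) in blast)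
    moreover have "(\<lambda>p. F (pt (Suc (\<phi> p)) (s p)) i) \<longlonglongrightarrow> F t i"
      by (rule continuous_on_tendsto_compose[OF cont[OF i] conv t(1)], rule s(1), assumption)
        (intro always_eventually allI cube zero_less_Suc bs)
    then have "F t i \<le> 0" by (rule LIMSEQ_le_const2) (use s(2) in blast)
    ultimately show ?thesis by simp
  qed
  then show ?thesis using t(1) by blast
qed

section \<open>Lower content bounds from coordinates\<close>

text \<open>The coordinates divided by \<open>s\<close> send \<open>S\<close> onto a set containing
  a cube of volume 1, and a set of diameter \<open>D\<close> into a cube of side
  \<open>2 * D / s\<close>. Subadditivity of Lebesgue measure then bounds the sum of the
  \<open>D ^ d\<close> from below by \<open>(s / 2) ^ d\<close>.\<close>

lemma hausdorff_content_coordinates: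
  fixes b :: "nat \<Rightarrow> 'a::real_inner"
  assumes d: "d \<ge> 1" and b: "onb d b" and s: "s > 0"
    and cover: "\<And>\<tau>. (\<And>i. i < d \<Longrightarrow> \<bar>\<tau> i\<bar> \<le> 1/2) \<Longrightarrow> \<exists>p\<in>S. \<forall>i<d. (p - y) \<bullet> b i / s = \<tau> i"
  shows "ennreal ((s / 2) ^ d) \<le> hausdorff_content d S"
  unfolding hausdorff_content_def
proof (rule INF_greatest)
  fix U :: "nat \<Rightarrow> 'a set"
  assume "U \<in> {U. (\<forall>i. bounded (U i)) \<and> S \<subseteq> (\<Union>i. U i)}"
  then have U: "\<And>i. bounded (U i)" "S \<subseteq> (\<Union>i. U i)" by auto
  interpret product_sigma_finite "\<lambda>_::nat. lborel :: real measure" by standard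
  let ?M = "PiM {..<d} (\<lambda>_::nat. lborel :: real measure)"
  have nb: "norm (b i) = 1" if "i < d" for i using b that unfolding onb_def by (simp add: norm_eq_sqrt_inner)
  \<comment> \<open>For an empty \<open>U i\<close> the chosen point is arbitrary; its cube is
    degenerate and has measure 0.\<close>
  define e where "e i = (SOME p. p \<in> U i)" for i
  define D where "D i = diameter (U i) / s" for i
  have D0: "D i \<ge> 0" for i unfolding D_def using s diameter_ge_0[OF U(1)] by simp
  define B where "B i = (\<Pi>\<^sub>E j\<in>{..<d}. {(e i - y) \<bullet> b j / s - D i .. (e i - y) \<bullet> b j / s + D i})" for i
  let ?C = "\<Pi>\<^sub>E j\<in>{..<d}. {-1/2..1/2::real}"
  have "?C \<subseteq> (\<Union>i. B i)"
  proof
    fix \<tau> assume \<tau>: "\<tau> \<in> ?C"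
    then have "\<bar>\<tau> i\<bar> \<le> 1/2" if "i < d" for i using that by (force simp: PiE_iff abs_le_iff)
    from cover[of \<tau>, OF this] obtain p where p: "p \<in> S" "\<And>i. i < d \<Longrightarrow> (p - y) \<bullet> b i / s = \<tau> i" by blast
    obtain i where i: "p \<in> U i" using U(2) p(1) by blast
    have e: "e i \<in> U i" unfolding e_def using i by (rule someI)
    have "\<bar>\<tau> j - (e i - y) \<bullet> b j / s\<bar> \<le> D i" if j: "j < d" for j
    proof -
      have "\<tau> j - (e i - y) \<bullet> b j / s = (p - e i) \<bullet> b j / s"
        using p(2)[OF j] by (simp add: inner_diff_left diff_divide_distrib)
      moreover have "\<bar>(p - e i) \<bullet> b j\<bar> \<le> diameter (U i)"
        using Cauchy_Schwarz_ineq2[of "p - e i" "b j"] nb[OF j] diameter_bounded_bound[OF U(1) i e]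
        by (simp add: dist_norm)
      ultimately show ?thesis unfolding D_def using s by (simp add: divide_right_mono)
    qed
    then have "\<tau> \<in> B i" using \<tau> by (auto simp: B_def PiE_iff abs_le_iff algebra_simps extensional_def)
    then show "\<tau> \<in> (\<Union>i. B i)" by blast
  qed
  moreover have sB: "B i \<in> sets ?M" for i unfolding B_def by (intro sets_PiM_I_finite) auto
  ultimately have "emeasure ?M ?C \<le> emeasure ?M (\<Union>i. B i)" by (intro emeasure_mono) auto
  also have "\<dots> \<le> (\<Sum>i. emeasure ?M (B i))" by (rule emeasure_subadditive_countably) (use sB in auto)
  finally have "emeasure ?M ?C \<le> (\<Sum>i. emeasure ?M (B i))" .
  moreover have "emeasure ?M ?C = 1" by (subst emeasure_PiM) auto
  moreover have "emeasure ?M (B i) = ennreal ((2 * D i) ^ d)" for i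
    unfolding B_def by (subst emeasure_PiM) (use D0[of i] in \<open>auto simp: ennreal_power\<close>)
  ultimately have 1: "1 \<le> (\<Sum>i. ennreal ((2 * D i) ^ d))" by simp
  have "ennreal ((s / 2) ^ d) = ennreal ((s / 2) ^ d) * 1" by simp
  also have "\<dots> \<le> ennreal ((s / 2) ^ d) * (\<Sum>i. ennreal ((2 * D i) ^ d))" using 1 by (rule mult_left_mono) simp
  also have "\<dots> = (\<Sum>i. ennreal ((s / 2) ^ d) * ennreal ((2 * D i) ^ d))" by simp
  also have "\<dots> = (\<Sum>i. ennreal (diameter (U i) ^ d))"
  proof (rule suminf_cong)
    fix i
    have "s / 2 * (2 * D i) = diameter (U i)" using s by (simp add: D_def)
    then have "(s / 2) ^ d * (2 * D i) ^ d = diameter (U i) ^ d"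
      by (simp only: power_mult_distrib[of "s / 2" "2 * D i", symmetric])
    then show "ennreal ((s / 2) ^ d) * ennreal ((2 * D i) ^ d) = ennreal (diameter (U i) ^ d)"
      using s D0[of i] ennreal_mult[of "(s / 2) ^ d" "(2 * D i) ^ d"] by simp
  qed
  finally show "ennreal ((s / 2) ^ d) \<le> (\<Sum>i. ennreal (diameter (U i) ^ d))" .
qed

text \<open>A cube of half side \<open>s = \<rho> / d\<close> fits into the disc. In coordinates
  divided by \<open>s\<close> it has half side 1, and \<open>g\<close> moves them by at most 1/2; on
  opposite faces the image therefore stays on either side of each \<tau> with entries at most 1/2 in
  modulus, and \<tau> is attained.\<close>

lemma hausdorff_content_perturbed_disc:
  fixes Q :: "'a::real_inner set"
  assumes d: "d \<ge> 1" and Q: "is_plane d Q" and y: "y \<in> Q" and \<rho>: "\<rho> > 0"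
    and g: "continuous_on (Q \<inter> cball y \<rho>) g"
    and gS: "\<And>q. q \<in> Q \<Longrightarrow> norm (q - y) \<le> \<rho> \<Longrightarrow> g q \<in> S"
    and near: "\<And>q. q \<in> Q \<Longrightarrow> norm (q - y) \<le> \<rho> \<Longrightarrow> norm (g q - q) \<le> \<rho> / (2 * real d)"
  shows "ennreal ((\<rho> / (2 * real d)) ^ d) \<le> hausdorff_content d S"
proof -
  obtain a b where b: "onb d b" "directions Q = span (b ` {..<d})" using plane_onb[OF Q] by metis
  have nb: "norm (b i) = 1" if "i < d" for i using b(1) that unfolding onb_def by (simp add: norm_eq_sqrt_inner)
  define s where "s = \<rho> / real d"
  have s: "s > 0" using \<rho> d by (simp add: s_def)
  define q where "q t = y + (\<Sum>i<d. (s * (2 * t i - 1)) *\<^sub>R b i)" for t :: "nat \<Rightarrow> real"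
  have qQ: "q t \<in> Q" for t
    unfolding q_def using plane_translate_iff[OF Q y] b(2)
    by (auto intro!: span_sum span_scale intro: span_base)
  have qn: "norm (q t - y) \<le> \<rho>" if t: "t \<in> unit_cube" for t
  proof -
    have "norm (q t - y) \<le> (\<Sum>i<d. norm ((s * (2 * t i - 1)) *\<^sub>R b i))" unfolding q_def add_diff_cancel_left' by (rule norm_sum)
    also have "\<dots> \<le> (\<Sum>i<d. s)"
    proof (rule sum_mono)
      fix i assume i: "i \<in> {..<d}"
      have "t i \<in> {0..1}" using t by (auto simp: unit_cube_def)
      then have "\<bar>2 * t i - 1\<bar> \<le> 1" by (auto simp: abs_le_iff)
      then have "s * \<bar>2 * t i - 1\<bar> \<le> s * 1" using s by (intro mult_left_mono) auto
      then show "norm ((s * (2 * t i - 1)) *\<^sub>R b i) \<le> s" using nb i s by (simp add: abs_mult)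
    qed
    also have "\<dots> = \<rho>" using d by (simp add: s_def)
    finally show ?thesis .
  qed
  have qi: "(q t - y) \<bullet> b i = s * (2 * t i - 1)" if i: "i < d" for t i
  proof -
    have "(q t - y) \<bullet> b i = (\<Sum>j<d. (s * (2 * t j - 1)) * (b j \<bullet> b i))" by (simp add: q_def inner_sum_left)
    also have "\<dots> = (\<Sum>j<d. if j = i then s * (2 * t i - 1) else 0)"
      using b(1) i by (intro sum.cong) (auto simp: onb_def)
    finally show ?thesis using i by simp
  qed
  have qc: "continuous_on unit_cube q"
    unfolding q_def
    by (intro continuous_intros continuous_on_subset[OF continuous_on_product_coordinates]) auto
  have gc: "continuous_on unit_cube (\<lambda>t. g (q t))"
    by (rule continuous_on_compose2[OF g qc]) (use qQ qn in \<open>auto simp: dist_norm norm_minus_commute\<close>)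
  have dev: "\<bar>(g (q t) - y) \<bullet> b i / s - (2 * t i - 1)\<bar> \<le> 1/2" if t: "t \<in> unit_cube" and i: "i < d" for t i
  proof -
    have "\<bar>(g (q t) - q t) \<bullet> b i\<bar> \<le> s / 2"
      using Cauchy_Schwarz_ineq2[of "g (q t) - q t" "b i"] nb[OF i] near[OF qQ qn[OF t]] by (simp add: s_def mult.commute)
    then have "\<bar>(g (q t) - q t) \<bullet> b i\<bar> / s \<le> 1/2" using s by (simp add: divide_simps)
    moreover have "(g (q t) - q t) \<bullet> b i / s = (g (q t) - y) \<bullet> b i / s - (2 * t i - 1)"
    proof -
      have "(g (q t) - q t) \<bullet> b i = (g (q t) - y) \<bullet> b i - (q t - y) \<bullet> b i" by (simp add: inner_diff_left)
      then show ?thesis using qi[OF i] s by (simp add: diff_divide_distrib)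
    qed
    ultimately show ?thesis using s by (metis abs_divide abs_of_pos)
  qed
  have "ennreal ((s / 2) ^ d) \<le> hausdorff_content d S"
  proof (rule hausdorff_content_coordinates[OF d b(1) s])
    fix \<tau> :: "nat \<Rightarrow> real" assume \<tau>: "\<And>i. i < d \<Longrightarrow> \<bar>\<tau> i\<bar> \<le> 1/2"
    have "\<exists>t\<in>unit_cube. \<forall>i<d. \<tau> i - (g (q t) - y) \<bullet> b i / s = 0"
    proof (rule poincare_miranda)
      show "continuous_on unit_cube (\<lambda>t. \<tau> i - (g (q t) - y) \<bullet> b i / s)" for i
        using s by (intro continuous_intros gc) auto
      show "\<tau> i - (g (q t) - y) \<bullet> b i / s \<ge> 0" if "t \<in> unit_cube" "i < d" "t i = 0" for t i
        using dev[OF that(1,2)] \<tau>[OF that(2)] that(3) unfolding abs_le_iff by linarith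
      show "\<tau> i - (g (q t) - y) \<bullet> b i / s \<le> 0" if "t \<in> unit_cube" "i < d" "t i = 1" for t i
        using dev[OF that(1,2)] \<tau>[OF that(2)] that(3) unfolding abs_le_iff by linarith
    qed
    then obtain t where t: "t \<in> unit_cube" "\<And>i. i < d \<Longrightarrow> \<tau> i - (g (q t) - y) \<bullet> b i / s = 0" by blast
    then have "\<forall>i<d. (g (q t) - y) \<bullet> b i / s = \<tau> i" by simp
    then show "\<exists>p\<in>S. \<forall>i<d. (p - y) \<bullet> b i / s = \<tau> i" using gS[OF qQ qn[OF t(1)]] by blast
  qed
  moreover have "s / 2 = \<rho> / (2 * real d)" by (simp add: s_def mult.commute)
  ultimately show ?thesis by metis
qed

section \<open>Content of the limit surface\<close>

context coherent_collection
begin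

lemma small_dimension: "80 * real d * \<gamma> \<le> 1" "\<gamma> \<le> 1 / 1000"
  using \<gamma>_small \<gamma>_pos by (simp_all add: mult.assoc)

text \<open>A disc of radius \<open>r / 2\<close> in the plane of the local graph is mapped into
  \<Sigma> by lifting it to \<open>S k\<close> and applying \<open>FF k\<close>. Since
  \<open>rad k\<close> is comparable with \<open>r\<close>, it moves by at most
  \<open>20 * \<gamma> * r\<close>; halving the radius keeps the image in the ball around
  \<open>z\<close>.\<close>

lemma limit_surface_content_small:
  assumes z: "z \<in> \<Sigma>" and r: "rad k / 10 \<le> r" "r < rad k"
  shows "ennreal ((r / (4 * real d)) ^ d) \<le> hausdorff_content d (\<Sigma> \<inter> cball z r)"
proof -
  let ?r = "rad k"
  have r0: "r > 0" using r(1) rad_pos[of k] by linarith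
  obtain u where u: "u \<in> P0" "z = f u" using z by blast
  let ?y = "f_seq \<sigma> k u"
  have y: "?y \<in> S k" by (rule f_seq_surf[OF u(1)])
  obtain Q A where lg: "local_graph k ?y Q A" using local_graph_exists[OF y] by blast
  note l = local_graphD[OF lg]
  define g where "g q = FF k (q + A q)" for q
  have gr: "\<gamma> * ?r \<le> 10 * \<gamma> * r" using mult_left_mono[OF r(1), of "10 * \<gamma>"] \<gamma>_pos by simp
  have A: "norm (A q) \<le> \<gamma> * ?r" if "norm (q - ?y) \<le> r / 2" for q
  proof -
    have "norm (A q) \<le> \<gamma> * norm (q - ?y)" using l(8)[of q ?y] l(9)[OF y] by simp
    also have "\<dots> \<le> \<gamma> * ?r" using that r r0 \<gamma>_pos by (intro mult_left_mono) auto
    finally show ?thesis .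
  qed
  have g1: "\<gamma> * ?r \<le> ?r" using mult_right_mono[OF small_dimension(2), of ?r] rad_pos[of k] by linarith
  have inS: "q + A q \<in> S k" if "q \<in> Q" "norm (q - ?y) \<le> r / 2" for q
  proof -
    have "norm (q + A q - ?y) \<le> norm (q - ?y) + norm (A q)"
      using norm_triangle_ineq[of "q - ?y" "A q"] by (simp add: algebra_simps)
    then have "norm (q + A q - ?y) \<le> 19 * ?r" using A[OF that(2)] g1 that(2) r r0 by linarith
    then have "q + A q \<in> graph_over Q A \<inter> cball ?y (19 * ?r)"
      using that(1) by (auto simp: graph_over_def dist_norm norm_minus_commute)
    then show ?thesis unfolding l(7)[symmetric] by simp
  qed
  have d24: "24 * \<delta> * ?r \<le> \<gamma> * ?r" using delta24(1) \<gamma>_pos by (intro mult_right_mono) auto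
  have near: "norm (g q - q) \<le> 20 * \<gamma> * r" if "q \<in> Q" "norm (q - ?y) \<le> r / 2" for q
  proof -
    have "norm (g q - q) \<le> norm (FF k (q + A q) - (q + A q)) + norm (A q)"
      using norm_triangle_ineq[of "FF k (q + A q) - (q + A q)" "A q"] by (simp add: g_def)
    then show ?thesis using FF_dist_0[OF inS[OF that]] A[OF that(2)] d24 gr by linarith
  qed
  have dd: "20 * \<gamma> * r \<le> r / 2 / (2 * real d)"
  proof -
    have "80 * real d * \<gamma> * r \<le> 1 * r" using small_dimension(1) r0 by (intro mult_right_mono) auto
    then show ?thesis using d1 by (simp add: field_simps)
  qed
  have yz: "norm (z - ?y) \<le> 10 * \<gamma> * r" using f_dist[OF u(1), of k] d24 gr unfolding u(2) by linarith
  have "ennreal ((r / 2 / (2 * real d)) ^ d) \<le> hausdorff_content d (\<Sigma> \<inter> cball z r)"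
  proof (rule hausdorff_content_perturbed_disc[OF d1 l(1,2)])
    show "continuous_on (Q \<inter> cball ?y (r / 2)) g"
      unfolding g_def
    proof (rule continuous_on_compose2[OF FF_continuous])
      show "continuous_on (Q \<inter> cball ?y (r / 2)) (\<lambda>q. q + A q)"
        by (intro continuous_intros continuous_on_subset[OF c2_continuous[OF l(3)]]) auto
      show "(\<lambda>q. q + A q) ` (Q \<inter> cball ?y (r / 2)) \<subseteq> S k"
        using inS by (auto simp: dist_norm norm_minus_commute)
    qed
    fix q assume q: "q \<in> Q" "norm (q - ?y) \<le> r / 2"
    show "norm (g q - q) \<le> r / 2 / (2 * real d)" using near[OF q] dd by linarith
    have "20 * \<gamma> * r \<le> 20 * (1/1000) * r" "10 * \<gamma> * r \<le> 10 * (1/1000) * r"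
      using small_dimension(2) r0 by (auto intro!: mult_right_mono)
    moreover have "norm (g q - z) \<le> norm (g q - q) + norm (q - ?y) + norm (z - ?y)"
      using norm_triangle_ineq[of "g q - q" "q - z"] norm_triangle_ineq4[of "q - ?y" "z - ?y"] by simp
    ultimately have "norm (g q - z) \<le> r" using near[OF q] q(2) yz r0 by linarith
    moreover have "g q \<in> \<Sigma>" unfolding g_def using inS[OF q] FF_image by blast
    ultimately show "g q \<in> \<Sigma> \<inter> cball z r" by (simp add: dist_norm norm_minus_commute)
  qed (use r0 in simp)
  then show ?thesis by (simp add: field_simps)
qed

text \<open>Above scale 1 no intermediate surface is needed: \<open>f\<close> moves the points of
  \<open>P0\<close> by at most \<gamma>, which is at most \<open>\<gamma> * r\<close>.\<close>

lemma limit_surface_content_large: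
  assumes z: "z \<in> \<Sigma>" and r: "r \<ge> 1"
  shows "ennreal ((r / (4 * real d)) ^ d) \<le> hausdorff_content d (\<Sigma> \<inter> cball z r)"
proof -
  obtain u where u: "u \<in> P0" "z = f u" using z by blast
  have fd: "norm (f q - q) \<le> \<gamma>" if "q \<in> P0" for q
    using f_dist[OF that, of 0] delta24(1) \<gamma>_pos by simp
  have gr: "\<gamma> \<le> \<gamma> * r" using mult_left_mono[OF r, of \<gamma>] \<gamma>_pos by simp
  have g3: "\<gamma> * r \<le> r / 1000" using mult_right_mono[OF small_dimension(2), of r] r by simp
  have "ennreal ((r / 2 / (2 * real d)) ^ d) \<le> hausdorff_content d (\<Sigma> \<inter> cball z r)"
  proof (rule hausdorff_content_perturbed_disc[OF d1 plane0 u(1)])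
    show "continuous_on (P0 \<inter> cball u (r / 2)) f"
      using FF_continuous[of 0] unfolding FF_0 by (rule continuous_on_subset) auto
    fix q assume q: "q \<in> P0" "norm (q - u) \<le> r / 2"
    have "80 * real d * \<gamma> * r \<le> 1 * r" using small_dimension(1) r by (intro mult_right_mono) auto
    then have "20 * (\<gamma> * r) \<le> r / 2 / (2 * real d)" using d1 by (simp add: field_simps)
    then show "norm (f q - q) \<le> r / 2 / (2 * real d)" using fd[OF q(1)] gr \<gamma>_pos by linarith
    have "norm (f q - z) \<le> norm (f q - q) + norm (q - u) + norm (f u - u)"
      using norm_triangle_ineq[of "f q - q" "q - z"] norm_triangle_ineq4[of "q - u" "f u - u"] u(2) by simp
    then have "norm (f q - z) \<le> r" using fd[OF q(1)] fd[OF u(1)] q(2) gr g3 r by linarith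
    then show "f q \<in> \<Sigma> \<inter> cball z r" using q(1) by (simp add: dist_norm norm_minus_commute)
  qed (use r in simp)
  then show ?thesis by (simp add: field_simps)
qed

lemma limit_surface_content:
  assumes z: "z \<in> \<Sigma>" and r: "r > 0"
  shows "ennreal (r ^ d) \<le> ennreal ((4 * real d) ^ d) * hausdorff_content d (\<Sigma> \<inter> cball z r)"
proof -
  have "ennreal ((r / (4 * real d)) ^ d) \<le> hausdorff_content d (\<Sigma> \<inter> cball z r)"
  proof (cases "r \<ge> 1")
    case True then show ?thesis by (rule limit_surface_content_large[OF z])
  next
    case False
    obtain k where "rad k / 10 \<le> r" "r < rad k" using rad_scale_exists[of r] r False by auto
    then show ?thesis by (rule limit_surface_content_small[OF z])
  qed
  then have "ennreal ((4 * real d) ^ d) * ennreal ((r / (4 * real d)) ^ d) \<le>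
      ennreal ((4 * real d) ^ d) * hausdorff_content d (\<Sigma> \<inter> cball z r)"
    by (rule mult_left_mono) simp
  moreover have "(4 * real d) ^ d * (r / (4 * real d)) ^ d = r ^ d"
    using d1 unfolding power_mult_distrib[of "4 * real d" "r / (4 * real d)", symmetric] by simp
  moreover have "ennreal ((4 * real d) ^ d) * ennreal ((r / (4 * real d)) ^ d) =
      ennreal ((4 * real d) ^ d * (r / (4 * real d)) ^ d)"
    by (rule ennreal_mult[symmetric]) (use r in auto)
  ultimately show ?thesis by simp
qed

end

section \<open>The parametrization theorem\<close>

text \<open>Ensures that the final constant dominates the 60000 of conclusion 11. It is stated
  outside the locale because the constant is chosen before \<epsilon> and the collection.\<close>

lemma C2_large:
  assumes "d \<ge> 1"
  shows "C2 d c \<ge> 60000"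
proof -
  have "(200 * d) ^ d \<ge> 1" using assms by simp
  then have "real ((200 * d) ^ d) \<ge> 1" by linarith
  then have "MM d c \<ge> 1 * 1" unfolding MM_def by (intro mult_mono) auto
  moreover from this have "MM d c * MM d c \<ge> 1 * 1" by (intro mult_mono) auto
  ultimately show ?thesis by (simp add: C2_def C0_def)
qed

theorem theorem3p6:
  fixes d :: nat and c :: "nat \<Rightarrow> real"
  assumes infinite_dim: "\<not> (\<exists>B :: 'a::{real_inner, polish_space} set. finite B \<and> span B = UNIV)"
    and d: "d \<ge> 1"
  shows "\<exists>\<epsilon>0>0. \<exists>C>0. \<forall>\<epsilon>. 0 < \<epsilon> \<and> \<epsilon> < \<epsilon>0 \<longrightarrow>
    (\<forall>(P0 :: 'a set) (J :: nat \<Rightarrow> 'i set) (x :: nat \<Rightarrow> 'i \<Rightarrow> 'a)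
      (P :: nat \<Rightarrow> 'i \<Rightarrow> 'a set) (\<theta> :: nat \<Rightarrow> 'i \<Rightarrow> 'a \<Rightarrow> real).
      ccbp d \<epsilon> P0 J x P \<and>
      (\<forall>k. \<forall>j\<in>J k. eps_at J x P k (x k j) < \<epsilon>) \<and>
      partition_family c J x \<theta> \<longrightarrow>
      (let \<sigma> = sigma_map J P \<theta>; f = f_lim \<sigma>; \<Sigma> = f ` P0; S = surf \<sigma> P0 in
        bij_betw f P0 \<Sigma> \<and>
        \<comment> \<open>1\<close>
        (\<Inter>K\<in>{1..}. closure (\<Union>k\<in>{K..}. x k ` J k)) \<subseteq> \<Sigma> \<and>
        \<comment> \<open>2\<close>
        (\<forall>y\<in>P0. infdist y P0 > 2 \<longrightarrow> f y = y) \<and>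
        \<comment> \<open>3\<close>
        (\<exists>\<tau>. 0 < \<tau> \<and> \<tau> < 1 \<and> (\<forall>y\<in>P0. \<forall>z\<in>P0. norm (y - z) \<le> 1 \<longrightarrow>
           1 / 4 * norm (y - z) powr (1 + \<tau>) \<le> norm (f y - f z) \<and>
           norm (f y - f z) \<le> 10 * norm (y - z) powr (1 - \<tau>))) \<and>
        \<comment> \<open>4\<close>
        (\<forall>y\<in>P0. norm (f y - y) \<le> C * \<epsilon>) \<and>
        \<comment> \<open>5\<close>
        (\<forall>y\<in>P0. (\<lambda>k. fold \<sigma> [0..<Suc k] y) \<longlonglongrightarrow> f y) \<and>
        \<comment> \<open>6\<close>
        (\<forall>k. \<forall>y. y \<notin> V_set J x k 10 \<longrightarrow> \<sigma> k y = y) \<and>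
        \<comment> \<open>7\<close>
        (\<forall>k. \<forall>j\<in>J k. \<exists>A.
           A ` (P k j \<inter> cball (x k j) (49 * rad k)) \<subseteq> perp (P k j) \<and>
           (\<exists>L. L-lipschitz_on (P k j \<inter> cball (x k j) (49 * rad k)) A) \<and>
           norm (A (x k j)) \<le> C * \<epsilon> * rad k \<and>
           (\<forall>y\<in>P k j \<inter> cball (x k j) (49 * rad k). \<exists>DA.
              (A has_derivative DA) (at y within P k j \<inter> cball (x k j) (49 * rad k)) \<and>
              (\<forall>v\<in>directions (P k j). norm (DA v) \<le> C * \<epsilon> * norm v)) \<and>
           S k \<inter> cylinder (x k j) (P k j) (49 * rad k) =
             graph_over (P k j \<inter> cball (x k j) (49 * rad k)) A \<inter>
             cylinder (x k j) (P k j) (49 * rad k)) \<and>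
        \<comment> \<open>8\<close>
        (\<forall>k. \<forall>y\<in>S k. \<exists>Q A. is_plane d Q \<and> y \<in> Q \<and> A ` Q \<subseteq> perp Q \<and>
           (C * \<epsilon>)-lipschitz_on Q A \<and> C2_on_plane Q A \<and>
           S k \<inter> cball y (19 * rad k) = graph_over Q A \<inter> cball y (19 * rad k)) \<and>
        \<comment> \<open>9\<close>
        (\<forall>z\<in>\<Sigma>. \<forall>t. 0 < t \<and> t < 1 \<longrightarrow> (\<exists>Q. is_plane d Q \<and> ball_dist z t \<Sigma> Q \<le> C * \<epsilon>)) \<and>
        \<comment> \<open>10\<close>
        (\<forall>k. \<forall>y\<in>S k. norm (\<sigma> k y - y) \<le> C * \<epsilon> * rad k \<and> infdist y \<Sigma> \<le> C * \<epsilon> * rad k) \<and>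
        \<comment> \<open>11\<close>
        (\<forall>k. \<forall>y\<in>S k \<inter> V_set J x k 8. \<forall>i\<in>J k. y \<in> cball (x k i) (10 * rad k) \<longrightarrow>
           norm (\<sigma> k y - plane_proj (P k i) y) \<le> C * eps_at J x P k y * rad k) \<and>
        \<comment> \<open>12\<close>
        (\<forall>k. \<forall>y\<in>S k. \<forall>z\<in>S k.
           plane_angle (tangent_space (S k) y) (tangent_space (S k) z) \<le> C * \<epsilon> * (norm (y - z) / rad k)) \<and>
        \<comment> \<open>13\<close>
        (\<forall>z\<in>\<Sigma>. \<forall>r>0. ennreal (r ^ d) \<le> ennreal C * hausdorff_content d (\<Sigma> \<inter> cball z r))))"
proof -
  let ?C2 = "C2 d c"
  \<comment> \<open>The first summand is for flatness, whose bound \<open>20 * \<gamma>\<close> is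
    the largest multiple of \<epsilon>; the second is for the content.\<close>
  define C where "C = 20 * ?C2 + (4 * real d) ^ d"
  have C2: "?C2 \<ge> 60000" by (rule C2_large[OF d])
  have C: "C > 0" "20 * ?C2 \<le> C" "(4 * real d) ^ d \<le> C" "60000 \<le> C"
    using C2 unfolding C_def by (auto intro: add_pos_nonneg add_increasing2)
  have e0: "1 / (10 ^ 6 * real d * ?C2) > 0" using d C2 by simp
  show ?thesis
    unfolding Let_def
  proof (rule exI[of _ "1 / (10 ^ 6 * real d * ?C2)"], rule conjI[OF e0], rule exI[of _ C], rule conjI[OF C(1)],
      intro allI impI, goal_cases)
    case (1 \<epsilon> P0 J x P \<theta>)
    have "10 ^ 6 * real d * ?C2 * \<epsilon> \<le> 1"
      using 1(1) d C2 by (simp add: less_divide_eq mult_ac)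
    then interpret coherent_collection d c \<epsilon> P0 J x P \<theta>
      using 1 d by unfold_locales auto
    have \<gamma>C: "20 * \<gamma> \<le> C * \<epsilon>" using mult_right_mono[OF C(2), of \<epsilon>] eps0 by (simp add: \<gamma>_def)
    have Ce: "\<gamma> \<le> C * \<epsilon>" "\<delta> \<le> C * \<epsilon>" "24 * \<delta> \<le> C * \<epsilon>" "2 * \<gamma> \<le> C * \<epsilon>"
      using \<gamma>C \<gamma>_pos delta24(1) small_bounds(9) by linarith+
    show ?case
    proof (intro conjI)
      show "bij_betw f P0 \<Sigma>" using f_inj by (simp add: bij_betw_def)
      show "(\<Inter>K\<in>{1..}. closure (\<Union>k\<in>{K..}. x k ` J k)) \<subseteq> \<Sigma>" by (rule centres_limit_subset)
      \<comment> \<open>The domain of \<open>f\<close> is \<open>P0\<close>, whose points have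
        distance 0 from it.\<close>
      show "\<forall>y\<in>P0. infdist y P0 > 2 \<longrightarrow> f y = y" by (simp add: infdist_zero)
      show "\<exists>\<tau>. 0 < \<tau> \<and> \<tau> < 1 \<and> (\<forall>y\<in>P0. \<forall>z\<in>P0. norm (y - z) \<le> 1 \<longrightarrow>
           1 / 4 * norm (y - z) powr (1 + \<tau>) \<le> norm (f y - f z) \<and>
           norm (f y - f z) \<le> 10 * norm (y - z) powr (1 - \<tau>))"
        using bi_hoelder by (intro exI[of _ "1/2"]) auto
      show "\<forall>y\<in>P0. norm (f y - y) \<le> C * \<epsilon>"
      proof
        fix y assume "y \<in> P0"
        from f_dist[OF this, of 0] show "norm (f y - y) \<le> C * \<epsilon>" using Ce(3) by simp
      qed
      show "\<forall>y\<in>P0. (\<lambda>k. fold \<sigma> [0..<Suc k] y) \<longlonglongrightarrow> f y"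
      proof
        fix y assume "y \<in> P0"
        then have "(\<lambda>n. f_seq \<sigma> n y) \<longlonglongrightarrow> f y" using fs_convergent[of y 0] by (simp add: fs_0 FF_0)
        from LIMSEQ_Suc[OF this] show "(\<lambda>k. fold \<sigma> [0..<Suc k] y) \<longlonglongrightarrow> f y" unfolding fold_f_seq .
      qed
      show "\<forall>k. \<forall>y. y \<notin> V_set J x k 10 \<longrightarrow> \<sigma> k y = y" using sigma_id by blast
      show "\<forall>k. \<forall>j\<in>J k. \<exists>A.
           A ` (P k j \<inter> cball (x k j) (49 * rad k)) \<subseteq> perp (P k j) \<and>
           (\<exists>L. L-lipschitz_on (P k j \<inter> cball (x k j) (49 * rad k)) A) \<and>
           norm (A (x k j)) \<le> C * \<epsilon> * rad k \<and>
           (\<forall>y\<in>P k j \<inter> cball (x k j) (49 * rad k). \<exists>DA.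
              (A has_derivative DA) (at y within P k j \<inter> cball (x k j) (49 * rad k)) \<and>
              (\<forall>v\<in>directions (P k j). norm (DA v) \<le> C * \<epsilon> * norm v)) \<and>
           S k \<inter> cylinder (x k j) (P k j) (49 * rad k) =
             graph_over (P k j \<inter> cball (x k j) (49 * rad k)) A \<inter>
             cylinder (x k j) (P k j) (49 * rad k)"
      proof (intro allI ballI)
        fix k j assume j: "j \<in> J k"
        have le: "\<delta> * a \<le> C * \<epsilon> * a" if "a \<ge> 0" for a using Ce(2) that by (rule mult_right_mono)
        let ?U = "P k j \<inter> cball (x k j) (49 * rad k)" and ?D = "cylinder (x k j) (P k j) (49 * rad k)"
        obtain A where A: "A ` ?U \<subseteq> perp (P k j)" "\<exists>L. L-lipschitz_on ?U A" "norm (A (x k j)) \<le> \<delta> * rad k"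
          "\<forall>y\<in>?U. \<exists>DA. (A has_derivative DA) (at y within ?U) \<and> (\<forall>v\<in>directions (P k j). norm (DA v) \<le> \<delta> * norm v)"
          "S k \<inter> ?D = graph_over ?U A \<inter> ?D"
          using graph_in_cylinder[OF j] by (elim exE conjE) (rule that, assumption, rule exI, assumption+)
        show "\<exists>A. A ` ?U \<subseteq> perp (P k j) \<and> (\<exists>L. L-lipschitz_on ?U A) \<and> norm (A (x k j)) \<le> C * \<epsilon> * rad k \<and>
           (\<forall>y\<in>?U. \<exists>DA. (A has_derivative DA) (at y within ?U) \<and>
              (\<forall>v\<in>directions (P k j). norm (DA v) \<le> C * \<epsilon> * norm v)) \<and>
           S k \<inter> ?D = graph_over ?U A \<inter> ?D"
        proof (rule exI[of _ A], intro conjI A(1,2,5) ballI)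
          show "norm (A (x k j)) \<le> C * \<epsilon> * rad k" using A(3) le[OF rad_nonneg[of k]] by linarith
          fix y assume "y \<in> ?U"
          with A(4) obtain DA where DA: "(A has_derivative DA) (at y within ?U)"
            "\<And>v. v \<in> directions (P k j) \<Longrightarrow> norm (DA v) \<le> \<delta> * norm v" by blast
          show "\<exists>DA. (A has_derivative DA) (at y within ?U) \<and>
              (\<forall>v\<in>directions (P k j). norm (DA v) \<le> C * \<epsilon> * norm v)"
            using DA(1) order_trans[OF DA(2) le[OF norm_ge_zero]] by blast
        qed
      qed
      show "\<forall>k. \<forall>y\<in>S k. \<exists>Q A. is_plane d Q \<and> y \<in> Q \<and> A ` Q \<subseteq> perp Q \<and>
           (C * \<epsilon>)-lipschitz_on Q A \<and> C2_on_plane Q A \<and>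
           S k \<inter> cball y (19 * rad k) = graph_over Q A \<inter> cball y (19 * rad k)"
      proof (intro allI ballI)
        fix k y assume y: "y \<in> S k"
        obtain Q A where lg: "local_graph k y Q A" using local_graph_exists[OF y] by blast
        note l = local_graphD[OF lg]
        have "(C * \<epsilon>)-lipschitz_on Q A"
        proof (rule lipschitz_onI)
          fix p q
          show "dist (A p) (A q) \<le> C * \<epsilon> * dist p q"
            using l(8)[of p q] mult_right_mono[OF Ce(1), of "norm (p - q)"] by (simp add: dist_norm)
        qed (use C(1) eps0 in simp)
        then show "\<exists>Q A. is_plane d Q \<and> y \<in> Q \<and> A ` Q \<subseteq> perp Q \<and>
           (C * \<epsilon>)-lipschitz_on Q A \<and> C2_on_plane Q A \<and>
           S k \<inter> cball y (19 * rad k) = graph_over Q A \<inter> cball y (19 * rad k)"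
          using l(1,2,4,7) C2_on_plane_c2[OF l(3)] by (intro exI[of _ Q] exI[of _ A]) auto
      qed
      show "\<forall>z\<in>\<Sigma>. \<forall>t. 0 < t \<and> t < 1 \<longrightarrow> (\<exists>Q. is_plane d Q \<and> ball_dist z t \<Sigma> Q \<le> C * \<epsilon>)"
        using reifenberg_flat \<gamma>C by (meson order_trans)
      show "\<forall>k. \<forall>y\<in>S k. norm (\<sigma> k y - y) \<le> C * \<epsilon> * rad k \<and> infdist y \<Sigma> \<le> C * \<epsilon> * rad k"
      proof (intro allI ballI)
        fix k y assume y: "y \<in> S k"
        have "21 * \<delta> * rad k \<le> 24 * \<delta> * rad k" "24 * \<delta> * rad k \<le> C * \<epsilon> * rad k"
          using Ce(3) small_bounds(9) by (auto intro!: mult_right_mono)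
        then show "norm (\<sigma> k y - y) \<le> C * \<epsilon> * rad k \<and> infdist y \<Sigma> \<le> C * \<epsilon> * rad k"
          using displacement[OF y] infdist_limit_surface[OF y] by linarith
      qed
      show "\<forall>k. \<forall>y\<in>S k \<inter> V_set J x k 8. \<forall>i\<in>J k. y \<in> cball (x k i) (10 * rad k) \<longrightarrow>
           norm (\<sigma> k y - \<pi> k i y) \<le> C * eps_at J x P k y * rad k"
      proof (intro allI ballI impI)
        fix k y i assume y: "y \<in> S k \<inter> V_set J x k 8" and i: "i \<in> J k" and yi: "y \<in> cball (x k i) (10 * rad k)"
        have n: "norm (y - x k i) \<le> 10 * rad k" using yi by (simp add: dist_norm norm_minus_commute)
        have s: "norm (\<sigma> k y - \<pi> k i y) \<le> 60000 * eps_at J x P k y * rad k"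
          by (rule sigma_near_projection[OF _ i n]) (use y in simp)
        \<comment> \<open>The sign of \<open>eps_at\<close> is read off from the estimate itself,
          which bounds a norm.\<close>
        have "0 \<le> 60000 * eps_at J x P k y * rad k" using s norm_ge_zero order_trans by blast
        then have "0 \<le> eps_at J x P k y" using rad_pos[of k] by (auto simp: zero_le_mult_iff not_le simp del: rad_pos)
        then have "60000 * eps_at J x P k y * rad k \<le> C * eps_at J x P k y * rad k"
          using C(4) by (intro mult_right_mono) auto
        then show "norm (\<sigma> k y - \<pi> k i y) \<le> C * eps_at J x P k y * rad k" using s by linarith
      qed
      show "\<forall>k. \<forall>y\<in>S k. \<forall>z\<in>S k. plane_angle (TS k y) (TS k z) \<le> C * \<epsilon> * (norm (y - z) / rad k)"
      proof (intro allI ballI)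
        fix k y z assume yz: "y \<in> S k" "z \<in> S k"
        have "2 * \<gamma> * (norm (y - z) / rad k) \<le> C * \<epsilon> * (norm (y - z) / rad k)"
          using Ce(4) by (intro mult_right_mono) auto
        then show "plane_angle (TS k y) (TS k z) \<le> C * \<epsilon> * (norm (y - z) / rad k)"
          using tangent_angle[OF yz] by linarith
      qed
      show "\<forall>z\<in>\<Sigma>. \<forall>r>0. ennreal (r ^ d) \<le> ennreal C * hausdorff_content d (\<Sigma> \<inter> cball z r)"
      proof (intro ballI allI impI)
        fix z r assume z: "z \<in> \<Sigma>" and r: "(0::real) < r"
        have "ennreal ((4 * real d) ^ d) * hausdorff_content d (\<Sigma> \<inter> cball z r) \<le>
            ennreal C * hausdorff_content d (\<Sigma> \<inter> cball z r)"
          by (intro mult_right_mono ennreal_leI C(3)) simp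
        then show "ennreal (r ^ d) \<le> ennreal C * hausdorff_content d (\<Sigma> \<inter> cball z r)"
          using limit_surface_content[OF z r] by (rule order_trans[rotated])
      qed
    qed
  qed
qed

end
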